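(* Let $a,b,k$ be integers with $0\leq a,b\leq k$, and let $\nu=(\nu_1,\nu_2,\nu_3):=(a+b+2,b+1,0)$. Then, as an identity of formal power series in $x_1/x_2$ and $x_2/x_3$, \begin{align*} &\sum_{\substack{\lambda_1\geq\cdots\geq\lambda_k\geq 0\\ \mu_1\geq\cdots\geq\mu_k\geq 0}} \Big(1-\frac{x_1}{x_3}q^{\lambda_a+\mu_b-1}\Big)\prod_{i=1}^k \frac{(x_1/x_2)^{\lambda_i}(x_2/x_3)^{\mu_i}q^{\lambda_i^2-\lambda_i\mu_i+\mu_i^2-\chi(i\le a)\lambda_i-\chi(i\le b)\mu_i}}{(q;q)_{\lambda_i-\lambda_{i+1}}(q;q)_{\mu_i-\mu_{i+1}}}\\ &\quad=\sum_{y\in Q_+}\frac{\det_{1\le i,j\le 3}\big((x_iq^{y_i})^{\nu_i-\nu_j}\big)}{\prod_{1\le i<j\le 3}(x_i/x_j;q)_\infty}\prod_{i=1}^3\frac{x_i^{(k+2)y_i}q^{(k+2)\binom{y_i}{2}-\nu_iy_i}(x_i/x_3;q)_{y_i}}{(qx_i/x_1;q)_{y_i}}, \end{align*} where $\lambda_{k+1}=\mu_{k+1}:=0$ and $q^{\lambda_0}=q^{\mu_0}:=0$.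
   Context: $(a;q)_\infty=\prod_{j\ge0}(1-aq^j)$ and $(a;q)_n=(a;q)_\infty/(aq^n;q)_\infty$ for all $n\in\mathbb{Z}$ (so for $n<0$, $(a;q)_n=1/\prod_{j=1}^{-n}(1-aq^{-j})$). $\chi(\cdot)$ is the indicator function of the condition. $Q_+:=\{y=(y_1,y_2,y_3)\in\mathbb{Z}^3: y_1+y_2+y_3=0,\ y_1\ge0,\ y_1+y_2\ge0\}$. *)

theory Defs
  imports "HOL-Analysis.Infinite_Sum"
          "HOL-Computational_Algebra.Formal_Laurent_Series"
          "HOL-Combinatorics.Permutations"
begin

text \<open>Two-variable formal Laurent series: the field K((z1))((z2)), where the
  inner variable z1 stands for x1/x2 and the outer variable z2 for x2/x3.
  Every rational expression in the statement is expanded in this field.\<close>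
type_synonym ser = "complex fls fls"

definition Z1 :: ser where "Z1 = fls_const fls_X"
definition Z2 :: ser where "Z2 = fls_X"
definition cst :: "complex \<Rightarrow> ser" where "cst c = fls_const (fls_const c)"

definition coeff2 :: "ser \<Rightarrow> int \<Rightarrow> int \<Rightarrow> complex" where
  "coeff2 F m n = fls_nth (fls_nth F n) m"

definition qpoch :: "'a::field \<Rightarrow> 'a \<Rightarrow> int \<Rightarrow> 'a" where
  "qpoch a q n = (if 0 \<le> n then (\<Prod>j<nat n. 1 - a * q ^ j)
                  else 1 / (\<Prod>j\<in>{1..nat (- n)}. 1 - a * inverse q ^ j))"

definition qinf_fps :: "complex \<Rightarrow> complex fps" where
  "qinf_fps q = Abs_fps (\<lambda>n. lim (\<lambda>N. (\<Prod>j<N. 1 - fps_const (q ^ j) * fps_X) $ n))"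

definition at_z1 :: "complex fps \<Rightarrow> ser" where
  "at_z1 f = fls_const (fps_to_fls f)"
definition at_z2 :: "complex fps \<Rightarrow> ser" where
  "at_z2 f = fps_to_fls (Abs_fps (\<lambda>n. fls_const (f $ n)))"
definition at_z1z2 :: "complex fps \<Rightarrow> ser" where
  "at_z1z2 f = fps_to_fls (Abs_fps (\<lambda>n. fls_const (f $ n) * fls_X ^ n))"

text \<open>Partitions with at most k parts: lambda_1 \<ge> ... \<ge> lambda_k \<ge> 0, stored as
  functions on indices 1..k, with value 0 outside (so lambda_(k+1) = 0).\<close>
definition Parts :: "nat \<Rightarrow> (nat \<Rightarrow> nat) set" where
  "Parts k = {l. (\<forall>i. 1 \<le> i \<longrightarrow> i < k \<longrightarrow> l (Suc i) \<le> l i) \<and> (\<forall>i. (i = 0 \<or> k < i) \<longrightarrow> l i = 0)}"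

definition Qplus :: "(int \<times> int \<times> int) set" where
  "Qplus = {(y1, y2, y3). y1 + y2 + y3 = 0 \<and> y1 \<ge> 0 \<and> y1 + y2 \<ge> 0}"

definition chi :: "bool \<Rightarrow> int" where "chi P = (if P then 1 else 0)"

text \<open>Summand of the left-hand side (x1/x3 = z1*z2; q^(lambda_0) = q^(mu_0) = 0).\<close>
definition lhs_term :: "complex \<Rightarrow> nat \<Rightarrow> nat \<Rightarrow> nat \<Rightarrow> (nat \<Rightarrow> nat) \<Rightarrow> (nat \<Rightarrow> nat) \<Rightarrow> ser" where
  "lhs_term q a b k l u =
     (1 - Z1 * Z2 * (if a = 0 \<or> b = 0 then 0
                     else cst (q powi (int (l a) + int (u b) - 1))))
     * (\<Prod>i\<in>{1..k}.
          Z1 ^ l i * Z2 ^ u i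
          * cst (q powi (int (l i)^2 - int (l i) * int (u i) + int (u i)^2
                         - chi (i \<le> a) * int (l i) - chi (i \<le> b) * int (u i)))
          / cst (qpoch q q (int (l i) - int (l (Suc i))) * qpoch q q (int (u i) - int (u (Suc i)))))"

text \<open>The variables x1, x2, x3; the summands on the right are homogeneous of
  degree 0 in x, so we may normalise x3 = 1, x2 = z2, x1 = z1*z2.\<close>
definition xv :: "nat \<Rightarrow> ser" where
  "xv i = (if i = 1 then Z1 * Z2 else if i = 2 then Z2 else 1)"

definition nu :: "nat \<Rightarrow> nat \<Rightarrow> nat \<Rightarrow> int" where
  "nu a b i = (if i = 1 then int a + int b + 2 else if i = 2 then int b + 1 else 0)"

definition yv :: "int \<times> int \<times> int \<Rightarrow> nat \<Rightarrow> int" where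
  "yv y i = (case y of (y1, y2, y3) \<Rightarrow> if i = 1 then y1 else if i = 2 then y2 else y3)"

definition binom2 :: "int \<Rightarrow> int" where "binom2 y = y * (y - 1) div 2"

definition det3 :: "(nat \<Rightarrow> nat \<Rightarrow> 'a::comm_ring_1) \<Rightarrow> 'a" where
  "det3 M = (\<Sum>p\<in>{p. p permutes {1,2,3}}. of_int (sign p) * (\<Prod>i\<in>{1,2,3}. M i (p i)))"

definition rhs_term :: "complex \<Rightarrow> nat \<Rightarrow> nat \<Rightarrow> nat \<Rightarrow> int \<times> int \<times> int \<Rightarrow> ser" where
  "rhs_term q a b k y =
     det3 (\<lambda>i j. (xv i * cst q powi yv y i) powi (nu a b i - nu a b j))
     / (at_z1 (qinf_fps q) * at_z1z2 (qinf_fps q) * at_z2 (qinf_fps q))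
     * (\<Prod>i\<in>{1,2,3}.
          xv i powi ((int k + 2) * yv y i)
          * cst q powi ((int k + 2) * binom2 (yv y i) - nu a b i * yv y i)
          * qpoch (xv i / xv 3) (cst q) (yv y i)
          / qpoch (cst q * xv i / xv 1) (cst q) (yv y i))"

end

theory Submission
  imports Defs
begin

text \<open>
  Columns are functions of (L, M) with values in series. Put w = z1 z2 and let t be the transfer operator
  sending f to z1^L z2^M q^(L^2 - L M + M^2) (\<Sum>l j. f(l, j) / ((q;q)_(L-l) (q;q)_(M-j))). The left-hand side
  is the sum over all positions of W(a, b) - (w/q) W(a-1, b-1), where W(a, b) is a word in t, P = q^(-L) and
  R = q^(-M), applied to the unit vector at the origin.
  The two Hamiltonians H1, H2 of the finite q-difference Toda chain commute with t, and since summing over all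
  positions kills the images of 1 - (shift), one can show by induction on k that, as row vectors,
  this difference equals s(H1, H2) t^k, where s is the Schur function of shape (a+b, b, 0).
  The joint eigenvectors of H1, H2 and t are explicit products indexed by y in Q+, with
  H1 and H2 acting as elementary symmetric functions of the 1/(x_i q^(y_i)). Expanding the unit vector in
  eigenvectors, which is a telescoping sum, and replacing the Schur function by
  its bialternant gives the right-hand side term by term.
\<close>

section \<open>A noncommutative algebra of Toda type\<close>

text \<open>The correction with w/q is forced by noncommutativity. Moving \<open>1 - T\<close> past
  \<open>R\<close> turns it into \<open>1 - u * T\<close>, so modulo the images of
  \<open>1 - S\<close> and \<open>1 - T\<close> the product \<open>R * H1\<close> equals
  \<open>P * R + w * (1 - u)\<close>. Hence not \<open>P * R\<close> but
  \<open>P * R - w * u\<close> plays the role of e1 e2 - e3; this explains the factor with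
  q^(lambda_a + mu_b - 1). The scalars come from normalising by x_1. For y = (r, s - r, -s), the
  eigenvalues of \<open>H1\<close> and \<open>z1 * H2\<close>, and the scalar \<open>z1 * w\<close>,
  are x_1 e1, x_1^2 e2 and x_1^3 e3 in the variables 1/(x_i q^(y_i)). The infinite products arise
  from the eigenvalue equation of t itself, read far away from the origin. The exponent k + 2 on the
  right counts eigenvalues of t: k from t^k, one from summing an eigenvector over all positions, and
  one hidden in the expansion coefficients of the unit vector. All infinite sums are controlled by
  degree: entries at (L, M) are divisible by z1^L z2^M up to a bounded loss, so each coefficient
  sees finitely many positions.\<close>

text \<open>The word belonging to (a, b, k), with A = a + 1 and B = b + 1 so that the index 0 stands for -1.
  The innermost factor at position k + 1 is 1 unless a or b exceeds k; it is kept to make the induction work.\<close>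

definition row :: "'r::ring_1 \<Rightarrow> 'r \<Rightarrow> 'r \<Rightarrow> nat \<Rightarrow> nat \<Rightarrow> nat \<Rightarrow> 'r" where
  "row P R t k A B = (if A = 0 \<or> B = 0 then 0 else
     prod_list (map (\<lambda>i. (if i < A then P else 1) * (if i < B then R else 1) * t) [1..<Suc k])
     * ((if Suc k < A then P else 1) * (if Suc k < B then R else 1)))"

text \<open>P, R are q^(-L), q^(-M) with inverses P', R'; S, T are the unit shifts in L, M; t is the transfer operator;
  u is 1/q.\<close>

locale toda =
  fixes P P' R R' S T t z1 z2 w u :: "'r::ring_1"
  assumes comm: "P * R = R * P" "P' * R = R * P'" "P * R' = R' * P" "P' * R' = R' * P'"
      "S * R = R * S" "S * R' = R' * S" "T * P = P * T" "T * P' = P' * T" "S * T = T * S"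
    and inv: "P * P' = 1" "P' * P = 1" "R * R' = 1" "R' * R = 1"
    and shift: "P * S = u * (S * P)" "R * T = u * (T * R)"
    and tau_P: "t * P = P * t - z1 * (S * P' * R * t)"
    and tau_R: "t * R = R * t - z2 * (T * R' * P * t)"
    and tau_S: "t * (1 - S) * P' = P' * t"
    and tau_T: "t * (1 - T) * R' = R' * t"
    and central: "\<And>x. x * z1 = z1 * x" "\<And>x. x * z2 = z2 * x" "\<And>x. x * w = w * x" "\<And>x. x * u = u * x"
    and w_def: "w = z1 * z2"
begin

text \<open>Only the first summand survives in the row vector of all positions, since the others
  begin, up to central factors, with \<open>1 - S\<close> or \<open>1 - T\<close>.\<close>

definition H1 where "H1 = P + z1 * ((1 - S) * P' * R) + w * ((1 - T) * R')"
definition H2 where "H2 = R + z2 * ((1 - T) * R' * P) + w * ((1 - S) * P')"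

text \<open>Equality of the row vectors obtained by summing over all positions, which S and T leave invariant.\<close>

definition row_eq (infix "\<approx>" 50) where
  "x \<approx> y \<longleftrightarrow> (\<exists>a b. x - y = (1 - S) * a + (1 - T) * b)"

lemma add_diff_add: "(x::'r) + x' - (y + y') = (x - y) + (x' - y')"
  by (simp add: algebra_simps)

lemma row_eq_refl [simp]: "x \<approx> x"
  unfolding row_eq_def by (rule exI[of _ 0], rule exI[of _ 0]) simp

lemma row_eqI: "x = y \<Longrightarrow> x \<approx> y" by simp

lemma row_eq_add: "x \<approx> y \<Longrightarrow> x' \<approx> y' \<Longrightarrow> x + x' \<approx> y + y'"
proof -
  assume "x \<approx> y" "x' \<approx> y'"
  then obtain a b a' b' where "x - y = (1 - S) * a + (1 - T) * b" "x' - y' = (1 - S) * a' + (1 - T) * b'"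
    unfolding row_eq_def by blast
  then have "x + x' - (y + y') = (1 - S) * (a + a') + (1 - T) * (b + b')"
    by (metis (no_types, lifting) add.left_commute add.assoc add_diff_add distrib_left)
  then show ?thesis unfolding row_eq_def by blast
qed

lemma row_eq_mult: "x \<approx> y \<Longrightarrow> x * c \<approx> y * c"
proof -
  assume "x \<approx> y"
  then obtain a b where "x - y = (1 - S) * a + (1 - T) * b" unfolding row_eq_def by blast
  then have "x * c - y * c = (1 - S) * (a * c) + (1 - T) * (b * c)"
    by (metis (no_types, lifting) distrib_right left_diff_distrib mult.assoc)
  then show ?thesis unfolding row_eq_def by blast
qed

lemma row_eq_cmult: "(\<And>x. x * c = c * x) \<Longrightarrow> x \<approx> y \<Longrightarrow> c * x \<approx> c * y"
  using row_eq_mult by metis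

lemma row_eq_minus: "x \<approx> y \<Longrightarrow> - x \<approx> - y"
proof -
  assume "x \<approx> y"
  then have "x * - 1 \<approx> y * - 1" by (rule row_eq_mult)
  then show ?thesis by simp
qed

lemma row_eq_diff: "x \<approx> y \<Longrightarrow> x' \<approx> y' \<Longrightarrow> x - x' \<approx> y - y'"
  using row_eq_add[OF _ row_eq_minus] by fastforce

lemma row_eq_sym: "x \<approx> y \<Longrightarrow> y \<approx> x"
proof -
  assume "x \<approx> y"
  then have "y + x + - x \<approx> y + x + - y" by (intro row_eq_add row_eq_minus row_eq_refl)
  then show ?thesis by simp
qed

lemma row_eq_trans [trans]: "x \<approx> y \<Longrightarrow> y \<approx> z \<Longrightarrow> x \<approx> z"
proof -
  assume "x \<approx> y" "y \<approx> z"
  then have "x + y - y \<approx> y + z - y" by (intro row_eq_add row_eq_diff row_eq_refl)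
  then show ?thesis by simp
qed

lemma row_eq_diffI: "x - y = d \<Longrightarrow> d \<approx> 0 \<Longrightarrow> x \<approx> y"
  by (auto simp: row_eq_def)

lemma row_eq_cmult_0: "(\<And>x. x * c = c * x) \<Longrightarrow> x \<approx> 0 \<Longrightarrow> c * x \<approx> 0"
  using row_eq_cmult[of c x 0] by simp

lemma row_eq_mult_0: "x \<approx> 0 \<Longrightarrow> x * c \<approx> 0"
  using row_eq_mult[of x 0 c] by simp

lemma row_eq_iff_diff: "x \<approx> y \<longleftrightarrow> x - y \<approx> 0"
  by (simp add: row_eq_def)

lemma row_eq_diff_0: "x \<approx> 0 \<Longrightarrow> y \<approx> 0 \<Longrightarrow> x - y \<approx> 0"
  using row_eq_diff[of x 0 y 0] by simp

lemma row_eq_0: "(1 - S) * x \<approx> 0" "(1 - T) * x \<approx> 0"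
  unfolding row_eq_def
  by (rule exI[of _ x], rule exI[of _ 0], simp, rule exI[of _ 0], rule exI[of _ x], simp)

text \<open>\<open>tau_S\<close> and \<open>tau_T\<close> swallow the factors \<open>1 - S\<close>
  and \<open>1 - T\<close>, so with \<open>t\<close> in front the Hamiltonians become free of
  shifts.\<close>

lemma tau_H1: "t * H1 = t * P + z1 * (P' * t * R) + w * (R' * t)"
proof -
  have "t * (z1 * ((1 - S) * P' * R)) = z1 * (t * (1 - S) * P' * R)"
    by (metis central(1) mult.assoc)
  moreover have "t * (w * ((1 - T) * R')) = w * (t * (1 - T) * R')"
    by (metis central(3) mult.assoc)
  ultimately show ?thesis by (simp add: H1_def distrib_left tau_S tau_T)
qed

lemma tau_H2: "t * H2 = t * R + z2 * (R' * t * P) + w * (P' * t)"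
proof -
  have "t * (z2 * ((1 - T) * R' * P)) = z2 * (t * (1 - T) * R' * P)"
    by (metis central(2) mult.assoc)
  moreover have "t * (w * ((1 - S) * P')) = w * (t * (1 - S) * P')"
    by (metis central(3) mult.assoc)
  ultimately show ?thesis by (simp add: H2_def distrib_left tau_S tau_T)
qed

text \<open>Exchange of the two coordinates. Each statement about growing \<open>A\<close> thereby
  yields one about growing \<open>B\<close>.\<close>

lemma symmetric: "toda R R' P P' T S t z2 z1 w u"
  by unfold_locales
    ((rule comm comm[symmetric] inv shift tau_P tau_R tau_S tau_T central) | metis w_def central(1))+


section \<open>Normal ordering, and the step that lengthens a word by one \<open>P\<close>\<close>

lemma comm_left:
  "R * (P * x) = P * (R * x)" "R * (P' * x) = P' * (R * x)"
  "R' * (P * x) = P * (R' * x)" "R' * (P' * x) = P' * (R' * x)"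
  "R * (S * x) = S * (R * x)" "R' * (S * x) = S * (R' * x)"
  "P * (T * x) = T * (P * x)" "P' * (T * x) = T * (P' * x)" "T * (S * x) = S * (T * x)"
  "P * (P' * x) = x" "P' * (P * x) = x" "R * (R' * x) = x" "R' * (R * x) = x"
  by (simp_all add: comm inv flip: mult.assoc)

lemma tau_left:
  "t * (P * x) = P * (t * x) - z1 * (S * (P' * (R * (t * x))))"
  "t * (R * x) = R * (t * x) - z2 * (T * (R' * (P * (t * x))))"
proof -
  have "t * (P * x) = (t * P) * x" "t * (R * x) = (t * R) * x" by (simp_all add: mult.assoc)
  then show "t * (P * x) = P * (t * x) - z1 * (S * (P' * (R * (t * x))))"
    "t * (R * x) = R * (t * x) - z2 * (T * (R' * (P * (t * x))))"
    by (simp_all add: tau_P tau_R left_diff_distrib mult.assoc)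
qed

lemma central_left:
  "z1 * (u * x) = u * (z1 * x)" "z2 * (u * x) = u * (z2 * x)" "w * (u * x) = u * (w * x)"
  "w * (z1 * x) = z1 * (w * x)" "w * (z2 * x) = z2 * (w * x)"
  "z1 * (z2 * x) = w * x" "z2 * (z1 * x) = w * x"
  using central by (metis mult.assoc w_def)+

lemma scal:
  "x * (z1 * y) = z1 * (x * y)" "x * (z2 * y) = z2 * (x * y)"
  "x * (w * y) = w * (x * y)" "x * (u * y) = u * (x * y)"
  using central by (metis mult.assoc)+

lemma central_prod: "x * (w * u) = w * u * x" "x * (z1 * w) = z1 * w * x"
  using central by (metis mult.assoc)+

text \<open>Normal order: \<open>t\<close> is pushed to the right and \<open>P\<close> stands before
  \<open>R\<close>. The products \<open>P * S\<close> and \<open>R * T\<close> are left alone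
  because reordering them costs a factor \<open>u\<close>; \<open>shift_left\<close> supplies this
  where it is wanted.\<close>

lemmas nf = comm_left tau_left tau_P tau_R central_left comm(1-4)[symmetric]
  comm(5-6)[symmetric] comm(7-8)[symmetric] comm(9)[symmetric] inv
lemmas scal_gen = scal[where x=P] scal[where x=R] scal[where x=S] scal[where x=T]
  scal[where x=t] scal[where x=P'] scal[where x=R']

text \<open>The recursion h(a+1) = e1 h(a) - e2 h(a-1) + e3 h(a-2) for Schur functions with growing first row,
  transported to words.\<close>

lemma step_core:
  assumes h1: "\<alpha> * (1 - S) * P' \<approx> \<alpha>2"
    and h2: "\<beta> * (1 - S) * P' \<approx> \<gamma>"
    and h3: "\<beta> * S * (1 - T) * R' \<approx> z1 * (\<gamma> * (1 - S) * P' - \<gamma>2)"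
  shows "(\<alpha> * P - w * u * \<beta>) * t * H1 - z1 * ((\<alpha> - w * u * \<gamma>) * t * H2)
       + z1 * w * ((\<alpha>2 - w * u * \<gamma>2) * t)
     \<approx> \<alpha> * P * t * P - w * u * (\<beta> * P * t)" (is "?l \<approx> ?r")
proof -
  \<comment> \<open>\<open>\<gamma>\<close> is only equivalent to \<open>g\<close>, but for
    \<open>g\<close> the products with \<open>P\<close> can be computed. After the replacement, the
    difference of the two sides is an exact ring identity whose right side consists of multiples of
    the defects in \<open>h1\<close> and \<open>h3\<close>.\<close>
  define g where "g = \<beta> * (1 - S) * P'"
  have g1: "g * (P * x) = \<beta> * x - \<beta> * (S * x)"
      "g * (T * (P * x)) = \<beta> * (T * x) - \<beta> * (S * (T * x))"
      "g * (R * x) = \<beta> * (P' * (R * x)) - \<beta> * (S * (P' * (R * x)))" for x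
    by (simp_all add: g_def mult.assoc left_diff_distrib right_diff_distrib nf)
  define l' where "l' = (\<alpha> * P - w * u * \<beta>) * t * H1 - z1 * ((\<alpha> - w * u * g) * t * H2)
       + z1 * w * ((\<alpha>2 - w * u * \<gamma>2) * t)"
  have "?l \<approx> l'"
    unfolding l'_def using row_eq_sym[OF h2, folded g_def]
    by (intro row_eq_add row_eq_diff row_eq_cmult[OF central(1)] row_eq_cmult[OF central_prod(1)] row_eq_mult row_eq_refl)
  moreover have "l' - ?r = w * (z1 * ((\<alpha>2 - \<alpha> * (1 - S) * P') * t))
     - u * (w * (w * ((\<beta> * S * (1 - T) * R' - z1 * (g * (1 - S) * P' - \<gamma>2)) * t)))"
    unfolding l'_def tau_H1 tau_H2 mult.assoc
    by (simp add: algebra_simps tau_H1 tau_H2 nf scal_gen scal[where x=\<alpha>] scal[where x=\<beta>] scal[where x=g] scal[where x=\<gamma>2] g1)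
  moreover have "w * (z1 * ((\<alpha>2 - \<alpha> * (1 - S) * P') * t))
     - u * (w * (w * ((\<beta> * S * (1 - T) * R' - z1 * (g * (1 - S) * P' - \<gamma>2)) * t))) \<approx> 0"
  proof -
    have "z1 * (\<gamma> * (1 - S) * P' - \<gamma>2) \<approx> z1 * (g * (1 - S) * P' - \<gamma>2)"
      using row_eq_sym[OF h2] unfolding g_def
      by (intro row_eq_cmult[OF central(1)] row_eq_diff row_eq_mult row_eq_refl)
    with h3 have "\<beta> * S * (1 - T) * R' - z1 * (g * (1 - S) * P' - \<gamma>2) \<approx> 0"
      using row_eq_trans row_eq_iff_diff by blast
    moreover have "\<alpha>2 - \<alpha> * (1 - S) * P' \<approx> 0"
      using h1 row_eq_sym row_eq_iff_diff by blast
    ultimately show ?thesis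
      by (meson row_eq_diff_0 row_eq_cmult_0[OF central(1)] row_eq_cmult_0[OF central(3)]
          row_eq_cmult_0[OF central(4)] row_eq_mult_0)
  qed
  ultimately show ?thesis
    using row_eq_diffI row_eq_trans by blast
qed


section \<open>The corner case, where both kinds of letters fill all positions\<close>

lemma shift_left: "P * (S * x) = u * (S * (P * x))" "R * (T * x) = u * (T * (R * x))"
  by (metis mult.assoc shift)+

text \<open>By \<open>R * T = u * (T * R)\<close>, the element \<open>1 - u * T\<close> is
  \<open>R * (1 - T) * R'\<close>. It appears as soon as an \<open>R\<close> stands between
  \<open>t\<close> and a Hamiltonian.\<close>

lemma tau_uT: "t * (1 - u * T) = t - z2 * (T * R' * R' * P * t)"
proof -
  have "t * T = t - R' * t * R"
  proof -
    have "t * (1 - T) * R' * R = R' * t * R" by (simp only: tau_T)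
    then show ?thesis by (simp add: mult.assoc inv algebra_simps)
  qed
  then have "u * (t * T) = u * t - u * (R' * (t * R))" by (simp add: right_diff_distrib mult.assoc)
  also have "\<dots> = z2 * (u * (R' * (T * (R' * (P * t)))))"
    by (simp add: tau_R right_diff_distrib mult.assoc comm_left scal[where x=R'] scal(2)[where x=u])
  also have "u * (R' * (T * (R' * (P * t)))) = T * R' * R' * P * t"
  proof -
    have "u * (R' * (T * x)) = R' * (R * (T * (R' * x)))" for x
      by (simp add: shift_left comm_left scal[where x=R'])
    then show ?thesis by (simp add: comm_left mult.assoc)
  qed
  finally show ?thesis by (simp add: right_diff_distrib scal[where x=t])
qed

lemma tau_R_H1: "t * R * H1 = t * P * R + z1 * (P' * (t * R * R)) + w * (t - z2 * (T * R' * R' * P * t))"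
proof -
  have "R * H1 = P * R + z1 * ((1 - S) * P' * R * R) + w * (1 - u * T)"
    by (simp add: H1_def algebra_simps nf shift_left scal_gen)
  then have "t * R * H1 = t * P * R + z1 * (t * (1 - S) * P' * R * R) + w * (t * (1 - u * T))"
    by (simp add: mult.assoc distrib_left scal_gen)
  then show ?thesis by (simp only: tau_uT tau_S mult.assoc[symmetric])
qed

lemma tau_R_H2: "t * R * H2 = t * R * R + z2 * ((t - z2 * (T * R' * R' * P * t)) * P) + w * (P' * t * R)"
proof -
  have "R * H2 = R * R + z2 * ((1 - u * T) * P) + w * ((1 - S) * P' * R)"
    by (simp add: H2_def algebra_simps nf shift_left scal_gen)
  then have "t * R * H2 = t * R * R + z2 * (t * (1 - u * T) * P) + w * (t * (1 - S) * P' * R)"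
    by (simp add: mult.assoc distrib_left scal_gen)
  then show ?thesis by (simp only: tau_uT tau_S mult.assoc[symmetric])
qed

text \<open>An \<open>R\<close> after the last \<open>t\<close> does not commute with
  \<open>T\<close>, so the argument of \<open>step_core\<close> breaks down. The hypotheses
  therefore concern the word before the last block, and both sides of the recursion contain the same
  number of letters \<open>t\<close>.\<close>

lemma corner_core:
  assumes h1: "\<phi> * (1 - S) * P' \<approx> F"
    and h2: "\<phi> * S * (1 - T) * R' \<approx> z1 * (F * (1 - S) * P' - F')"
  shows "(\<phi> * P * R * t * R - w * u * (\<phi> * R * t)) * H1
       - z1 * ((\<phi> * R * t * R - w * u * (F * R * t)) * H2)
       + z1 * w * (F * R * t * R - w * u * (F' * R * t))
     \<approx> \<phi> * P * R * t * P * R - w * u * (\<phi> * P * R * t)" (is "?l \<approx> ?r")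
proof -
  define g where "g = \<phi> * (1 - S) * P'"
  have g1: "g * (P * x) = \<phi> * x - \<phi> * (S * x)"
      "g * (T * (P * x)) = \<phi> * (T * x) - \<phi> * (S * (T * x))"
      "g * (R * x) = \<phi> * (P' * (R * x)) - \<phi> * (S * (P' * (R * x)))" for x
    by (simp_all add: g_def mult.assoc left_diff_distrib right_diff_distrib nf)
  define l' where "l' = (\<phi> * P * R * t * R - w * u * (\<phi> * R * t)) * H1
       - z1 * ((\<phi> * R * t * R - w * u * (g * R * t)) * H2)
       + z1 * w * (g * R * t * R - w * u * (F' * R * t))"
  have "?l \<approx> l'"
    unfolding l'_def using row_eq_sym[OF h1, folded g_def]
    by (intro row_eq_add row_eq_diff row_eq_cmult[OF central(1)] row_eq_cmult[OF central_prod(1)] row_eq_cmult[OF central_prod(2)] row_eq_mult row_eq_refl)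
  moreover have "l' - ?r = u * (w * (w * ((z1 * (g * (1 - S) * P' - F') - \<phi> * S * (1 - T) * R') * (R * t))))"
  proof -
    \<comment> \<open>This product cancels between the terms with \<open>H1\<close> and
      \<open>H2\<close>; folding it keeps the rules for \<open>t\<close> from expanding it.\<close>
    define X where "X = t * R * R"
    have l': "l' = \<phi> * (P * (R * (t * R * H1))) - w * u * (\<phi> * (R * (t * H1)))
       - z1 * (\<phi> * (R * (t * R * H2)) - w * u * (g * (R * (t * H2))))
       + z1 * w * (g * R * t * R - w * u * (F' * R * t))"
      unfolding l'_def by (simp only: left_diff_distrib mult.assoc)
    show ?thesis
      unfolding l' tau_R_H1 tau_R_H2 tau_H1 tau_H2 X_def[symmetric]
      by (simp add: algebra_simps nf shift_left scal_gen scal[where x=\<phi>] scal[where x=g] scal[where x=F'] g1)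
  qed
  moreover have "u * (w * (w * ((z1 * (g * (1 - S) * P' - F') - \<phi> * S * (1 - T) * R') * (R * t)))) \<approx> 0"
  proof -
    have "z1 * (F * (1 - S) * P' - F') \<approx> z1 * (g * (1 - S) * P' - F')"
      using row_eq_sym[OF h1] unfolding g_def
      by (intro row_eq_cmult[OF central(1)] row_eq_diff row_eq_mult row_eq_refl)
    with h2 have "z1 * (g * (1 - S) * P' - F') - \<phi> * S * (1 - T) * R' \<approx> 0"
      using row_eq_trans row_eq_sym row_eq_iff_diff by blast
    then show ?thesis
      by (meson row_eq_cmult_0[OF central(3)] row_eq_cmult_0[OF central(4)] row_eq_mult_0)
  qed
  ultimately show ?thesis
    using row_eq_diffI row_eq_trans by blast
qed


section \<open>Words as row vectors and their recursions\<close>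

abbreviation "rw \<equiv> row P R t"

lemma row_Suc:
  "rw (Suc k) A B = rw k A B * t * ((if Suc (Suc k) < A then P else 1) * (if Suc (Suc k) < B then R else 1))"
  by (simp add: row_def mult.assoc)

lemma row_0: "rw 0 A B = (if A = 0 \<or> B = 0 then 0 else (if 1 < A then P else 1) * (if 1 < B then R else 1))"
  by (simp add: row_def)

lemma row_zero [simp]: "rw k 0 B = 0" "rw k A 0 = 0"
  by (simp_all add: row_def)

lemma row_swap: "row R P t k B A = rw k A B"
proof -
  have "(if i < B then R else 1) * (if i < A then P else 1) = (if i < A then P else 1) * (if i < B then R else 1)" for i
    by (simp add: comm)
  then show ?thesis by (auto simp: row_def)
qed

lemma row_top:
  assumes "Suc k < A"
  shows "rw k A B = rw k (Suc k) B * P"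
proof -
  have *: "map (\<lambda>i. (if i < A then P else 1) * (if i < B then R else 1) * t) [1..<Suc k] =
    map (\<lambda>i. (if i < Suc k then P else 1) * (if i < B then R else 1) * t) [1..<Suc k]"
    using assms by (intro map_cong) auto
  show ?thesis unfolding row_def * using assms by (simp add: mult.assoc comm del: upt_Suc)
qed

text \<open>\<open>tau_S\<close> carries \<open>P'\<close> through the last \<open>t\<close>, where
  it cancels the \<open>P\<close> in front; for positive \<open>k\<close> the two sides are even
  equal. For \<open>k = 0\<close> the factor \<open>1 - S\<close> moves to the front and is
  killed.\<close>

lemma row_remove: "rw k (Suc k) B * (1 - S) * P' \<approx> rw k k B"
proof (cases k)
  case 0
  have "(if 1 < B then R else 1) * (1 - S) * P' \<approx> 0"
  proof -
    have "(if 1 < B then R else 1) * (1 - S) * P' = (1 - S) * ((if 1 < B then R else 1) * P')"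
      by (simp add: algebra_simps comm_left)
    then show ?thesis by (simp add: row_eq_0)
  qed
  then show ?thesis using 0 by (cases "B = 0") (simp_all add: row_0)
next
  case (Suc j)
  have *: "P * (t * ((1 - S) * P')) = t" by (metis tau_S comm_left(10) mult.assoc)
  have "P * (t * (R * ((1 - S) * P'))) = P * (t * ((1 - S) * P')) * R"
    by (simp add: mult.assoc algebra_simps comm comm_left)
  then have **: "P * (t * (R * ((1 - S) * P'))) = t * R" by (simp add: *)
  show ?thesis using Suc
    by (intro row_eqI) (auto simp: row_Suc row_top mult.assoc * **)
qed

text \<open>By \<open>tau_S\<close>, \<open>P * t * S\<close> equals \<open>P * t - t * P\<close>;
  together with \<open>tau_T\<close> this produces the commutator of \<open>P\<close> and
  \<open>t\<close>, which \<open>tau_P\<close> turns into \<open>z1 * (S * P' * t)\<close>. Writing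
  \<open>S\<close> as 1 - (1 - S) then leads back to \<open>row_remove\<close>. The bound on
  \<open>B\<close> keeps \<open>R\<close>, which does not commute with \<open>T\<close>, out of the
  innermost position.\<close>

lemma row_star:
  assumes "B \<le> Suc k"
  shows "rw k (Suc k) B * S * (1 - T) * R' \<approx> z1 * (rw k k B * (1 - S) * P' - rw k (k - 1) B)"
proof (cases k)
  case 0
  have "S * (1 - T) * R' = (1 - T) * (S * R')" by (simp add: algebra_simps nf)
  then have "S * (1 - T) * R' \<approx> 0" by (simp add: row_eq_0)
  moreover have "B = 0 \<or> B = 1" using assms 0 by auto
  ultimately show ?thesis using 0 by (auto simp: row_0)
next
  case (Suc j)
  define b where "b = rw j (Suc j) B"
  have PtS: "P * (t * S) = P * t - t * P"
  proof -
    have "t * (1 - S) * P' * P = P' * t * P" by (simp only: tau_S)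
    then have "t - t * S = P' * (t * P)" by (simp add: mult.assoc inv right_diff_distrib)
    then have "P * (t - t * S) = t * P" by (simp add: comm_left)
    then show ?thesis by (simp add: algebra_simps)
  qed
  have tT: "t * ((1 - T) * R') = R' * t" by (metis tau_T mult.assoc)
  have "P * (t * (S * ((1 - T) * R'))) = P * (t * S) * ((1 - T) * R')" by (simp add: mult.assoc)
  also have "\<dots> = P * (t * ((1 - T) * R')) - t * ((1 - T) * R') * P"
    unfolding PtS by (simp add: algebra_simps nf(1-13) comm)
  also have "\<dots> = P * (R' * t) - R' * (t * P)" by (simp add: tT mult.assoc)
  also have "\<dots> = z1 * (S * (P' * t))"
    by (simp add: algebra_simps nf scal_gen)
  finally have 1: "P * (t * (S * ((1 - T) * R'))) = z1 * (S * (P' * t))" .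
  have "rw k (Suc k) B * S * (1 - T) * R' = z1 * (b * (S * (P' * t)))"
    using Suc assms by (simp add: row_Suc row_top b_def[symmetric] mult.assoc 1 scal)
  also have "\<dots> \<approx> z1 * (b * (P' * t) - b * (1 - S) * P' * t)"
    by (intro row_eqI) (simp add: algebra_simps)
  also have "\<dots> \<approx> z1 * (b * (P' * t) - rw j j B * t)"
    unfolding b_def by (intro row_eq_cmult[OF central(1)] row_eq_diff row_eq_refl row_eq_mult row_remove)
  also have "\<dots> = z1 * (rw k k B * (1 - S) * P' - rw k (k - 1) B)"
    using Suc assms by (simp add: row_Suc b_def[symmetric] mult.assoc tau_S[unfolded mult.assoc])
  finally show ?thesis .
qed

text \<open>For \<open>A = 1\<close> or \<open>B = 1\<close> the second word is 0, in accordance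
  with the convention q^(lambda_0) = q^(mu_0) = 0.\<close>

definition V where "V k A B = rw k A B - w * u * rw k (A - 1) (B - 1)"

lemma V_Suc:
  assumes "A \<le> Suc (Suc k)" "B \<le> Suc (Suc k)"
  shows "V (Suc k) A B = V k A B * t"
  using assms by (simp add: V_def row_Suc algebra_simps)

text \<open>The bound on \<open>B\<close> is what \<open>row_star\<close> demands of the second word
  of \<open>V\<close>, whose index is \<open>B - 1\<close>. It excludes \<open>B = k + 3\<close>,
  the case treated by \<open>V_corner\<close>.\<close>

lemma V_step:
  assumes "B \<le> Suc (Suc k)"
  shows "V (Suc k) (Suc (Suc (Suc k))) B \<approx>
    V k (Suc (Suc k)) B * t * H1 - z1 * (V k (Suc k) B * t * H2) + z1 * w * (V k k B * t)"
proof -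
  have "V (Suc k) (Suc (Suc (Suc k))) B =
      rw k (Suc k) B * P * t * P - w * u * (rw k (Suc k) (B - 1) * P * t)"
    using assms by (simp add: V_def row_Suc row_top mult.assoc)
  then show ?thesis
    using row_eq_sym[OF step_core[OF row_remove[of k B] row_remove[of k "B - 1"] row_star[of "B - 1" k]]] assms
    by (simp add: V_def row_top)
qed

lemma V_corner:
  assumes "k = Suc j"
  shows "V k (Suc (Suc k)) (Suc (Suc k)) \<approx>
    V k (Suc k) (Suc (Suc k)) * H1 - z1 * (V k k (Suc (Suc k)) * H2) + z1 * w * V k (k - 1) (Suc (Suc k))"
proof -
  interpret sym: toda R R' P P' T S t z2 z1 w u by (rule symmetric)
  have top: "rw j A (Suc (Suc j)) = rw j A (Suc j) * R" "rw j A (Suc (Suc (Suc j))) = rw j A (Suc j) * R" for A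
    using sym.row_top[of j _ A] by (simp_all add: row_swap)
  define \<phi> F F' where "\<phi> = rw j (Suc j) (Suc j)" and "F = rw j j (Suc j)" and "F' = rw j (j - Suc 0) (Suc j)"
  have nlt: "\<not> Suc (Suc j) < j - Suc 0" by simp
  have top\<phi>: "rw j (Suc (Suc j)) (Suc j) = \<phi> * P" "rw j (Suc (Suc (Suc j))) (Suc j) = \<phi> * P"
    by (simp_all add: row_top \<phi>_def)
  have eqs: "V k (Suc k) (Suc (Suc k)) = \<phi> * P * R * t * R - w * u * (\<phi> * R * t)"
    "V k k (Suc (Suc k)) = \<phi> * R * t * R - w * u * (F * R * t)"
    "V k (k - 1) (Suc (Suc k)) = F * R * t * R - w * u * (F' * R * t)"
    "V k (Suc (Suc k)) (Suc (Suc k)) = \<phi> * P * R * t * P * R - w * u * (\<phi> * P * R * t)"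
    using assms by (simp_all add: V_def row_Suc top top\<phi> \<phi>_def[symmetric] F_def[symmetric] F'_def[symmetric] nlt mult.assoc)
  show ?thesis
    unfolding eqs \<phi>_def F_def F'_def
    by (rule row_eq_sym[OF corner_core[OF row_remove row_star[unfolded One_nat_def]]]) simp
qed

text \<open>The initial values 1, e1, e2 and e1 e2 - e3 of the Schur recursions, up to
  normalisation. In the last one, \<open>R * (1 - T) * R' = 1 - u * T\<close> leaves the correction
  \<open>w * u\<close>.\<close>

lemma V_0:
  "V 0 1 1 = 1" "V 0 2 1 \<approx> H1" "V 0 1 2 \<approx> H2" "V 0 2 2 \<approx> V 0 1 2 * H1 - w"
proof -
  show "V 0 1 1 = 1" by (simp add: V_def row_0)
  have "H1 - P = (1 - S) * (z1 * (P' * R)) + (1 - T) * (w * R')"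
    by (simp add: H1_def mult.assoc scal)
  then show "V 0 2 1 \<approx> H1"
    by (intro row_eq_sym[of H1]) (auto simp: V_def row_0 row_eq_def)
  have "H2 - R = (1 - S) * (w * P') + (1 - T) * (z2 * (R' * P))"
    by (simp add: H2_def mult.assoc scal)
  then show "V 0 1 2 \<approx> H2"
    by (intro row_eq_sym[of H2]) (auto simp: V_def row_0 row_eq_def)
  have "R * H1 - w - (P * R - w * u) = (1 - S) * (z1 * (P' * R * R)) + (1 - T) * (w * u)"
    by (simp add: H1_def algebra_simps nf shift_left scal_gen central(3)[of T] central_prod)
  then show "V 0 2 2 \<approx> V 0 1 2 * H1 - w"
    by (intro row_eq_sym[of "V 0 1 2 * H1 - w"]) (auto simp: V_def row_0 row_eq_def)
qed


text \<open>Since \<open>H1\<close> will turn out to have simple spectrum, this single commutation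
  relation suffices to diagonalise \<open>t\<close>; see \<open>Psi_tau\<close>.\<close>

lemma H1_tau: "H1 * t = t * H1"
  unfolding tau_H1 by (simp add: H1_def algebra_simps nf scal_gen)

text \<open>Peels off the outermost block, which carries the largest parts lambda_1 and mu_1. The
  \<open>max 1\<close> keeps an exhausted index at 1 (no letter left) instead of 0 (the zero
  word).\<close>

lemma row_Cons:
  assumes "A \<noteq> 0" "B \<noteq> 0"
  shows "rw (Suc k) A B = (if 1 < A then P else 1) * (if 1 < B then R else 1) * t * rw k (max 1 (A - 1)) (max 1 (B - 1))"
proof -
  have lt: "Suc i < A \<longleftrightarrow> i < max 1 (A - 1)" "Suc i < B \<longleftrightarrow> i < max 1 (B - 1)" if "1 \<le> i" for i
    using that by auto
  have map: "map f [1..<Suc (Suc k)] = f 1 # map (\<lambda>i. f (Suc i)) [1..<Suc k]" for f :: "nat \<Rightarrow> 'r"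
    by (simp add: upt_conv_Cons map_Suc_upt[symmetric] comp_def del: upt_Suc)
  define X where "X = prod_list (map (\<lambda>i. (if i < max 1 (A - 1) then P else 1) * (if i < max 1 (B - 1) then R else 1) * t) [1..<Suc k])"
  have mp: "map (\<lambda>i. (if Suc i < A then P else 1) * (if Suc i < B then R else 1) * t) [1..<Suc k] =
    map (\<lambda>i. (if i < max 1 (A - 1) then P else 1) * (if i < max 1 (B - 1) then R else 1) * t) [1..<Suc k]"
    by (rule map_cong) (auto simp: lt)
  define D where "D = (if Suc k < max 1 (A - 1) then P else 1) * (if Suc k < max 1 (B - 1) then R else 1)"
  have nz: "(A = 0 \<or> B = 0) = False" "(max 1 (A - 1) = 0 \<or> max 1 (B - 1) = 0) = False"
    using assms by simp_all
  have "rw (Suc k) A B = (if 1 < A then P else 1) * (if 1 < B then R else 1) * t * X * D"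
    unfolding row_def map mp D_def lt[of "Suc k", simplified] nz if_False X_def by simp
  moreover have "rw k (max 1 (A - 1)) (max 1 (B - 1)) = X * D"
    unfolding row_def nz if_False X_def D_def ..
  ultimately show ?thesis by (simp add: mult.assoc)
qed

end

section \<open>Eigenvectors and the expansion of the unit vector\<close>

text \<open>Only negative exponents are restricted: there the factors stand in a
  denominator.\<close>

lemma qpoch_rec:
  fixes a q :: "'a::field"
  assumes "q \<noteq> 0" and nz: "\<And>j. j < 0 \<Longrightarrow> a * q powi j \<noteq> 1"
  shows "qpoch a q (n + 1) = qpoch a q n * (1 - a * q powi n)"
proof (cases "0 \<le> n")
  case True
  then have "nat (n + 1) = Suc (nat n)" by simp
  moreover have "q powi n = q ^ nat n" using True by (simp add: power_int_def)
  ultimately show ?thesis using True by (simp add: qpoch_def)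
next
  case False
  define m where "m = nat (- n) - 1"
  have n: "n = - int (Suc m)" using False by (simp add: m_def)
  have nz': "1 - a * inverse q ^ Suc m \<noteq> 0"
    using nz[of n] False by (simp add: n power_int_def nat_add_distrib)
  have "qpoch a q n = 1 / (\<Prod>j\<in>{1..Suc m}. 1 - a * inverse q ^ j)"
    by (simp add: qpoch_def n nat_add_distrib)
  moreover have "qpoch a q (n + 1) = 1 / (\<Prod>j\<in>{1..m}. 1 - a * inverse q ^ j)"
    by (simp add: qpoch_def n)
  moreover have "q powi n = inverse q ^ Suc m"
    by (simp add: n power_int_def nat_add_distrib)
  ultimately show ?thesis
    using nz' by (simp add: prod.nat_ivl_Suc')
qed

text \<open>For n < 0 the definition gives qpoch q q n = 0, hence inverse 0: the convention 1/(q;q)_n = 0 is built in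
  and the recursion holds for all integers.\<close>

lemma inverse_qpoch_rec:
  fixes q :: "'a::field"
  assumes "q \<noteq> 0" and nz: "\<And>n. 0 < n \<Longrightarrow> q ^ n \<noteq> 1"
  shows "inverse (qpoch q q (n - 1)) = (1 - q powi n) * inverse (qpoch q q n)"
proof -
  have neg: "qpoch q q m = 0" if "m < 0" for m
  proof -
    have "1 \<in> {1..nat (- m)}" using that by auto
    then have "(\<Prod>j\<in>{1..nat (- m)}. 1 - q * inverse q ^ j) = 0"
      using assms(1) by (intro prod_zero bexI[of _ 1]) auto
    then show ?thesis using that by (simp add: qpoch_def)
  qed
  consider "n < 0" | "n = 0" | "n > 0" by linarith
  then show ?thesis
  proof cases
    case 3
    define m where "m = nat n - 1"
    have n: "n = int (Suc m)" using 3 by (simp add: m_def)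
    have "q * q ^ m \<noteq> 1" using nz[of "Suc m"] by simp
    then show ?thesis by (simp add: n qpoch_def power_int_def nat_add_distrib)
  qed (use neg in auto)
qed

locale qfield =
  fixes q z1 z2 w :: "'a::field"
  assumes q0: "q \<noteq> 0" and qn: "\<And>n. 0 < n \<Longrightarrow> q ^ n \<noteq> 1"
    and w_def: "w = z1 * z2"
    and nz1: "\<And>n. z1 * q powi n \<noteq> 1" and nz2: "\<And>n. z2 * q powi n \<noteq> 1"
    and nw: "\<And>n. w * q powi n \<noteq> 1"
begin

lemma qfield_swap: "qfield q z2 z1 w"
  by unfold_locales (use q0 qn w_def nz1 nz2 nw in \<open>auto simp: mult.commute\<close>)

abbreviation "p1 n \<equiv> qpoch z1 q n"
abbreviation "p2 n \<equiv> qpoch z2 q n"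
abbreviation "pw n \<equiv> qpoch w q n"
abbreviation "rq n \<equiv> inverse (qpoch q q n)"

lemma p1_rec: "p1 (n + 1) = p1 n * (1 - z1 * q powi n)" by (rule qpoch_rec[OF q0 nz1])
lemma p2_rec: "p2 (n + 1) = p2 n * (1 - z2 * q powi n)" by (rule qpoch_rec[OF q0 nz2])
lemma pw_rec: "pw (n + 1) = pw n * (1 - w * q powi n)" by (rule qpoch_rec[OF q0 nw])
lemma rq_rec: "rq (n - 1) = (1 - q powi n) * rq n" by (rule inverse_qpoch_rec[OF q0 qn])

lemma qpoch_nonzero:
  fixes a :: 'a assumes "\<And>n. a * q powi n \<noteq> 1" shows "qpoch a q n \<noteq> 0"
proof -
  have "1 - a * q ^ j \<noteq> 0" for j using assms[of "int j"] by (simp add: power_int_def)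
  moreover have "1 - a * inverse q ^ j \<noteq> 0" for j
    using assms[of "- int j"] by (cases "j = 0") (auto simp: power_int_def)
  ultimately show ?thesis by (simp add: qpoch_def)
qed

lemma p_nonzero: "p1 n \<noteq> 0" "p2 n \<noteq> 0" "pw n \<noteq> 0"
  using qpoch_nonzero nz1 nz2 nw by blast+

text \<open>The entries of the eigenvector whose support starts at (r, s), with the factor
  \<open>weight\<close> split off. They factor completely, which makes the eigenvalue equations
  checkable through ratios of neighbours.\<close>

definition theta :: "int \<Rightarrow> int \<Rightarrow> int \<Rightarrow> int \<Rightarrow> 'a" where
  "theta r s L M = pw (L + M + 1) * rq (L - r) * rq (M - s)
     / (p1 (L + r - s + 1) * p2 (M + s - r + 1) * pw (L + s + 1) * pw (M + r + 1))"

lemma theta_swap: "qfield.theta q z2 z1 w s r M L = theta r s L M"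
proof -
  interpret sw: qfield q z2 z1 w by (rule qfield_swap)
  show ?thesis by (simp add: sw.theta_def theta_def add.commute mult.commute mult.left_commute)
qed

lemma powi_split:
  "q powi (i + j) = q powi i * q powi j" "q powi (i - j) = q powi i / q powi j" "q powi i \<noteq> 0"
  using q0 by (simp_all add: power_int_add power_int_diff)

lemma theta_lower:
  "theta r s (L - 1) M * (1 - w * q powi (L + M)) =
     theta r s L M * ((1 - q powi (L - r)) * (1 - z1 * q powi (L + r - s)) * (1 - w * q powi (L + s)))"
proof -
  have 1: "rq (L - 1 - r) = (1 - q powi (L - r)) * rq (L - r)"
    using rq_rec[of "L - r"] by (simp add: algebra_simps)
  have 2: "p1 (L + r - s + 1) = p1 (L - 1 + r - s + 1) * (1 - z1 * q powi (L + r - s))"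
    using p1_rec[of "L + r - s"] by (simp add: algebra_simps)
  have 3: "pw (L + s + 1) = pw (L - 1 + s + 1) * (1 - w * q powi (L + s))"
    using pw_rec[of "L + s"] by (simp add: algebra_simps)
  have 4: "pw (L + M + 1) = pw (L - 1 + M + 1) * (1 - w * q powi (L + M))"
    using pw_rec[of "L + M"] by (simp add: algebra_simps)
  have 5: "1 - z1 * q powi (L + r - s) \<noteq> 0" "1 - w * q powi (L + s) \<noteq> 0"
    using nz1 nw by simp_all
  show ?thesis
    unfolding theta_def 1 2 3 4 using p_nonzero 5 by (simp add: divide_simps)
qed

lemma theta_lower':
  "theta r s L (M - 1) * (1 - w * q powi (L + M)) =
     theta r s L M * ((1 - q powi (M - s)) * (1 - z2 * q powi (M + s - r)) * (1 - w * q powi (M + r)))"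
proof -
  interpret sw: qfield q z2 z1 w by (rule qfield_swap)
  show ?thesis using sw.theta_lower[of s r M L] by (simp add: theta_swap add.commute)
qed

lemma theta_zero: "L < r \<or> M < s \<Longrightarrow> theta r s L M = 0"
proof -
  have neg: "rq n = 0" if "n < 0" for n
  proof -
    have "rq (- 1 - int m) = 0" for m
    proof (induction m)
      case 0
      show ?case using rq_rec[of 0] by simp
    next
      case (Suc m)
      then show ?case using rq_rec[of "- 1 - int m"] by (simp add: algebra_simps)
    qed
    from this[of "nat (- 1 - n)"] show ?thesis using that by simp
  qed
  assume "L < r \<or> M < s"
  then show ?thesis using neg[of "L - r"] neg[of "M - s"] by (auto simp: theta_def)
qed

text \<open>For y = (r, s - r, -s), \<open>ev1\<close> is x_1 times the sum of the 1/(x_i q^(y_i)),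
  and \<open>ev2\<close> is the sum of the x_i q^(y_i) divided by x_3. As the y_i add up to 0,
  \<open>z1 * ev2\<close> is x_1^2 times the second elementary symmetric function of the 1/(x_i
  q^(y_i)).\<close>

definition ev1 where "ev1 r s = inverse (q powi r) + z1 * q powi (r - s) + w * q powi s"
definition ev2 where "ev2 r s = inverse (q powi s) + z2 * q powi (s - r) + w * q powi r"

text \<open>What remains of the eigenvalue equation once the ratios from \<open>theta_lower\<close>
  and \<open>theta_lower'\<close> are inserted; the capitals stand for q^L, q^M, q^r, q^s.\<close>

lemma eigen_poly:
  fixes A B R S :: 'a
  assumes "A \<noteq> 0" "B \<noteq> 0" "R \<noteq> 0" "S \<noteq> 0"
  shows "(1 - w * (A * B)) * (inverse A + z1 * (A / B) + w * B - (inverse R + z1 * (R / S) + w * S)) =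
    inverse A * ((1 - A / R) * (1 - z1 * (A * R / S)) * (1 - w * (A * S)))
    + z1 * (A / B) * ((1 - B / S) * (1 - z2 * (B * S / R)) * (1 - w * (B * R)))"
  using assms unfolding w_def by (simp add: field_simps)

lemma theta_eigen:
  "(ev1 L M - ev1 r s) * theta r s L M =
     inverse (q powi L) * theta r s (L - 1) M + z1 * q powi (L - M) * theta r s L (M - 1)"
proof -
  have nz: "1 - w * q powi (L + M) \<noteq> 0" using nw by simp
  have "(1 - w * q powi (L + M)) * ((ev1 L M - ev1 r s) * theta r s L M) =
     (1 - w * q powi (L + M)) * (ev1 L M - ev1 r s) * theta r s L M" by simp
  also have "(1 - w * q powi (L + M)) * (ev1 L M - ev1 r s) =
     inverse (q powi L) * ((1 - q powi (L - r)) * (1 - z1 * q powi (L + r - s)) * (1 - w * q powi (L + s)))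
    + z1 * q powi (L - M) * ((1 - q powi (M - s)) * (1 - z2 * q powi (M + s - r)) * (1 - w * q powi (M + r)))"
    unfolding ev1_def powi_split using eigen_poly[of "q powi L" "q powi M" "q powi r" "q powi s"]
    by (simp add: q0)
  also have "\<dots> * theta r s L M = inverse (q powi L) * (theta r s (L - 1) M * (1 - w * q powi (L + M)))
     + z1 * q powi (L - M) * (theta r s L (M - 1) * (1 - w * q powi (L + M)))"
    unfolding theta_lower theta_lower' by (simp only: distrib_left distrib_right mult_ac)
  also have "\<dots> = (1 - w * q powi (L + M)) * (inverse (q powi L) * theta r s (L - 1) M + z1 * q powi (L - M) * theta r s L (M - 1))"
    by (simp add: algebra_simps)
  finally show ?thesis using nz by simp
qed

lemma theta_eigen':
  "(ev2 L M - ev2 r s) * theta r s L M =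
     inverse (q powi M) * theta r s L (M - 1) + z2 * q powi (M - L) * theta r s (L - 1) M"
proof -
  interpret sw: qfield q z2 z1 w by (rule qfield_swap)
  show ?thesis using sw.theta_eigen[of M L s r] by (simp add: theta_swap sw.ev1_def ev2_def)
qed

text \<open>The product over i < j of 1 - x_i q^(y_i) / (x_j q^(y_j)) at y = (r, s - r, -s).\<close>

definition vandermonde where "vandermonde r s = (1 - z1 * q powi (2 * r - s)) * (1 - z2 * q powi (2 * s - r)) * (1 - w * q powi (r + s))"

text \<open>Times \<open>vandermonde\<close>, this is the coefficient of an eigenvector in the unit
  vector. \<open>coefficient_omega\<close> identifies it with the q-shifted factorials of the
  right-hand side.\<close>

definition omega :: "nat \<Rightarrow> nat \<Rightarrow> 'a" where
  "omega r s = (- 1) ^ (r + s) * q ^ (r choose 2) * q ^ (s choose 2)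
     * pw (int r) * pw (int s) * p1 (int r - int s) * p2 (int s - int r) * rq (int r) * rq (int s)"

lemma omega_swap: "qfield.omega q z2 z1 w s r = omega r s"
proof -
  interpret sw: qfield q z2 z1 w by (rule qfield_swap)
  show ?thesis by (simp add: sw.omega_def omega_def add.commute mult.commute mult.left_commute)
qed

text \<open>The certificate for the expansion of the unit vector: with A = q^L, B = q^M, R = q^r, S = q^s the summand
  is a sum of differences in the three positive root directions (1,0), (0,1), (1,1) of the (r, s)-plane.\<close>

lemma telescope_poly:
  fixes A B R S :: 'a
  assumes "R \<noteq> 0" "S \<noteq> 0"
  shows "- (1 - A * B) * ((1 - z1 * (R * R / S)) * (1 - z2 * (S * S / R)) * (1 - w * (R * S))) =
     S * (- R * (1 - w * R) * (1 - z1 * (R / S)) * (1 - A / R) * (1 - z2 * (B * S / R)))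
   - S * ((1 - R) * (1 - z1 * (A * R / S)) * (1 - w * (B * R)) * (1 - z2 * (S / R)))
   + (R * (- S * (1 - w * S) * (1 - z2 * (S / R)) * (1 - B / S) * (1 - z1 * (A * R / S)))
   - R * ((1 - S) * (1 - z2 * (B * S / R)) * (1 - w * (A * S)) * (1 - z1 * (R / S))))
   + (R * S * (1 - w * R) * (1 - w * S) * (1 - A / R) * (1 - B / S)
   - (1 - R) * (1 - S) * (1 - w * (A * S)) * (1 - w * (B * R)))"
  using assms unfolding w_def by (simp add: field_simps)


section \<open>Telescoping the expansion of the unit vector\<close>

definition dterm :: "nat \<Rightarrow> nat \<Rightarrow> nat \<Rightarrow> nat \<Rightarrow> 'a" where
  "dterm L M r s = omega r s * theta (int r) (int s) (int L) (int M)"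

lemma dterm_swap: "qfield.dterm q z2 z1 w M L s r = dterm L M r s"
proof -
  interpret sw: qfield q z2 z1 w by (rule qfield_swap)
  show ?thesis by (simp add: sw.dterm_def dterm_def theta_swap omega_swap)
qed

lemma dterm_0: "dterm L M (Suc L) s = 0"
proof -
  have "rq (int L - int (Suc L)) = 0" using rq_rec[of 0] by simp
  then show ?thesis by (simp add: dterm_def theta_def)
qed

lemma omega_Suc:
  "omega (Suc r) s * ((1 - q powi (int r + 1)) * (1 - z2 * q powi (int s - int r - 1))) =
   omega r s * (- (q powi int r) * (1 - w * q powi int r) * (1 - z1 * q powi (int r - int s)))"
proof -
  have 1: "rq (int r) = (1 - q powi (int r + 1)) * rq (int r + 1)"
    using rq_rec[of "int r + 1"] by simp
  have 2: "p2 (int s - int r) = p2 (int s - int r - 1) * (1 - z2 * q powi (int s - int r - 1))"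
    using p2_rec[of "int s - int r - 1"] by simp
  have 3: "p1 (int r + 1 - int s) = p1 (int r - int s) * (1 - z1 * q powi (int r - int s))"
    using p1_rec[of "int r - int s"] by (simp add: algebra_simps)
  have 4: "pw (int r + 1) = pw (int r) * (1 - w * q powi int r)" by (rule pw_rec)
  have 5: "q ^ (Suc r choose 2) = q powi int r * q ^ (r choose 2)"
    by (simp add: numeral_2_eq_2 power_add)
  have 6: "int (Suc r) = int r + 1" "int s - (int r + 1) = int s - int r - 1" by simp_all
  show ?thesis unfolding omega_def 6 1 2 3 4 5 by (simp add: mult_ac)
qed

lemma theta_shift:
  "theta (r + 1) s L M * ((1 - z1 * q powi (L + r - s + 1)) * (1 - w * q powi (M + r + 1))) =
   theta r s L M * ((1 - q powi (L - r)) * (1 - z2 * q powi (M + s - r)))"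
proof -
  have 1: "rq (L - (r + 1)) = (1 - q powi (L - r)) * rq (L - r)"
    using rq_rec[of "L - r"] by (simp add: algebra_simps)
  have 2: "p1 (L + (r + 1) - s + 1) = p1 (L + r - s + 1) * (1 - z1 * q powi (L + r - s + 1))"
    using p1_rec[of "L + r - s + 1"] by (simp add: algebra_simps)
  have 3: "p2 (M + s - r + 1) = p2 (M + s - (r + 1) + 1) * (1 - z2 * q powi (M + s - r))"
    using p2_rec[of "M + s - r"] by (simp add: algebra_simps)
  have 4: "pw (M + (r + 1) + 1) = pw (M + r + 1) * (1 - w * q powi (M + r + 1))"
    using pw_rec[of "M + r + 1"] by (simp add: algebra_simps)
  have 5: "1 - z1 * q powi (L + r - s + 1) \<noteq> 0" "1 - z2 * q powi (M + s - r) \<noteq> 0" "1 - w * q powi (M + r + 1) \<noteq> 0"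
    using nz1 nz2 nw by simp_all
  show ?thesis
    unfolding theta_def 1 2 3 4 using p_nonzero 5 by (simp add: divide_simps)
qed

lemma dterm_Suc:
  "dterm L M (Suc r) s * ((1 - q powi (int r + 1)) * (1 - z1 * q powi (int L + int r - int s + 1))
      * (1 - w * q powi (int M + int r + 1)) * (1 - z2 * q powi (int s - int r - 1))) =
   dterm L M r s * (- (q powi int r) * (1 - w * q powi int r) * (1 - z1 * q powi (int r - int s))
      * (1 - q powi (int L - int r)) * (1 - z2 * q powi (int M + int s - int r)))"
proof -
  have "dterm L M (Suc r) s * ((1 - q powi (int r + 1)) * (1 - z1 * q powi (int L + int r - int s + 1))
      * (1 - w * q powi (int M + int r + 1)) * (1 - z2 * q powi (int s - int r - 1))) =
     (omega (Suc r) s * ((1 - q powi (int r + 1)) * (1 - z2 * q powi (int s - int r - 1)))) *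
     (theta (int r + 1) (int s) (int L) (int M) * ((1 - z1 * q powi (int L + int r - int s + 1)) * (1 - w * q powi (int M + int r + 1))))"
    by (simp add: dterm_def mult_ac add.commute)
  then show ?thesis unfolding omega_Suc theta_shift by (simp add: dterm_def mult_ac)
qed

lemma dterm_Suc_Suc:
  "dterm L M (Suc r) (Suc s) * ((1 - q powi (int r + 1)) * (1 - q powi (int s + 1))
      * (1 - w * q powi (int L + int s + 1)) * (1 - w * q powi (int M + int r + 1))) =
   dterm L M r s * (q powi int r * q powi int s * (1 - w * q powi int r) * (1 - w * q powi int s)
      * (1 - q powi (int L - int r)) * (1 - q powi (int M - int s)))"
proof -
  have 1: "rq (int r) = (1 - q powi (int r + 1)) * rq (int r + 1)"
     "rq (int s) = (1 - q powi (int s + 1)) * rq (int s + 1)"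
    using rq_rec[of "int r + 1"] rq_rec[of "int s + 1"] by simp_all
  have 2: "rq (int L - (int r + 1)) = (1 - q powi (int L - int r)) * rq (int L - int r)"
     "rq (int M - (int s + 1)) = (1 - q powi (int M - int s)) * rq (int M - int s)"
    using rq_rec[of "int L - int r"] rq_rec[of "int M - int s"] by (simp_all add: algebra_simps)
  have 3: "pw (int L + (int s + 1) + 1) = pw (int L + int s + 1) * (1 - w * q powi (int L + int s + 1))"
     "pw (int M + (int r + 1) + 1) = pw (int M + int r + 1) * (1 - w * q powi (int M + int r + 1))"
    using pw_rec[of "int L + int s + 1"] pw_rec[of "int M + int r + 1"] by (simp_all add: algebra_simps)
  have 4: "pw (int r + 1) = pw (int r) * (1 - w * q powi int r)" "pw (int s + 1) = pw (int s) * (1 - w * q powi int s)"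
    by (rule pw_rec)+
  have 5: "q ^ (Suc n choose 2) = q powi int n * q ^ (n choose 2)" for n
    by (simp add: numeral_2_eq_2 power_add)
  have 6: "int (Suc n) = int n + 1" for n by simp
  have 7: "int L + (int r + 1) - (int s + 1) + 1 = int L + int r - int s + 1"
    "int M + (int s + 1) - (int r + 1) + 1 = int M + int s - int r + 1"
    "int r + 1 - (int s + 1) = int r - int s" "int s + 1 - (int r + 1) = int s - int r"
    by simp_all
  have 8: "1 - w * q powi (int L + int s + 1) \<noteq> 0" "1 - w * q powi (int M + int r + 1) \<noteq> 0"
    using nw by simp_all
  show ?thesis unfolding dterm_def omega_def theta_def 6 7 1 2 3 4 5
    using p_nonzero 8 by (simp add: divide_simps)
qed

text \<open>Certificates for the directions (1,0) and (1,1). The factors 1 - q^r and 1 - q^s make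
  them vanish on the lower sides of the box, and \<open>dterm\<close> vanishes just beyond the upper
  sides.\<close>

definition G1 where "G1 L M r s = q powi int s * dterm L M r s *
  ((1 - q powi int r) * (1 - z1 * q powi (int L + int r - int s)) * (1 - w * q powi (int M + int r)) * (1 - z2 * q powi (int s - int r)))"
definition G3 where "G3 L M r s = dterm L M r s *
  ((1 - q powi int r) * (1 - q powi int s) * (1 - w * q powi (int L + int s)) * (1 - w * q powi (int M + int r)))"

lemma G_boundary: "G1 L M 0 s = 0" "G1 L M (Suc L) s = 0" "G3 L M 0 s = 0" "G3 L M (Suc L) s = 0" "G3 L M r 0 = 0" "G3 L M r (Suc M) = 0"
proof -
  interpret sw: qfield q z2 z1 w by (rule qfield_swap)
  show "G3 L M r (Suc M) = 0" using sw.dterm_0[of M L r] by (simp add: G3_def dterm_swap)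
qed (simp_all add: G1_def G3_def dterm_0)

lemma G1_Suc: "G1 L M (Suc r) s = q powi int s * (dterm L M r s * (- (q powi int r) * (1 - w * q powi int r) * (1 - z1 * q powi (int r - int s))
      * (1 - q powi (int L - int r)) * (1 - z2 * q powi (int M + int s - int r))))"
proof -
  have "int (Suc r) = int r + 1" "int L + (int r + 1) - int s = int L + int r - int s + 1"
    "int M + (int r + 1) = int M + int r + 1" "int s - (int r + 1) = int s - int r - 1" by simp_all
  then show ?thesis unfolding G1_def using dterm_Suc[of L M r s] by (simp only: mult.assoc)
qed

lemma G3_Suc: "G3 L M (Suc r) (Suc s) = dterm L M r s * (q powi int r * q powi int s * (1 - w * q powi int r) * (1 - w * q powi int s)
      * (1 - q powi (int L - int r)) * (1 - q powi (int M - int s)))"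
proof -
  have "int (Suc r) = int r + 1" "int (Suc s) = int s + 1" "int L + (int s + 1) = int L + int s + 1"
    "int M + (int r + 1) = int M + int r + 1" by simp_all
  then show ?thesis unfolding G3_def using dterm_Suc_Suc[of L M r s] by (simp only: mult.assoc)
qed

definition G2 where "G2 L M r s = qfield.G1 q z2 z1 w M L s r"

text \<open>\<open>telescope_poly\<close> multiplied by \<open>dterm\<close>. The factor 1 - q^(L+M)
  is nonzero away from the origin, so vanishing of the telescoped sum forces vanishing of the
  expansion there.\<close>

lemma telescope:
  "- (1 - q ^ (L + M)) * (vandermonde (int r) (int s) * dterm L M r s) =
     (G1 L M (Suc r) s - G1 L M r s) + (G2 L M r (Suc s) - G2 L M r s) + (G3 L M (Suc r) (Suc s) - G3 L M r s)"
proof -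
  interpret sw: qfield q z2 z1 w by (rule qfield_swap)
  have *: "2 * int r - int s = int r + int r - int s" "2 * int s - int r = int s + int s - int r" by simp_all
  have **: "q ^ (L + M) = q powi int L * q powi int M" by (simp add: power_add)
  let ?d = "dterm L M r s" and ?A = "q powi int L" and ?B = "q powi int M" and ?R = "q powi int r" and ?S = "q powi int s"
  have e1: "G1 L M (Suc r) s = ?d * (?S * (- ?R * (1 - w * ?R) * (1 - z1 * (?R / ?S)) * (1 - ?A / ?R) * (1 - z2 * (?B * ?S / ?R))))"
    unfolding G1_Suc powi_split by (simp only: mult_ac)
  have e2: "G1 L M r s = ?d * (?S * ((1 - ?R) * (1 - z1 * (?A * ?R / ?S)) * (1 - w * (?B * ?R)) * (1 - z2 * (?S / ?R))))"
    unfolding G1_def powi_split by (simp only: mult_ac)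
  have e3: "G2 L M r (Suc s) = ?d * (?R * (- ?S * (1 - w * ?S) * (1 - z2 * (?S / ?R)) * (1 - ?B / ?S) * (1 - z1 * (?A * ?R / ?S))))"
    unfolding G2_def sw.G1_Suc powi_split dterm_swap by (simp only: mult_ac)
  have e4: "G2 L M r s = ?d * (?R * ((1 - ?S) * (1 - z2 * (?B * ?S / ?R)) * (1 - w * (?A * ?S)) * (1 - z1 * (?R / ?S))))"
    unfolding G2_def sw.G1_def powi_split dterm_swap by (simp only: mult_ac)
  have e5: "G3 L M (Suc r) (Suc s) = ?d * (?R * ?S * (1 - w * ?R) * (1 - w * ?S) * (1 - ?A / ?R) * (1 - ?B / ?S))"
    unfolding G3_Suc powi_split by (simp only: mult_ac)
  have e6: "G3 L M r s = ?d * ((1 - ?R) * (1 - ?S) * (1 - w * (?A * ?S)) * (1 - w * (?B * ?R)))"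
    unfolding G3_def powi_split by (simp only: mult_ac)
  have v: "vandermonde (int r) (int s) = (1 - z1 * (?R * ?R / ?S)) * (1 - z2 * (?S * ?S / ?R)) * (1 - w * (?R * ?S))"
    unfolding vandermonde_def * powi_split ..
  have combine: "c * (v * d) = (d * x1 - d * x2) + (d * x3 - d * x4) + (d * x5 - d * x6)"
    if "c * v = x1 - x2 + (x3 - x4) + (x5 - x6)" for c v d x1 x2 x3 x4 x5 x6 :: 'a
    using arg_cong[OF that, of "\<lambda>x. d * x"] by (simp add: algebra_simps)
  show ?thesis
    unfolding e1 e2 e3 e4 e5 e6 v **
    by (rule combine, rule telescope_poly) (rule powi_split(3))+
qed

lemma delta_expansion:
  "(\<Sum>r\<le>L. \<Sum>s\<le>M. vandermonde (int r) (int s) * omega r s * theta (int r) (int s) (int L) (int M)) = (if L = 0 \<and> M = 0 then 1 else 0)"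
proof (cases "L = 0 \<and> M = 0")
  case True
  have "1 - z1 \<noteq> 0" "1 - z2 \<noteq> 0" "1 - w \<noteq> 0" using nz1[of 0] nz2[of 0] nw[of 0] by simp_all
  then show ?thesis using True by (simp add: vandermonde_def omega_def theta_def qpoch_def binomial_eq_0)
next
  case False
  interpret sw: qfield q z2 z1 w by (rule qfield_swap)
  have tel: "(\<Sum>i\<le>n. f (Suc i) - f i) = f (Suc n) - f 0" for f :: "nat \<Rightarrow> 'a" and n
    by (induction n) simp_all
  have 1: "(\<Sum>r\<le>L. \<Sum>s\<le>M. G1 L M (Suc r) s - G1 L M r s) = 0"
    using tel[of "\<lambda>i. G1 L M i _" L] by (subst sum.swap) (simp add: G_boundary)
  have 2: "(\<Sum>r\<le>L. \<Sum>s\<le>M. G2 L M r (Suc s) - G2 L M r s) = 0"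
    using tel[of "\<lambda>i. G2 L M _ i" M] by (simp add: G2_def sw.G_boundary)
  \<comment> \<open>Used once per coordinate for \<open>G3\<close>, which vanishes on all four sides
    of the box, so the diagonal shift can be undone one index at a time.\<close>
  have a: "(\<Sum>i\<le>n. f (Suc i)) = (\<Sum>i\<le>n. f i)" if "f 0 = 0" "f (Suc n) = 0" for f :: "nat \<Rightarrow> 'a" and n
    using tel[of f n] that by (simp add: sum_subtractf)
  have "(\<Sum>r\<le>L. \<Sum>s\<le>M. G3 L M (Suc r) (Suc s)) = (\<Sum>r\<le>L. \<Sum>s\<le>M. G3 L M (Suc r) s)"
    by (intro sum.cong refl a) (simp_all add: G_boundary)
  also have "\<dots> = (\<Sum>r\<le>L. \<Sum>s\<le>M. G3 L M r s)"
    by (intro a) (simp_all add: G_boundary)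
  finally have 3: "(\<Sum>r\<le>L. \<Sum>s\<le>M. G3 L M (Suc r) (Suc s) - G3 L M r s) = 0"
    by (simp add: sum_subtractf)
  have "- (1 - q ^ (L + M)) * (\<Sum>r\<le>L. \<Sum>s\<le>M. vandermonde (int r) (int s) * dterm L M r s) = 0"
    unfolding sum_distrib_left telescope sum.distrib 1 2 3 by simp
  then have "(\<Sum>r\<le>L. \<Sum>s\<le>M. vandermonde (int r) (int s) * dterm L M r s) = 0"
    using qn[of "L + M"] False by auto
  then show ?thesis using False by (simp add: dterm_def mult.assoc)
qed


text \<open>The alternant of the 1/(x_i q^(y_i)) with exponents (A + B, B, 0), normalised by a monomial in x. Here x, y, z
  are x_1/(x_i q^(y_i)), and x', y', z' are the numbers w/x, w/y, w/z.\<close>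

definition bialt :: "nat \<Rightarrow> nat \<Rightarrow> int \<Rightarrow> int \<Rightarrow> 'a" where
  "bialt A B r s = (let x = inverse (q powi r); y = z1 * q powi (r - s); z = w * q powi s;
       x' = w * q powi r; y' = z2 * q powi (s - r); z' = inverse (q powi s) in
     x ^ A * z' ^ B - y ^ A * z' ^ B - x ^ A * y' ^ B + z ^ A * y' ^ B + y ^ A * x' ^ B - z ^ A * x' ^ B)"

section \<open>Bialternants and their recursions\<close>

lemma bialt_swap: "qfield.bialt q z2 z1 w B A s r = bialt A B r s"
proof -
  interpret sw: qfield q z2 z1 w by (rule qfield_swap)
  show ?thesis by (simp add: sw.bialt_def bialt_def Let_def mult.commute)
qed

lemma bialt_zero [simp]: "bialt 0 B r s = 0" "bialt A 0 r s = 0"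
  by (simp_all add: bialt_def)

text \<open>The exponents are (2, 1, 0), so this is the Vandermonde determinant.\<close>

lemma bialt_1_1: "bialt 1 1 r s = inverse (q powi (r + s)) * vandermonde r s"
proof -
  have *: "2 * r - s = r + r - s" "2 * s - r = s + s - r" by simp_all
  show ?thesis unfolding bialt_def vandermonde_def Let_def * powi_split unfolding w_def
    using q0 by (simp add: field_simps)
qed

lemma bialt_1_1_nonzero: "bialt 1 1 r s \<noteq> 0"
  unfolding bialt_1_1 using nz1 nz2 nw q0 by (simp add: vandermonde_def)

text \<open>The three arguments of the alternant are the roots of the cubic with elementary
  symmetric functions \<open>ev1\<close>, \<open>z1 * ev2\<close> and \<open>z1 * w\<close>.\<close>

lemma cubic_root:
  fixes X Y :: 'a
  assumes "X \<noteq> 0" "Y \<noteq> 0" "x = inverse X \<or> x = z1 * (X / Y) \<or> x = w * Y"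
  shows "x ^ (n + 3) = (inverse X + z1 * (X / Y) + w * Y) * x ^ (n + 2)
     - z1 * (inverse Y + z2 * (Y / X) + w * X) * x ^ (n + 1) + z1 * w * x ^ n"
proof -
  have "x ^ 3 = (inverse X + z1 * (X / Y) + w * Y) * x ^ 2
     - z1 * (inverse Y + z2 * (Y / X) + w * X) * x + z1 * w"
    using assms(3)
  proof (elim disjE)
    assume x: "x = inverse X"
    show ?thesis unfolding w_def x using assms by (simp add: field_simps power2_eq_square power3_eq_cube)
  next
    assume x: "x = z1 * (X / Y)"
    show ?thesis unfolding w_def x using assms by (simp add: field_simps power2_eq_square power3_eq_cube)
  next
    assume x: "x = w * Y"
    show ?thesis unfolding x w_def using assms by (simp add: field_simps power2_eq_square power3_eq_cube)
  qed
  then have "x ^ n * x ^ 3 = x ^ n * ((inverse X + z1 * (X / Y) + w * Y) * x ^ 2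
     - z1 * (inverse Y + z2 * (Y / X) + w * X) * x + z1 * w)" by simp
  then show ?thesis by (simp add: power_add algebra_simps power2_eq_square)
qed

text \<open>For fixed \<open>B\<close> the alternant is a combination of the powers of the three
  roots with coefficients independent of the exponent, so it inherits their recursion.\<close>

lemma bialt_rec:
  "bialt (n + 3) B r s = ev1 r s * bialt (n + 2) B r s - z1 * ev2 r s * bialt (n + 1) B r s + z1 * w * bialt n B r s"
proof -
  let ?X = "q powi r" and ?Y = "q powi s"
  define x y z where "x = inverse ?X" and "y = z1 * (?X / ?Y)" and "z = w * ?Y"
  define e1 e2 where "e1 = x + y + z" and "e2 = inverse ?Y + z2 * (?Y / ?X) + w * ?X"
  have rec: "v ^ (n + 3) = e1 * v ^ (n + 2) - z1 * e2 * v ^ (n + 1) + z1 * w * v ^ n" if "v \<in> {x, y, z}" for v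
    unfolding e1_def e2_def x_def y_def z_def using that
    by (intro cubic_root) (auto simp: q0 x_def y_def z_def)
  have "ev1 r s = e1" "ev2 r s = e2"
    by (simp_all add: ev1_def ev2_def e1_def e2_def x_def y_def z_def powi_split)
  moreover define a b c where "a = inverse ?Y ^ B - (z2 * (?Y / ?X)) ^ B" and "b = (w * ?X) ^ B - inverse ?Y ^ B"
    and "c = (z2 * (?Y / ?X)) ^ B - (w * ?X) ^ B"
  have bf: "bialt m B r s = x ^ m * a + y ^ m * b + z ^ m * c" for m
    by (simp add: bialt_def x_def y_def z_def a_def b_def c_def powi_split Let_def right_diff_distrib)
  have "bialt (n + 3) B r s = e1 * bialt (n + 2) B r s - z1 * e2 * bialt (n + 1) B r s + z1 * w * bialt n B r s"
    unfolding bf using rec[of x] rec[of y] rec[of z] by (simp only: insert_iff simp_thms) (simp only: algebra_simps)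
  ultimately show ?thesis by simp
qed

lemma bialt_rec':
  "bialt A (n + 3) r s = ev2 r s * bialt A (n + 2) r s - z2 * ev1 r s * bialt A (n + 1) r s + z2 * w * bialt A n r s"
proof -
  interpret sw: qfield q z2 z1 w by (rule qfield_swap)
  show ?thesis using sw.bialt_rec[of n A s r] by (simp add: bialt_swap sw.ev1_def sw.ev2_def ev1_def ev2_def)
qed

lemma bialt_base:
  "bialt 2 1 r s = ev1 r s * bialt 1 1 r s" "bialt 1 2 r s = ev2 r s * bialt 1 1 r s"
  "bialt 2 2 r s = (ev1 r s * ev2 r s - w) * bialt 1 1 r s"
  unfolding bialt_def Let_def ev1_def ev2_def powi_split unfolding w_def
  using q0 by (simp_all add: field_simps power2_eq_square)

text \<open>With A = a + 1 and B = b + 1, the Schur function of shape (a + b, b, 0) in the 1/(x_i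
  q^(y_i)), up to a monomial in x.\<close>

definition schur where "schur A B r s = bialt A B r s / bialt 1 1 r s"

lemma schur_zero [simp]: "schur 0 B r s = 0" "schur A 0 r s = 0"
  by (simp_all add: schur_def)

lemma schur_base:
  "schur 1 1 r s = 1" "schur 2 1 r s = ev1 r s" "schur 1 2 r s = ev2 r s" "schur 2 2 r s = ev1 r s * ev2 r s - w"
  unfolding schur_def bialt_base using bialt_1_1_nonzero by simp_all

lemma schur_rec: "schur (n + 3) B r s = ev1 r s * schur (n + 2) B r s - z1 * ev2 r s * schur (n + 1) B r s + z1 * w * schur n B r s"
  unfolding schur_def bialt_rec by (simp add: add_divide_distrib diff_divide_distrib)

lemma schur_rec': "schur A (n + 3) r s = ev2 r s * schur A (n + 2) r s - z2 * ev1 r s * schur A (n + 1) r s + z2 * w * schur A n r s"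
  unfolding schur_def bialt_rec' by (simp add: add_divide_distrib diff_divide_distrib)

end

section \<open>Two-variable series\<close>

definition lift2 :: "complex fps fps \<Rightarrow> ser" where
  "lift2 F = fps_to_fls (Abs_fps (\<lambda>n. fps_to_fls (fps_nth F n)))"

lemma coeff2_lift2:
  "coeff2 (lift2 F) m n = (if m < 0 \<or> n < 0 then 0 else fps_nth (fps_nth F (nat n)) (nat m))"
  by (simp add: coeff2_def lift2_def fps_to_fls_nth)

lemma lift2_add: "lift2 (F + G) = lift2 F + lift2 G"
  unfolding lift2_def
  by (subst fps_to_fls_plus[symmetric], rule arg_cong[of _ _ fps_to_fls]) (simp add: fps_eq_iff)

lemma lift2_uminus: "lift2 (- F) = - lift2 F"
  unfolding lift2_def
  by (subst fps_to_fls_uminus[symmetric], rule arg_cong[of _ _ fps_to_fls]) (simp add: fps_eq_iff)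

lemma lift2_diff: "lift2 (F - G) = lift2 F - lift2 G"
  using lift2_add[of F "- G"] by (simp add: lift2_uminus)

lemma fps_to_fls_sum: "fps_to_fls (sum f I) = (\<Sum>i\<in>I. fps_to_fls (f i))"
  by (induction I rule: infinite_finite_induct) auto

lemma lift2_mult: "lift2 (F * G) = lift2 F * lift2 G"
  unfolding lift2_def
  by (subst fls_times_fps_to_fls[symmetric], rule arg_cong[of _ _ fps_to_fls])
     (simp add: fps_eq_iff fps_mult_nth fps_to_fls_sum fls_times_fps_to_fls)

lemma lift2_1: "lift2 1 = 1"
proof -
  have "Abs_fps (\<lambda>n. fps_to_fls (fps_nth 1 n)) = (1 :: complex fls fps)" by (simp add: fps_eq_iff)
  then show ?thesis by (simp add: lift2_def)
qed

lemma lift2_0: "lift2 0 = 0"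
  using lift2_add[of 0 0] by simp

lemma cst_lift2: "cst c = lift2 (fps_const (fps_const c))"
proof -
  have "Abs_fps (\<lambda>n. fps_to_fls (fps_nth (fps_const (fps_const c)) n)) = (fps_const (fls_const c))"
    by (simp add: fps_eq_iff)
  then show ?thesis by (simp add: lift2_def cst_def)
qed

lemma Z1_lift2: "Z1 = lift2 (fps_const fps_X)"
proof -
  have "Abs_fps (\<lambda>n. fps_to_fls (fps_nth (fps_const fps_X) n)) = (fps_const (fls_X :: complex fls))"
    by (simp add: fps_eq_iff)
  then show ?thesis by (simp add: lift2_def Z1_def)
qed

lemma Z2_lift2: "Z2 = lift2 fps_X"
proof -
  have "Abs_fps (\<lambda>n. fps_to_fls (fps_nth fps_X n)) = (fps_X :: complex fls fps)"
    by (simp add: fps_eq_iff)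
  then show ?thesis by (simp add: lift2_def Z2_def)
qed

text \<open>The power series inside K((z1))((z2)). Degree arguments take place here, since for an
  element of the big field the order in z1 need not be bounded below.\<close>

definition pser :: "ser set" where "pser = range lift2"

lemma pser_closed [intro]:
  "F \<in> pser \<Longrightarrow> G \<in> pser \<Longrightarrow> F + G \<in> pser" "F \<in> pser \<Longrightarrow> G \<in> pser \<Longrightarrow> F - G \<in> pser"
  "F \<in> pser \<Longrightarrow> G \<in> pser \<Longrightarrow> F * G \<in> pser" "F \<in> pser \<Longrightarrow> - F \<in> pser"
  "0 \<in> pser" "1 \<in> pser" "cst c \<in> pser" "Z1 \<in> pser" "Z2 \<in> pser"
  unfolding pser_def
  by (auto simp: lift2_add[symmetric] lift2_diff[symmetric] lift2_mult[symmetric] lift2_uminus[symmetric]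
      cst_lift2 Z1_lift2 Z2_lift2 intro: lift2_0[symmetric] lift2_1[symmetric] rangeI range_eqI)

lemma pser_power [intro]: "F \<in> pser \<Longrightarrow> F ^ n \<in> pser"
  by (induction n) auto

lemma pser_sum [intro]: "(\<And>i. i \<in> I \<Longrightarrow> f i \<in> pser) \<Longrightarrow> sum f I \<in> pser"
  by (induction I rule: infinite_finite_induct) auto

lemma pser_prod [intro]: "(\<And>i. i \<in> I \<Longrightarrow> f i \<in> pser) \<Longrightarrow> prod f I \<in> pser"
  by (induction I rule: infinite_finite_induct) auto

lemma coeff2_simps [simp]:
  "coeff2 (F + G) m n = coeff2 F m n + coeff2 G m n"
  "coeff2 (F - G) m n = coeff2 F m n - coeff2 G m n"
  "coeff2 (- F) m n = - coeff2 F m n" "coeff2 0 m n = 0"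
  "coeff2 (Z1 * F) m n = coeff2 F (m - 1) n" "coeff2 (Z2 * F) m n = coeff2 F m (n - 1)"
  "coeff2 (cst c * F) m n = c * coeff2 F m n"
  by (simp_all add: coeff2_def Z1_def Z2_def cst_def fls_X_times_conv_shift)

lemma coeff2_cst: "coeff2 (cst c) m n = (if m = 0 \<and> n = 0 then c else 0)"
  by (simp add: coeff2_def cst_def)

lemma coeff2_sum [simp]: "coeff2 (sum f I) m n = (\<Sum>i\<in>I. coeff2 (f i) m n)"
  by (induction I rule: infinite_finite_induct) auto

lemma cst_hom: "cst (a + b) = cst a + cst b" "cst (a * b) = cst a * cst b" "cst (a - b) = cst a - cst b"
   "cst (- a) = - cst a" "cst 1 = 1" "cst 0 = 0"
  unfolding cst_def
  by (simp_all only: fls_plus_const fls_minus_const fls_const_mult_const fls_const_uminus fls_const_1 fls_const_0)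

lemma cst_eq_iff [simp]: "cst a = cst b \<longleftrightarrow> a = b"
  by (metis coeff2_cst)

lemma cst_inverse: "cst (inverse a) = inverse (cst a)"
  by (simp add: cst_def fls_inverse_const)

lemma cst_power: "cst (a ^ n) = cst a ^ n" by (induction n) (simp_all add: cst_hom)
lemma cst_powi: "cst (a powi n) = cst a powi n"
  by (simp add: power_int_def cst_power cst_inverse)
lemma cst_prod: "cst (prod f I) = (\<Prod>i\<in>I. cst (f i))"
  by (induction I rule: infinite_finite_induct) (simp_all add: cst_hom)

lemma coeff2_monom_mult: "coeff2 (Z1 ^ i * Z2 ^ j * F) m n = coeff2 F (m - int i) (n - int j)"
proof -
  have a: "coeff2 (Z2 ^ j * F) m n = coeff2 F m (n - int j)" for m n
    by (induction j arbitrary: n) (simp_all add: mult.assoc algebra_simps)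
  have "coeff2 (Z1 ^ i * G) m n = coeff2 G (m - int i) n" for G m
    by (induction i arbitrary: m) (simp_all add: mult.assoc algebra_simps)
  then show ?thesis by (simp add: mult.assoc a)
qed

lemma coeff2_pser: "F \<in> pser \<Longrightarrow> m < 0 \<or> n < 0 \<Longrightarrow> coeff2 F m n = 0"
  by (auto simp: pser_def coeff2_lift2)

lemma unit_inverse:
  assumes "F * G = 1" "G \<in> pser" shows "inverse F \<in> pser"
  using assms by (metis inverse_unique)

lemma fps_geom: "(1 - fps_const c * fps_X) * Abs_fps (\<lambda>n. c ^ n) = (1 :: 'a::comm_ring_1 fps)"
  by (rule fps_ext) (auto simp: left_diff_distrib mult.assoc fps_mult_nth_1 simp flip: power_Suc split: nat.splits)

lemma pser_inverse_1:
  "inverse (1 - Z1 * cst c) \<in> pser" "inverse (1 - Z2 * cst c) \<in> pser" "inverse (1 - Z1 * Z2 * cst c) \<in> pser"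
proof -
  have "(1 - Z1 * cst c) * lift2 (fps_const (Abs_fps (\<lambda>n. c ^ n))) = lift2 1"
    unfolding Z1_lift2 cst_lift2
    using arg_cong[OF fps_geom[of c], of "\<lambda>x. lift2 (fps_const x)"]
    by (simp add: lift2_1[symmetric] mult.commute[of fps_X] fps_const_1_eq_1[symmetric]
        del: fps_const_1_eq_1 flip: lift2_mult lift2_diff)
  then show "inverse (1 - Z1 * cst c) \<in> pser" by (intro unit_inverse) (auto simp: pser_def lift2_1)
  have g: "(1 - lift2 fps_X * lift2 (fps_const d)) * lift2 (Abs_fps (\<lambda>n. d ^ n)) = lift2 1" for d
    by (simp only: lift2_1[symmetric] lift2_mult[symmetric] lift2_diff[symmetric] mult.commute[of fps_X] fps_geom)
  have "(1 - Z2 * cst c) * lift2 (Abs_fps (\<lambda>n. (fps_const c) ^ n)) = lift2 1"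
    using g[of "fps_const c"] by (simp add: Z2_lift2 cst_lift2)
  then show "inverse (1 - Z2 * cst c) \<in> pser" by (intro unit_inverse) (auto simp: pser_def lift2_1)
  have "Z1 * Z2 * cst c = lift2 fps_X * lift2 (fps_const (fps_X * fps_const c))"
    by (simp add: Z2_lift2 Z1_lift2 cst_lift2 mult_ac flip: lift2_mult)
  then have "(1 - Z1 * Z2 * cst c) * lift2 (Abs_fps (\<lambda>n. (fps_X * fps_const c) ^ n)) = lift2 1"
    using g[of "fps_X * fps_const c"] by simp
  then show "inverse (1 - Z1 * Z2 * cst c) \<in> pser" by (intro unit_inverse) (auto simp: pser_def lift2_1)
qed

section \<open>Operators on columns of series\<close>

definition monom_ideal :: "nat \<Rightarrow> nat \<Rightarrow> ser set" where
  "monom_ideal i j = (\<lambda>h. Z1 ^ i * Z2 ^ j * h) ` pser"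

lemma monom_ideal_add: "x \<in> monom_ideal i j \<Longrightarrow> y \<in> monom_ideal i j \<Longrightarrow> x + y \<in> monom_ideal i j"
  unfolding monom_ideal_def image_iff by (metis pser_closed(1) distrib_left)

lemma monom_ideal_mult: "x \<in> monom_ideal i j \<Longrightarrow> d \<in> pser \<Longrightarrow> d * x \<in> monom_ideal i j"
  unfolding monom_ideal_def image_iff by (metis pser_closed(3) mult.left_commute)

lemma monom_ideal_0 [simp]: "0 \<in> monom_ideal i j"
  unfolding monom_ideal_def image_iff by (metis pser_closed(5) mult_zero_right)

lemma monom_ideal_mono:
  assumes "x \<in> monom_ideal i j" "i' \<le> i" "j' \<le> j" shows "x \<in> monom_ideal i' j'"
proof -
  obtain h where h: "h \<in> pser" "x = Z1 ^ i * Z2 ^ j * h" using assms(1) by (auto simp: monom_ideal_def)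
  have "Z1 ^ i = Z1 ^ i' * Z1 ^ (i - i')" "Z2 ^ j = Z2 ^ j' * Z2 ^ (j - j')"
    using assms(2,3) by (simp_all add: power_add[symmetric])
  then have "x = Z1 ^ i' * Z2 ^ j' * (Z1 ^ (i - i') * Z2 ^ (j - j') * h)"
    by (simp add: h(2) mult_ac)
  moreover have "Z1 ^ (i - i') * Z2 ^ (j - j') * h \<in> pser" using h(1) by auto
  ultimately show ?thesis unfolding monom_ideal_def image_iff by blast
qed

lemma monom_ideal_pser: "monom_ideal i j \<subseteq> pser"
  by (auto simp: monom_ideal_def)

lemma coeff2_monom_ideal:
  assumes "x \<in> monom_ideal i j" "m < int i \<or> n < int j" shows "coeff2 x m n = 0"
proof -
  obtain h where h: "h \<in> pser" "x = Z1 ^ i * Z2 ^ j * h" using assms(1) by (auto simp: monom_ideal_def)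
  show ?thesis unfolding h(2) coeff2_monom_mult using assms(2) by (intro coeff2_pser[OF h(1)]) auto
qed

text \<open>Ensures that a given coefficient meets only finitely many positions. The slack
  \<open>c\<close> is needed because each shift costs one degree; the subtraction is truncated at
  0.\<close>

definition graded :: "nat \<Rightarrow> (nat \<Rightarrow> nat \<Rightarrow> ser) \<Rightarrow> bool" where
  "graded c g \<longleftrightarrow> (\<forall>l j. g l j \<in> monom_ideal (l - c) (j - c))"

lemma graded_mono: "graded c g \<Longrightarrow> c \<le> c' \<Longrightarrow> graded c' g"
  unfolding graded_def by (meson monom_ideal_mono diff_le_mono2)

lemma graded_add: "graded c g \<Longrightarrow> graded c h \<Longrightarrow> graded c (\<lambda>l j. g l j + h l j)"
  by (simp add: graded_def monom_ideal_add)

lemma graded_diag: "graded c g \<Longrightarrow> (\<And>l j. d l j \<in> pser) \<Longrightarrow> graded c (\<lambda>l j. d l j * g l j)"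
  by (simp add: graded_def monom_ideal_mult)

lemma graded_pser: "graded c g \<Longrightarrow> g l j \<in> pser"
  by (meson monom_ideal_pser graded_def subsetD)

definition lowerL :: "(nat \<Rightarrow> nat \<Rightarrow> ser) \<Rightarrow> nat \<Rightarrow> nat \<Rightarrow> ser" where
  "lowerL g l j = (if l = 0 then 0 else g (l - 1) j)"
definition lowerM :: "(nat \<Rightarrow> nat \<Rightarrow> ser) \<Rightarrow> nat \<Rightarrow> nat \<Rightarrow> ser" where
  "lowerM g l j = (if j = 0 then 0 else g l (j - 1))"

lemma graded_lower:
  assumes "graded c g" shows "graded (Suc c) (lowerL g)" "graded (Suc c) (lowerM g)"
proof -
  have "g (l - 1) j \<in> monom_ideal (l - Suc c) (j - Suc c)" "g l (j - 1) \<in> monom_ideal (l - Suc c) (j - Suc c)" for l j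
    by (rule monom_ideal_mono[OF assms[unfolded graded_def, rule_format]]; simp)+
  then show "graded (Suc c) (lowerL g)" "graded (Suc c) (lowerM g)"
    by (auto simp: graded_def lowerL_def lowerM_def)
qed

definition is_colop :: "((nat \<Rightarrow> nat \<Rightarrow> ser) \<Rightarrow> nat \<Rightarrow> nat \<Rightarrow> ser) \<Rightarrow> bool" where
  "is_colop f \<longleftrightarrow> (\<forall>g h. f (\<lambda>l j. g l j + h l j) = (\<lambda>l j. f g l j + f h l j)) \<and>
     (\<forall>a g. f (\<lambda>l j. a * g l j) = (\<lambda>l j. a * f g l j)) \<and>
     (\<forall>g c. graded c g \<longrightarrow> (\<exists>c'. graded c' (f g)))"

lemma is_colopI:
  assumes "\<And>g h l j. f (\<lambda>l j. g l j + h l j) l j = f g l j + f h l j"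
    "\<And>a g l j. f (\<lambda>l j. a * g l j) l j = a * f g l j"
    "\<And>g c. graded c g \<Longrightarrow> \<exists>c'. graded c' (f g)"
  shows "is_colop f"
  unfolding is_colop_def using assms by (auto simp: fun_eq_iff)

lemma is_colop_diag: "(\<And>l j. d l j \<in> pser) \<Longrightarrow> is_colop (\<lambda>g l j. d l j * g l j)"
  by (rule is_colopI) (auto simp: distrib_left mult.left_commute intro: graded_diag)

text \<open>A type of operators rather than a set, so that it can be made an instance of
  \<open>ring_1\<close> and the abstract algebra \<open>toda\<close> applies.\<close>

typedef colop = "{f. is_colop f}" morphisms app Abs_colop
  using is_colop_diag[of "\<lambda>_ _. 0"] by auto

lemma app_add: "app A (\<lambda>l j. g l j + h l j) l j = app A g l j + app A h l j"
  using app[of A] by (simp add: is_colop_def)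
lemma app_scale: "app A (\<lambda>l j. a * g l j) l j = a * app A g l j"
  using app[of A] by (simp add: is_colop_def)
lemma app_graded: "graded c g \<Longrightarrow> \<exists>c'. graded c' (app A g)"
  using app[of A] by (auto simp: is_colop_def)

lemma colop_eqI: "(\<And>g l j. app A g l j = app B g l j) \<Longrightarrow> A = B"
  by (metis app_inject ext)

lemma app_Abs: "is_colop f \<Longrightarrow> app (Abs_colop f) = f"
  by (simp add: Abs_colop_inverse)

instantiation colop :: ring_1
begin

definition "0 = Abs_colop (\<lambda>g l j. 0)"
definition "1 = Abs_colop (\<lambda>g. g)"
definition "A + B = Abs_colop (\<lambda>g l j. app A g l j + app B g l j)"
definition "A - B = Abs_colop (\<lambda>g l j. app A g l j - app B g l j)"
definition "- A = Abs_colop (\<lambda>g l j. - app A g l j)"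
definition "A * B = Abs_colop (\<lambda>g. app A (app B g))"

lemma app_ring [simp]:
  "app 0 g l j = 0" "app 1 g = g" "app (A + B) g l j = app A g l j + app B g l j"
  "app (A - B) g l j = app A g l j - app B g l j" "app (- A) g l j = - app A g l j"
  "app (A * B) g = app A (app B g)"
proof -
  have neg: "graded c (\<lambda>l j. - g l j)" if "graded c g" for c g
    using graded_diag[OF that, of "\<lambda>_ _. - 1"] by auto
  have add: "\<exists>c'. graded c' (\<lambda>l j. g l j + h l j)" if "\<exists>c. graded c g" "\<exists>c. graded c h" for g h
  proof -
    from that obtain c c' where "graded c g" "graded c' h" by blast
    then have "graded (max c c') g" "graded (max c c') h" by (auto intro: graded_mono)
    then show ?thesis using graded_add by blast
  qed
  have "is_colop (\<lambda>g l j. 0)" using is_colop_diag[of "\<lambda>_ _. 0"] by auto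
  then show "app 0 g l j = 0" by (simp add: zero_colop_def app_Abs)
  have "is_colop (\<lambda>g. g)" by (rule is_colopI) auto
  then show "app 1 g = g" by (simp add: one_colop_def app_Abs)
  have "is_colop (\<lambda>g l j. app A g l j + app B g l j)"
    by (rule is_colopI) (auto simp: app_add app_scale distrib_left intro!: add app_graded)
  then show "app (A + B) g l j = app A g l j + app B g l j" by (simp add: plus_colop_def app_Abs)
  have "is_colop (\<lambda>g l j. app A g l j - app B g l j)"
  proof (rule is_colopI)
    fix g c assume "graded c g"
    then show "\<exists>c'. graded c' (\<lambda>l j. app A g l j - app B g l j)"
      using add[of "app A g" "\<lambda>l j. - app B g l j"] app_graded[of c g B] app_graded[of c g A] neg by auto
  qed (auto simp: app_add app_scale algebra_simps)
  then show "app (A - B) g l j = app A g l j - app B g l j" by (simp add: minus_colop_def app_Abs)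
  have "is_colop (\<lambda>g l j. - app A g l j)"
  proof (rule is_colopI)
    fix g c assume "graded c g"
    then show "\<exists>c'. graded c' (\<lambda>l j. - app A g l j)" using app_graded[of c g A] neg by blast
  qed (auto simp: app_add app_scale)
  then show "app (- A) g l j = - app A g l j" by (simp add: uminus_colop_def app_Abs)
  have "is_colop (\<lambda>g. app A (app B g))"
  proof (rule is_colopI)
    fix g c assume "graded c g"
    then show "\<exists>c'. graded c' (app A (app B g))" using app_graded by blast
  next
    fix g h l j
    have "app B (\<lambda>l j. g l j + h l j) = (\<lambda>l j. app B g l j + app B h l j)" by (intro ext) (rule app_add)
    then show "app A (app B (\<lambda>l j. g l j + h l j)) l j = app A (app B g) l j + app A (app B h) l j"
      by (simp add: app_add)
  next
    fix a g l j
    have "app B (\<lambda>l j. a * g l j) = (\<lambda>l j. a * app B g l j)" by (intro ext) (rule app_scale)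
    then show "app A (app B (\<lambda>l j. a * g l j)) l j = a * app A (app B g) l j"
      by (simp add: app_scale)
  qed
  then show "app (A * B) g = app A (app B g)" by (simp add: times_colop_def app_Abs)
qed

instance
proof
  fix A B C :: colop
  show "A * B * C = A * (B * C)" by (rule colop_eqI) simp
  show "(A + B) * C = A * C + B * C" by (rule colop_eqI) simp
  show "A * (B + C) = A * B + A * C"
  proof (rule colop_eqI)
    fix g l j
    have "app (B + C) g = (\<lambda>l j. app B g l j + app C g l j)" by (intro ext) simp
    then show "app (A * (B + C)) g l j = app (A * B + A * C) g l j" by (simp add: app_add)
  qed
  show "(0 :: colop) \<noteq> 1"
  proof
    assume "(0 :: colop) = 1"
    then have "app 0 (\<lambda>_ _. 1) 0 0 = app 1 (\<lambda>_ _. 1) 0 0" by simp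
    then show False by simp
  qed
qed (rule colop_eqI, simp add: algebra_simps)+

end

definition diag :: "(nat \<Rightarrow> nat \<Rightarrow> ser) \<Rightarrow> colop" where
  "diag d = Abs_colop (\<lambda>g l j. d l j * g l j)"
definition shL :: colop where "shL = Abs_colop lowerL"
definition shM :: colop where "shM = Abs_colop lowerM"

lemma app_diag: "(\<And>l j. d l j \<in> pser) \<Longrightarrow> app (diag d) g l j = d l j * g l j"
  unfolding diag_def by (subst app_Abs) (auto intro: is_colop_diag)

lemma app_sh: "app shL = lowerL" "app shM = lowerM"
proof -
  have "is_colop lowerL"
    by (rule is_colopI) (auto simp: lowerL_def[of _ "_ :: nat"] dest: graded_lower(1))
  moreover have "is_colop lowerM"
    by (rule is_colopI) (auto simp: lowerM_def[of _ "_ :: nat"] dest: graded_lower(2))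
  ultimately show "app shL = lowerL" "app shM = lowerM" by (simp_all add: shL_def shM_def app_Abs)
qed

lemma diag_scalar_central: "a \<in> pser \<Longrightarrow> A * diag (\<lambda>_ _. a) = diag (\<lambda>_ _. a) * A"
proof (rule colop_eqI)
  fix g l j assume a: "a \<in> pser"
  have "app (diag (\<lambda>_ _. a)) h = (\<lambda>l j. a * h l j)" for h by (intro ext app_diag a)
  then show "app (A * diag (\<lambda>_ _. a)) g l j = app (diag (\<lambda>_ _. a) * A) g l j"
    by (simp add: app_scale)
qed

text \<open>The sum over all positions of the coefficient of z1^m z2^n is finite, so it is expressed
  by eventually constant partial sums.\<close>

definition total :: "int \<Rightarrow> int \<Rightarrow> (nat \<Rightarrow> nat \<Rightarrow> ser) \<Rightarrow> complex \<Rightarrow> bool" where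
  "total m n g v \<longleftrightarrow> eventually (\<lambda>N. (\<Sum>l\<le>N. \<Sum>j\<le>N. coeff2 (g l j) m n) = v) sequentially"

lemma total_add: "total m n g v \<Longrightarrow> total m n h v' \<Longrightarrow> total m n (\<lambda>l j. g l j + h l j) (v + v')"
  unfolding total_def by (auto elim: eventually_elim2 simp: sum.distrib)

lemma total_diff: "total m n g v \<Longrightarrow> total m n h v' \<Longrightarrow> total m n (\<lambda>l j. g l j - h l j) (v - v')"
  unfolding total_def by (auto elim: eventually_elim2 simp: sum_subtractf)

lemma total_zero [simp]: "total m n (\<lambda>l j. 0) 0"
  by (simp add: total_def)

lemma total_sum: "(\<And>i. i \<in> I \<Longrightarrow> total m n (f i) (v i)) \<Longrightarrow> total m n (\<lambda>l j. \<Sum>i\<in>I. f i l j) (\<Sum>i\<in>I. v i)"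
  by (induction I rule: infinite_finite_induct) (auto intro: total_add)

text \<open>The partial sums telescope to the boundary line at \<open>N\<close>, whose entries are
  of too high degree to reach the coefficient once \<open>N\<close> is large. This is the concrete
  content of \<open>row_eq\<close>.\<close>

lemma total_shift:
  assumes "graded c g"
  shows "total m n (\<lambda>l j. g l j - lowerL g l j) 0" "total m n (\<lambda>l j. g l j - lowerM g l j) 0"
proof -
  have tel: "(\<Sum>i\<le>N. f i - (if i = 0 then 0 else f (i - 1))) = f N" for f :: "nat \<Rightarrow> complex" and N
    by (induction N) auto
  have cf: "coeff2 (if b then 0 else x) m n = (if b then 0 else coeff2 x m n)" for b x by simp
  have ev: "eventually (\<lambda>N. m + int c < int N \<and> n + int c < int N) sequentially"
    using eventually_ge_at_top[of "nat (max m n + int c + 1)"] by eventually_elim linarith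
  have z: "coeff2 (g l j) m n = 0" if "m + int c < int l \<or> n + int c < int j" for l j
    using assms that by (intro coeff2_monom_ideal[of _ "l - c" "j - c"]) (auto simp: graded_def)
  show "total m n (\<lambda>l j. g l j - lowerM g l j) 0"
    unfolding total_def using ev
    by eventually_elim (simp add: lowerM_def cf tel[of "\<lambda>j. coeff2 (g _ j) m n"] z)
  have "(\<Sum>l\<le>N. \<Sum>j\<le>N. coeff2 (g l j - lowerL g l j) m n) = (\<Sum>j\<le>N. coeff2 (g N j) m n)" for N
    by (subst sum.swap) (simp add: lowerL_def cf tel[of "\<lambda>l. coeff2 (g l _) m n"])
  then show "total m n (\<lambda>l j. g l j - lowerL g l j) 0"
    unfolding total_def by (intro eventually_mono[OF ev]) (simp add: z)
qed

definition same_total :: "(nat \<Rightarrow> nat \<Rightarrow> ser) \<Rightarrow> (nat \<Rightarrow> nat \<Rightarrow> ser) \<Rightarrow> bool" where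
  "same_total g h \<longleftrightarrow> (\<forall>m n. total m n (\<lambda>l j. g l j - h l j) 0)"

lemma same_total_total: "same_total g h \<Longrightarrow> total m n h v \<Longrightarrow> total m n g v"
  unfolding same_total_def using total_add[of m n "\<lambda>l j. g l j - h l j" 0 h v] by simp

lemma same_total_refl [simp]: "same_total g g" by (simp add: same_total_def)

lemma same_total_add: "same_total g h \<Longrightarrow> same_total g' h' \<Longrightarrow> same_total (\<lambda>l j. g l j + g' l j) (\<lambda>l j. h l j + h' l j)"
  unfolding same_total_def using total_add[of _ _ "\<lambda>l j. g l j - h l j" 0 "\<lambda>l j. g' l j - h' l j" 0]
  by (simp add: algebra_simps)

lemma same_total_diff: "same_total g h \<Longrightarrow> same_total g' h' \<Longrightarrow> same_total (\<lambda>l j. g l j - g' l j) (\<lambda>l j. h l j - h' l j)"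
  unfolding same_total_def using total_diff[of _ _ "\<lambda>l j. g l j - h l j" 0 "\<lambda>l j. g' l j - h' l j" 0]
  by (simp add: algebra_simps)

lemma same_total_trans: "same_total g h \<Longrightarrow> same_total h k \<Longrightarrow> same_total g k"
  unfolding same_total_def using total_add[of _ _ "\<lambda>l j. g l j - h l j" 0 "\<lambda>l j. h l j - k l j" 0]
  by simp

section \<open>The transfer operator\<close>

lemma qpoch_cst: "qpoch (cst a) (cst q) n = cst (qpoch a q n)"
proof -
  have "cst (1 - a * q ^ j) = 1 - cst a * cst q ^ j" "cst (1 - a * inverse q ^ j) = 1 - cst a * inverse (cst q) ^ j" for j
    by (simp_all add: cst_hom cst_power cst_inverse)
  moreover have "cst (1 / x) = 1 / cst x" for x by (simp add: cst_inverse divide_inverse cst_hom)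
  ultimately show ?thesis by (simp add: qpoch_def cst_prod)
qed

lemma monomial_neq_1: "Z1 * cst c \<noteq> 1" "Z2 * cst c \<noteq> 1" "Z1 * Z2 * cst c \<noteq> 1"
proof -
  have 1: "coeff2 1 0 0 = 1" using coeff2_cst[of 1] by (simp add: cst_hom)
  have 0: "coeff2 (Z1 * cst c) 0 0 = 0" "coeff2 (Z2 * cst c) 0 0 = 0" "coeff2 (Z1 * Z2 * cst c) 0 0 = 0"
    by (simp_all add: coeff2_cst mult.assoc)
  show "Z1 * cst c \<noteq> 1" "Z2 * cst c \<noteq> 1" "Z1 * Z2 * cst c \<noteq> 1"
    using 0 1 by (metis zero_neq_one)+
qed

locale qser =
  fixes q :: complex
  assumes q_pos: "0 < norm q" and q_less: "norm q < 1"
begin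

lemma q0 [simp]: "q \<noteq> 0" using q_pos by auto

lemma q_power_inj: "q ^ m = q ^ n \<Longrightarrow> m = n"
proof -
  assume "q ^ m = q ^ n"
  then have "norm q ^ m = norm q ^ n" by (metis norm_power)
  then show ?thesis using q_pos q_less by (metis less_irrefl linorder_neqE_nat power_strict_decreasing)
qed

lemma q_power_neq_1: "0 < n \<Longrightarrow> q ^ n \<noteq> 1"
  using q_power_inj[of n 0] by auto

sublocale Q: qfield "cst q" Z1 Z2 "Z1 * Z2"
proof
  show "cst q \<noteq> 0" using cst_eq_iff[of q 0] by (simp add: cst_hom)
  show "cst q ^ n \<noteq> 1" if "0 < n" for n
    using q_power_neq_1[OF that] cst_eq_iff[of "q ^ n" 1] by (simp add: cst_hom cst_power)
qed (use monomial_neq_1 in \<open>simp_all add: cst_powi[symmetric]\<close>)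

definition inv_qfact :: "nat \<Rightarrow> ser" where "inv_qfact n = cst (inverse (qpoch q q (int n)))"

lemma inv_qfact_rq: "inv_qfact n = inverse (qpoch (cst q) (cst q) (int n))"
  by (simp add: inv_qfact_def cst_inverse qpoch_cst)

lemma inv_qfact_0 [simp]: "inv_qfact 0 = 1"
  by (simp add: inv_qfact_def qpoch_def cst_hom)

lemma inv_qfact_Suc: "inv_qfact n = (1 - cst (q ^ Suc n)) * inv_qfact (Suc n)"
  using Q.rq_rec[of "int (Suc n)"] unfolding inv_qfact_rq by (simp only: power_int_of_nat cst_power) simp

lemma inv_qfact_pser: "inv_qfact n \<in> pser" by (auto simp: inv_qfact_def)

definition qconv :: "nat \<Rightarrow> (nat \<Rightarrow> ser) \<Rightarrow> ser" where "qconv n f = (\<Sum>i\<le>n. f i * inv_qfact (n - i))"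

lemma qconv_add: "qconv n (\<lambda>i. f i + g i) = qconv n f + qconv n g" by (simp add: qconv_def algebra_simps sum.distrib)
lemma qconv_diff: "qconv n (\<lambda>i. f i - g i) = qconv n f - qconv n g" by (simp add: qconv_def algebra_simps sum_subtractf)
lemma qconv_scale: "qconv n (\<lambda>i. a * f i) = a * qconv n f" by (simp add: qconv_def mult.assoc sum_distrib_left)
lemma qconv_0 [simp]: "qconv n (\<lambda>i. 0) = 0" by (simp add: qconv_def)
lemma qconv_pser: "(\<And>i. f i \<in> pser) \<Longrightarrow> qconv n f \<in> pser" by (auto simp: qconv_def intro: inv_qfact_pser)
lemma qconv_swap: "qconv L (\<lambda>l. qconv M (g l)) = qconv M (\<lambda>j. qconv L (\<lambda>l. g l j))"
  unfolding qconv_def sum_distrib_right by (subst sum.swap) (simp add: mult_ac)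

text \<open>From 1/(q;q)_n - 1/(q;q)_(n-1) = q^n/(q;q)_n.\<close>

lemma qconv_raise:
  "qconv n (\<lambda>i. cst (inverse q ^ i) * f i) = cst (inverse q ^ n) * (qconv n f - (if n = 0 then 0 else qconv (n - 1) f))"
proof (cases n)
  case 0
  then show ?thesis by (simp add: qconv_def cst_hom)
next
  case (Suc m)
  have eq: "cst (inverse q ^ Suc m) * (f i * inv_qfact (Suc m - i) - f i * inv_qfact (m - i)) = cst (inverse q ^ i) * f i * inv_qfact (Suc m - i)"
    if "i \<le> m" for i
  proof -
    have *: "inverse q ^ Suc m * q ^ (Suc m - i) = inverse q ^ i"
      using that by (simp add: power_diff field_simps)
    have "f i * inv_qfact (Suc m - i) - f i * inv_qfact (m - i) = cst (q ^ (Suc m - i)) * (f i * inv_qfact (Suc m - i))"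
      using that by (simp add: Suc_diff_le inv_qfact_Suc[of "m - i"] algebra_simps)
    then have "cst (inverse q ^ Suc m) * (f i * inv_qfact (Suc m - i) - f i * inv_qfact (m - i)) =
       cst (inverse q ^ Suc m * q ^ (Suc m - i)) * (f i * inv_qfact (Suc m - i))"
      by (simp only: cst_hom mult.assoc)
    then show ?thesis unfolding * by (simp only: mult.assoc)
  qed
  have "cst (inverse q ^ Suc m) * (qconv (Suc m) f - qconv m f) =
      (\<Sum>i\<le>m. cst (inverse q ^ Suc m) * (f i * inv_qfact (Suc m - i) - f i * inv_qfact (m - i))) + cst (inverse q ^ Suc m) * f (Suc m)"
  proof -
    have "qconv (Suc m) f - qconv m f = (\<Sum>i\<le>m. f i * inv_qfact (Suc m - i) - f i * inv_qfact (m - i)) + f (Suc m)"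
      by (simp add: qconv_def sum_subtractf)
    then show ?thesis by (simp only: distrib_left sum_distrib_left)
  qed
  also have "\<dots> = qconv (Suc m) (\<lambda>i. cst (inverse q ^ i) * f i)"
    using eq by (simp add: qconv_def)
  finally show ?thesis using Suc by simp
qed

lemma qconv_shift: "qconv n (\<lambda>i. if i = 0 then 0 else f (i - 1)) = (if n = 0 then 0 else qconv (n - 1) f)"
  by (cases n) (simp_all add: qconv_def sum.atMost_Suc_shift del: sum.atMost_Suc)

lemma cst_q_inverse [simp]: "cst (inverse q ^ n) * (cst (q ^ n) * x) = x" "cst (q ^ n) * (cst (inverse q ^ n) * x) = x"
proof -
  have "inverse q ^ n * q ^ n = 1" by (simp add: power_mult_distrib[symmetric])
  then have "cst (inverse q ^ n) * cst (q ^ n) = 1" by (metis cst_hom(2,5))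
  then show "cst (inverse q ^ n) * (cst (q ^ n) * x) = x" "cst (q ^ n) * (cst (inverse q ^ n) * x) = x"
    by (metis mult.assoc mult.commute mult_1_left)+
qed

text \<open>\<open>qconv_raise\<close> read backwards, for the sequence q^i f_i.\<close>

lemma qconv_lower:
  "qconv n (\<lambda>i. cst (q ^ i) * f i - (if i = 0 then 0 else cst (q ^ (i - 1)) * f (i - 1))) = cst (q ^ n) * qconv n f"
proof -
  define h where "h i = cst (q ^ i) * f i" for i
  have "cst (q ^ n) * qconv n f = cst (q ^ n) * qconv n (\<lambda>i. cst (inverse q ^ i) * h i)" by (simp add: h_def)
  also have "\<dots> = qconv n h - (if n = 0 then 0 else qconv (n - 1) h)" by (simp only: qconv_raise cst_q_inverse)
  also have "\<dots> = qconv n (\<lambda>i. h i - (if i = 0 then 0 else h (i - 1)))" by (simp only: qconv_diff qconv_shift)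
  finally show ?thesis unfolding h_def ..
qed

lemma powi_collect: "q ^ n * inverse q ^ m * q powi i = q powi (int n - int m + i)"
  by (simp add: power_int_add power_int_diff divide_inverse power_inverse)

lemma powi_collect': "inverse q ^ m * q powi i = q powi (i - int m)"
  by (simp add: power_int_diff divide_inverse power_inverse mult.commute)

definition weight :: "nat \<Rightarrow> nat \<Rightarrow> ser" where
  "weight L M = Z1 ^ L * Z2 ^ M * cst (q powi (int L ^ 2 - int L * int M + int M ^ 2))"

text \<open>The quadratic exponent grows by 2 L + 1 - M when L grows by 1. This produces the term
  \<open>z1 * (S * P' * R * t)\<close> of \<open>tau_P\<close>.\<close>

lemma weight_L: "Z1 * (cst (q ^ L) * (cst (inverse q ^ M) * weight L M)) = cst (inverse q ^ Suc L) * weight (Suc L) M"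
proof -
  have "q ^ L * inverse q ^ M * q powi (int L ^ 2 - int L * int M + int M ^ 2) = 
    inverse q ^ Suc L * q powi (int (Suc L) ^ 2 - int (Suc L) * int M + int M ^ 2)"
    unfolding powi_collect powi_collect' by (simp add: power2_eq_square algebra_simps)
  from arg_cong[OF this, of cst] show ?thesis
    unfolding weight_def cst_hom by (simp add: mult_ac)
qed

lemma weight_M: "Z2 * (cst (q ^ M) * (cst (inverse q ^ L) * weight L M)) = cst (inverse q ^ Suc M) * weight L (Suc M)"
proof -
  have "q ^ M * inverse q ^ L * q powi (int L ^ 2 - int L * int M + int M ^ 2) = 
    inverse q ^ Suc M * q powi (int L ^ 2 - int L * int (Suc M) + int (Suc M) ^ 2)"
    unfolding powi_collect powi_collect' by (simp add: power2_eq_square algebra_simps)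
  from arg_cong[OF this, of cst] show ?thesis
    unfolding weight_def cst_hom by (simp add: mult_ac)
qed

definition tauf :: "(nat \<Rightarrow> nat \<Rightarrow> ser) \<Rightarrow> nat \<Rightarrow> nat \<Rightarrow> ser" where
  "tauf g L M = weight L M * qconv L (\<lambda>l. qconv M (g l))"

lemma graded_tauf: "graded c g \<Longrightarrow> graded 0 (tauf g)"
proof -
  assume g: "graded c g"
  have "cst x * qconv L (\<lambda>l. qconv M (g l)) \<in> pser" for x L M
    using graded_pser[OF g] by (intro pser_closed qconv_pser)
  then show ?thesis unfolding graded_def tauf_def weight_def monom_ideal_def by (auto simp: mult.assoc)
qed

lemma is_colop_tauf: "is_colop tauf"
  by (rule is_colopI) (auto simp: tauf_def qconv_add qconv_scale distrib_left dest: graded_tauf)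

definition "opP = diag (\<lambda>l j. cst (inverse q ^ l))"
definition "opP' = diag (\<lambda>l j. cst (q ^ l))"
definition "opR = diag (\<lambda>l j. cst (inverse q ^ j))"
definition "opR' = diag (\<lambda>l j. cst (q ^ j))"
definition "opT = Abs_colop tauf"
definition "scalar a = diag (\<lambda>_ _. a)"

lemma app_ops [simp]:
  "app opP g = (\<lambda>l j. cst (inverse q ^ l) * g l j)" "app opP' g = (\<lambda>l j. cst (q ^ l) * g l j)"
  "app opR g = (\<lambda>l j. cst (inverse q ^ j) * g l j)" "app opR' g = (\<lambda>l j. cst (q ^ j) * g l j)"
  "app opT g = tauf g" "a \<in> pser \<Longrightarrow> app (scalar a) g = (\<lambda>l j. a * g l j)"
proof -
  have d: "app (diag d) g = (\<lambda>l j. d l j * g l j)" if "\<And>l j. d l j \<in> pser" for d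
    by (intro ext app_diag that)
  show "app opP g = (\<lambda>l j. cst (inverse q ^ l) * g l j)" "app opP' g = (\<lambda>l j. cst (q ^ l) * g l j)"
    "app opR g = (\<lambda>l j. cst (inverse q ^ j) * g l j)" "app opR' g = (\<lambda>l j. cst (q ^ j) * g l j)"
    "app opT g = tauf g" "a \<in> pser \<Longrightarrow> app (scalar a) g = (\<lambda>l j. a * g l j)"
    unfolding opP_def opP'_def opR_def opR'_def opT_def scalar_def
    by (simp_all add: d app_Abs is_colop_tauf pser_closed)
qed

lemma lower_simps:
  "lowerL g l j = (if l = 0 then 0 else g (l - 1) j)" "lowerM g l j = (if j = 0 then 0 else g l (j - 1))"
  by (simp_all add: lowerL_def lowerM_def)

lemma tau_relations:
  "opT * opP = opP * opT - scalar Z1 * (shL * opP' * opR * opT)"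
  "opT * opR = opR * opT - scalar Z2 * (shM * opR' * opP * opT)"
  "opT * (1 - shL) * opP' = opP' * opT"
  "opT * (1 - shM) * opR' = opR' * opT"
proof -
  have Z: "Z1 \<in> pser" "Z2 \<in> pser" by auto
  show "opT * opP = opP * opT - scalar Z1 * (shL * opP' * opR * opT)"
  proof (rule colop_eqI)
    fix g L M
    have "app (opT * opP) g L M = weight L M * qconv L (\<lambda>l. cst (inverse q ^ l) * qconv M (g l))"
      by (simp add: tauf_def qconv_scale)
    also have "\<dots> = cst (inverse q ^ L) * tauf g L M - (if L = 0 then 0 else (cst (inverse q ^ L) * weight L M) * qconv (L - 1) (\<lambda>l. qconv M (g l)))"
      unfolding qconv_raise by (simp add: tauf_def algebra_simps)
    also have "\<dots> = app (opP * opT - scalar Z1 * (shL * opP' * opR * opT)) g L M"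
    proof (cases L)
      case (Suc n)
      then show ?thesis
        by (simp add: Z app_sh lower_simps tauf_def weight_L[symmetric] mult.assoc del: power_Suc)
    qed (simp add: Z app_sh lower_simps)
    finally show "app (opT * opP) g L M = app (opP * opT - scalar Z1 * (shL * opP' * opR * opT)) g L M" .
  qed
  show "opT * opR = opR * opT - scalar Z2 * (shM * opR' * opP * opT)"
  proof (rule colop_eqI)
    fix g L M
    have "app (opT * opR) g L M = weight L M * qconv M (\<lambda>j. cst (inverse q ^ j) * qconv L (\<lambda>l. g l j))"
      by (simp add: tauf_def qconv_swap[of L M] qconv_scale)
    also have "\<dots> = cst (inverse q ^ M) * tauf g L M - (if M = 0 then 0 else (cst (inverse q ^ M) * weight L M) * qconv (M - 1) (\<lambda>j. qconv L (\<lambda>l. g l j)))"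
      unfolding qconv_raise by (simp add: tauf_def qconv_swap[of L M] algebra_simps)
    also have "\<dots> = app (opR * opT - scalar Z2 * (shM * opR' * opP * opT)) g L M"
    proof (cases M)
      case (Suc n)
      then show ?thesis
        by (simp add: Z app_sh lower_simps tauf_def qconv_swap[of L n] weight_M[symmetric] mult.assoc del: power_Suc)
    qed (simp add: Z app_sh lower_simps)
    finally show "app (opT * opR) g L M = app (opR * opT - scalar Z2 * (shM * opR' * opP * opT)) g L M" .
  qed
  have app_diff: "app (1 - A) h = (\<lambda>l j. h l j - app A h l j)" for A h by (intro ext) simp
  show "opT * (1 - shL) * opP' = opP' * opT"
  proof (rule colop_eqI)
    fix g L M
    have "qconv M (app (1 - shL) (app opP' g) l) = cst (q ^ l) * qconv M (g l) - (if l = 0 then 0 else cst (q ^ (l - 1)) * qconv M (g (l - 1)))" for l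
      by (simp add: app_diff app_sh lower_simps qconv_diff qconv_scale)
    then show "app (opT * (1 - shL) * opP') g L M = app (opP' * opT) g L M"
      by (simp add: tauf_def qconv_lower[of L "\<lambda>l. qconv M (g l)"])
  qed
  show "opT * (1 - shM) * opR' = opR' * opT"
  proof (rule colop_eqI)
    fix g L M
    have "qconv M (app (1 - shM) (app opR' g) l) = cst (q ^ M) * qconv M (g l)" for l
      by (simp add: app_diff app_sh lower_simps qconv_lower)
    then show "app (opT * (1 - shM) * opR') g L M = app (opR' * opT) g L M"
      by (simp add: tauf_def qconv_scale)
  qed
qed

sublocale T: toda opP opP' opR opR' shL shM opT "scalar Z1" "scalar Z2" "scalar (Z1 * Z2)" "scalar (cst (inverse q))"
proof
  have Z: "Z1 \<in> pser" "Z2 \<in> pser" "Z1 * Z2 \<in> pser" "cst (inverse q) \<in> pser" by auto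
  have inv1: "cst (inverse q ^ Suc l) * x = cst (inverse q) * (cst (inverse q ^ l) * x)" for l x
    by (simp add: cst_hom mult.assoc)
  show "opP * shL = scalar (cst (inverse q)) * (shL * opP)" "opR * shM = scalar (cst (inverse q)) * (shM * opR)"
    by (rule colop_eqI; rename_tac g l j; case_tac l; case_tac j; use inv1 in \<open>simp add: Z app_sh lower_simps\<close>)+
  show "scalar (Z1 * Z2) = scalar Z1 * scalar Z2" by (rule colop_eqI) (simp add: Z mult.assoc)
  show "x * scalar Z1 = scalar Z1 * x" "x * scalar Z2 = scalar Z2 * x" "x * scalar (Z1 * Z2) = scalar (Z1 * Z2) * x"
    "x * scalar (cst (inverse q)) = scalar (cst (inverse q)) * x" for x
    unfolding scalar_def by (rule diag_scalar_central, rule Z)+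
qed (rule tau_relations | (rule colop_eqI, simp add: app_sh lower_simps mult.left_commute))+

end

section \<open>Spectral decomposition\<close>

context qser
begin

lemma qpoch_pser:
  assumes "z \<in> pser" "\<And>c. inverse (1 - z * cst c) \<in> pser"
  shows "qpoch z (cst q) n \<in> pser" "inverse (qpoch z (cst q) n) \<in> pser"
proof -
  have c: "cst q ^ j = cst (q ^ j)" "inverse (cst q) ^ j = cst (inverse q ^ j)" for j
    by (simp_all add: cst_power cst_inverse)
  have p: "(\<Prod>j\<in>J. 1 - z * cst (f j)) \<in> pser" "inverse (\<Prod>j\<in>J. 1 - z * cst (f j)) \<in> pser" for J and f :: "nat \<Rightarrow> complex"
    using assms by (auto simp: prod_inversef[symmetric] intro!: pser_prod)
  show "qpoch z (cst q) n \<in> pser" "inverse (qpoch z (cst q) n) \<in> pser"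
    using p by (simp_all add: qpoch_def c inverse_eq_divide[symmetric])
qed

lemma p_pser:
  "Q.p1 n \<in> pser" "Q.p2 n \<in> pser" "Q.pw n \<in> pser" "inverse (Q.p1 n) \<in> pser" "inverse (Q.p2 n) \<in> pser" "inverse (Q.pw n) \<in> pser"
  by (intro qpoch_pser pser_closed pser_inverse_1)+

lemma rq_pser: "Q.rq n \<in> pser"
  by (auto simp: qpoch_cst cst_inverse[symmetric])

lemma theta_pser: "Q.theta r s L M \<in> pser"
  unfolding Q.theta_def divide_inverse inverse_mult_distrib by (intro pser_closed p_pser rq_pser)

lemma weight_monom_ideal: "x \<in> pser \<Longrightarrow> weight l j * x \<in> monom_ideal l j"
  unfolding weight_def monom_ideal_def image_iff by (metis pser_closed(3,7) mult.assoc)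

definition Psi :: "nat \<Rightarrow> nat \<Rightarrow> nat \<Rightarrow> nat \<Rightarrow> ser" where
  "Psi r s l j = weight l j * Q.theta (int r) (int s) (int l) (int j)"

lemma Psi_graded: "graded 0 (Psi r s)"
  by (simp add: graded_def Psi_def weight_monom_ideal theta_pser)

lemma Psi_zero: "l < r \<or> j < s \<Longrightarrow> Psi r s l j = 0"
  by (simp add: Psi_def Q.theta_zero)

lemma cst_q_powi:
  "cst q powi int n = cst (q ^ n)" "inverse (cst (q ^ n)) = cst (inverse q ^ n)"
  "cst q powi (int m - int n) = cst (q ^ m) * cst (inverse q ^ n)"
  by (simp_all add: cst_power cst_inverse power_int_diff Q.q0 divide_inverse power_inverse)

lemma ev_cst:
  "Q.ev1 (int l) (int j) = cst (inverse q ^ l) + Z1 * (cst (q ^ l) * cst (inverse q ^ j)) + Z1 * Z2 * cst (q ^ j)"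
  "Q.ev2 (int l) (int j) = cst (inverse q ^ j) + Z2 * (cst (q ^ j) * cst (inverse q ^ l)) + Z1 * Z2 * cst (q ^ l)"
  unfolding Q.ev1_def Q.ev2_def cst_q_powi by simp_all

lemma ev_pser: "Q.ev1 (int l) (int j) \<in> pser" "Q.ev2 (int l) (int j) \<in> pser"
  unfolding ev_cst by (intro pser_closed)+

lemma app_H1:
  "app T.H1 g l j = Q.ev1 (int l) (int j) * g l j
     - (if l = 0 then 0 else Z1 * (cst (q ^ (l - 1)) * (cst (inverse q ^ j) * g (l - 1) j)))
     - (if j = 0 then 0 else Z1 * Z2 * (cst (q ^ (j - 1)) * g l (j - 1)))"
proof -
  have Z: "Z1 \<in> pser" "Z2 \<in> pser" "Z1 * Z2 \<in> pser" by auto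
  show ?thesis unfolding T.H1_def ev_cst
    by (simp add: Z app_sh lower_simps algebra_simps)
qed

lemma app_H2:
  "app T.H2 g l j = Q.ev2 (int l) (int j) * g l j
     - (if j = 0 then 0 else Z2 * (cst (q ^ (j - 1)) * (cst (inverse q ^ l) * g l (j - 1))))
     - (if l = 0 then 0 else Z1 * Z2 * (cst (q ^ (l - 1)) * g (l - 1) j))"
proof -
  have Z: "Z1 \<in> pser" "Z2 \<in> pser" "Z1 * Z2 \<in> pser" by auto
  show ?thesis unfolding T.H2_def ev_cst
    by (simp add: Z app_sh lower_simps algebra_simps)
qed

lemma weight_lower:
  "l \<noteq> 0 \<Longrightarrow> Z1 * (cst (q ^ (l - 1)) * (cst (inverse q ^ j) * (weight (l - 1) j * x))) = cst (inverse q ^ l) * (weight l j * x)"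
  "j \<noteq> 0 \<Longrightarrow> Z2 * (cst (q ^ (j - 1)) * (cst (inverse q ^ l) * (weight l (j - 1) * x))) = cst (inverse q ^ j) * (weight l j * x)"
  using weight_L[of "l - 1" j] weight_M[of "j - 1" l] by (simp_all only: mult.assoc[symmetric] Suc_pred' neq0_conv Suc_diff_1)

lemma weight_lower':
  "l \<noteq> 0 \<Longrightarrow> Z1 * Z2 * (cst (q ^ (l - 1)) * (weight (l - 1) j * x)) = Z2 * (cst (q ^ j) * (cst (inverse q ^ l) * (weight l j * x)))"
  "j \<noteq> 0 \<Longrightarrow> Z1 * Z2 * (cst (q ^ (j - 1)) * (weight l (j - 1) * x)) = Z1 * (cst (q ^ l) * (cst (inverse q ^ j) * (weight l j * x)))"
proof -
  assume "l \<noteq> 0"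
  have "Z1 * Z2 * (cst (q ^ (l - 1)) * (cst (q ^ j) * (cst (inverse q ^ j) * (weight (l - 1) j * x)))) =
     Z2 * (cst (q ^ j) * (Z1 * (cst (q ^ (l - 1)) * (cst (inverse q ^ j) * (weight (l - 1) j * x)))))"
    by (simp only: mult_ac)
  from this[unfolded weight_lower(1)[OF \<open>l \<noteq> 0\<close>]] show "Z1 * Z2 * (cst (q ^ (l - 1)) * (weight (l - 1) j * x)) = Z2 * (cst (q ^ j) * (cst (inverse q ^ l) * (weight l j * x)))"
    by simp
next
  assume "j \<noteq> 0"
  have "Z1 * Z2 * (cst (q ^ (j - 1)) * (cst (q ^ l) * (cst (inverse q ^ l) * (weight l (j - 1) * x)))) =
     Z1 * (cst (q ^ l) * (Z2 * (cst (q ^ (j - 1)) * (cst (inverse q ^ l) * (weight l (j - 1) * x)))))"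
    by (simp only: mult_ac)
  from this[unfolded weight_lower(2)[OF \<open>j \<noteq> 0\<close>]] show "Z1 * Z2 * (cst (q ^ (j - 1)) * (weight l (j - 1) * x)) = Z1 * (cst (q ^ l) * (cst (inverse q ^ j) * (weight l j * x)))"
    by simp
qed

text \<open>The factor \<open>weight\<close> converts the two shift terms of \<open>H1\<close> into
  the right-hand side of \<open>theta_eigen\<close>.\<close>

lemma Psi_H1: "app T.H1 (Psi r s) = (\<lambda>l j. Q.ev1 (int r) (int s) * Psi r s l j)"
proof (intro ext)
  fix l j
  have 1: "(if l = 0 then 0 else Z1 * (cst (q ^ (l - 1)) * (cst (inverse q ^ j) * Psi r s (l - 1) j))) =
      cst (inverse q ^ l) * (weight l j * Q.theta (int r) (int s) (int l - 1) (int j))"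
    using weight_lower(1)[of l j] by (cases "l = 0") (auto simp: Psi_def Q.theta_zero of_nat_diff)
  have 2: "(if j = 0 then 0 else Z1 * Z2 * (cst (q ^ (j - 1)) * Psi r s l (j - 1))) =
      Z1 * (cst (q ^ l) * (cst (inverse q ^ j) * (weight l j * Q.theta (int r) (int s) (int l) (int j - 1))))"
    using weight_lower'(2)[of j l] by (cases "j = 0") (auto simp: Psi_def Q.theta_zero of_nat_diff)
  have "weight l j * ((Q.ev1 (int l) (int j) - Q.ev1 (int r) (int s)) * Q.theta (int r) (int s) (int l) (int j)) =
     weight l j * (cst (inverse q ^ l) * Q.theta (int r) (int s) (int l - 1) (int j)
       + Z1 * (cst (q ^ l) * cst (inverse q ^ j)) * Q.theta (int r) (int s) (int l) (int j - 1))"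
    unfolding Q.theta_eigen cst_q_powi ..
  then show "app T.H1 (Psi r s) l j = Q.ev1 (int r) (int s) * Psi r s l j"
    unfolding app_H1 1 2 by (simp add: Psi_def algebra_simps)
qed

lemma Psi_H2: "app T.H2 (Psi r s) = (\<lambda>l j. Q.ev2 (int r) (int s) * Psi r s l j)"
proof (intro ext)
  fix l j
  have 1: "(if j = 0 then 0 else Z2 * (cst (q ^ (j - 1)) * (cst (inverse q ^ l) * Psi r s l (j - 1)))) =
      cst (inverse q ^ j) * (weight l j * Q.theta (int r) (int s) (int l) (int j - 1))"
    using weight_lower(2)[of j l] by (cases "j = 0") (auto simp: Psi_def Q.theta_zero of_nat_diff)
  have 2: "(if l = 0 then 0 else Z1 * Z2 * (cst (q ^ (l - 1)) * Psi r s (l - 1) j)) =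
      Z2 * (cst (q ^ j) * (cst (inverse q ^ l) * (weight l j * Q.theta (int r) (int s) (int l - 1) (int j))))"
    using weight_lower'(1)[of l j] by (cases "l = 0") (auto simp: Psi_def Q.theta_zero of_nat_diff)
  have "weight l j * ((Q.ev2 (int l) (int j) - Q.ev2 (int r) (int s)) * Q.theta (int r) (int s) (int l) (int j)) =
     weight l j * (cst (inverse q ^ j) * Q.theta (int r) (int s) (int l) (int j - 1)
       + Z2 * (cst (q ^ j) * cst (inverse q ^ l)) * Q.theta (int r) (int s) (int l - 1) (int j))"
    unfolding Q.theta_eigen' cst_q_powi ..
  then show "app T.H2 (Psi r s) l j = Q.ev2 (int r) (int s) * Psi r s l j"
    unfolding app_H2 1 2 by (simp add: Psi_def algebra_simps)
qed

text \<open>The constant coefficient is q^(-l) and that of z1 z2 is q^j; powers of q are distinct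
  because 0 < |q| < 1.\<close>

lemma ev1_inj:
  assumes "Q.ev1 (int l) (int j) = Q.ev1 (int r) (int s)" shows "l = r \<and> j = s"
proof -
  have c: "coeff2 (Q.ev1 (int l) (int j)) 0 0 = inverse q ^ l" "coeff2 (Q.ev1 (int l) (int j)) 1 1 = q ^ j" for l j
    unfolding ev_cst by (simp_all add: mult.assoc coeff2_cst cst_hom(2)[symmetric])
  have "inverse q ^ l = inverse q ^ r" "q ^ j = q ^ s" using assms c by metis+
  then show ?thesis using q_power_inj by (simp add: power_inverse)
qed

text \<open>H1 is lower triangular with pairwise distinct diagonal entries.\<close>

lemma eigen_unique:
  assumes H: "app T.H1 g = (\<lambda>l j. Q.ev1 (int r) (int s) * g l j)" and z: "g r s = 0"
  shows "g l j = 0"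
proof (induction "l + j" arbitrary: l j rule: less_induct)
  case less
  show ?case
  proof (cases "l = r \<and> j = s")
    case False
    have "(if l = 0 then 0 else Z1 * (cst (q ^ (l - 1)) * (cst (inverse q ^ j) * g (l - 1) j))) = 0"
      "(if j = 0 then 0 else Z1 * Z2 * (cst (q ^ (j - 1)) * g l (j - 1))) = 0"
      using less[of "l - 1" j] less[of l "j - 1"] by auto
    then have "Q.ev1 (int r) (int s) * g l j = Q.ev1 (int l) (int j) * g l j"
      using app_H1[of g l j] by (simp add: H)
    then show ?thesis using ev1_inj[of l j r s] False by auto
  qed (use z in auto)
qed

text \<open>By \<open>H1_tau\<close> the image is an eigenvector of \<open>H1\<close> with the same
  eigenvalue, hence a multiple by \<open>eigen_unique\<close>. The factor is read off at (r, s),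
  where the support starts and the convolution has a single term.\<close>

lemma Psi_tau: "app opT (Psi r s) = (\<lambda>l j. weight r s * Psi r s l j)"
proof -
  define g where "g = (\<lambda>l j. tauf (Psi r s) l j + (- weight r s) * Psi r s l j)"
  have "app T.H1 (tauf (Psi r s)) = (\<lambda>l j. Q.ev1 (int r) (int s) * tauf (Psi r s) l j)"
  proof -
    have "app T.H1 (tauf (Psi r s)) = app (T.H1 * opT) (Psi r s)" by simp
    also have "\<dots> = app opT (app T.H1 (Psi r s))" unfolding T.H1_tau by simp
    also have "\<dots> = (\<lambda>l j. Q.ev1 (int r) (int s) * tauf (Psi r s) l j)"
      unfolding Psi_H1 by (intro ext) (simp add: app_scale del: app_ops, simp)
    finally show ?thesis .
  qed
  then have H: "app T.H1 g = (\<lambda>l j. Q.ev1 (int r) (int s) * g l j)"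
    unfolding g_def by (intro ext) (simp only: app_add app_scale Psi_H1, simp add: algebra_simps)
  have "qconv s (Psi r s l) = (if l = r then Psi r s r s else 0)" if "l \<le> r" for l
  proof -
    have "qconv s (Psi r s l) = (\<Sum>i\<in>{s}. Psi r s l i * inv_qfact (s - i))"
      unfolding qconv_def by (rule sum.mono_neutral_right) (auto simp: Psi_zero)
    then show ?thesis using that by (auto simp: Psi_zero)
  qed
  then have "qconv r (\<lambda>l. qconv s (Psi r s l)) = (\<Sum>i\<in>{r}. qconv s (Psi r s i) * inv_qfact (r - i))"
    unfolding qconv_def[of r] by (intro sum.mono_neutral_right) auto
  then have "qconv r (\<lambda>l. qconv s (Psi r s l)) = Psi r s r s"
    using \<open>\<And>l. l \<le> r \<Longrightarrow> qconv s (Psi r s l) = (if l = r then Psi r s r s else 0)\<close>[of r] by simp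
  then have "g r s = 0" by (simp add: g_def tauf_def)
  from eigen_unique[OF H this] show ?thesis by (intro ext) (simp add: g_def)
qed

lemma row_eq_same_total:
  assumes "T.row_eq X Y" "graded c g" shows "same_total (app X g) (app Y g)"
proof -
  obtain a b where ab: "X - Y = (1 - shL) * a + (1 - shM) * b" using assms(1) by (auto simp: T.row_eq_def)
  obtain ca cb where g: "graded ca (app a g)" "graded cb (app b g)" using app_graded[OF assms(2)] by metis
  have "app X g l j - app Y g l j = (app a g l j - lowerL (app a g) l j) + (app b g l j - lowerM (app b g) l j)" for l j
    using arg_cong[OF ab, of "\<lambda>A. app A g l j"] by (simp add: app_sh)
  then show ?thesis
    unfolding same_total_def using total_add[OF total_shift(1)[OF g(1)] total_shift(2)[OF g(2)]] by simp
qed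

text \<open>Abstracted from \<open>Psi\<close> because the induction in \<open>spectral\<close> has
  to run over all its multiples by power series.\<close>

definition eig where
  "eig r s g \<longleftrightarrow> (\<exists>c. graded c g) \<and> app T.H1 g = (\<lambda>l j. Q.ev1 (int r) (int s) * g l j) \<and>
     app T.H2 g = (\<lambda>l j. Q.ev2 (int r) (int s) * g l j) \<and> app opT g = (\<lambda>l j. weight r s * g l j)"

lemma eig_Psi: "eig r s (Psi r s)"
  unfolding eig_def using Psi_graded Psi_H1 Psi_H2 Psi_tau by blast

lemma eig_scale: "eig r s g \<Longrightarrow> a \<in> pser \<Longrightarrow> eig r s (\<lambda>l j. a * g l j)"
  unfolding eig_def by (auto intro: graded_diag simp: app_scale fun_eq_iff simp del: app_ops(5))

lemma weight_pser: "weight l j \<in> pser" unfolding weight_def by (intro pser_closed pser_power)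


section \<open>Words acting on joint eigenvectors\<close>

lemma V_swap: "toda.V opR opP opT (scalar (Z1 * Z2)) (scalar (cst (inverse q))) k B A = T.V k A B"
proof -
  interpret sw: toda opR opR' opP opP' shM shL opT "scalar Z2" "scalar Z1" "scalar (Z1 * Z2)" "scalar (cst (inverse q))"
    by (rule T.symmetric)
  show ?thesis by (simp add: sw.V_def T.V_def T.row_swap)
qed

lemma V_step':
  assumes "A \<le> Suc (Suc k)"
  shows "T.row_eq (T.V (Suc k) A (Suc (Suc (Suc k))))
    (T.V k A (Suc (Suc k)) * opT * T.H2 - scalar Z2 * (T.V k A (Suc k) * opT * T.H1) + scalar Z2 * scalar (Z1 * Z2) * (T.V k A k * opT))"
proof -
  interpret sw: toda opR opR' opP opP' shM shL opT "scalar Z2" "scalar Z1" "scalar (Z1 * Z2)" "scalar (cst (inverse q))"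
    by (rule T.symmetric)
  have "sw.H1 = T.H2" "sw.H2 = T.H1" by (simp_all add: sw.H1_def sw.H2_def T.H1_def T.H2_def)
  moreover have "sw.row_eq x y \<longleftrightarrow> T.row_eq x y" for x y
    unfolding sw.row_eq_def T.row_eq_def by (metis add.commute)
  ultimately show ?thesis using sw.V_step[OF assms] by (simp add: V_swap)
qed

lemma V_zero: "T.V k 0 B = 0" "T.V k A 0 = 0"
  by (simp_all add: T.V_def)

text \<open>One recursion step applied to an eigenvector. The eigenvalues and central scalars are
  moved into the column, where the induction hypothesis can absorb them, since
  \<open>same_total\<close> is a statement about single coefficients.\<close>

lemma same_total_comb:
  assumes "T.row_eq X (Y1 * U1 - scalar z * (Y2 * U2) + scalar z' * Y3)" "graded c g" "z \<in> pser" "z' \<in> pser"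
    and "app U1 g = (\<lambda>l j. a1 * g l j)" "app U2 g = (\<lambda>l j. a2 * g l j)"
    and "same_total (app Y1 (\<lambda>l j. a1 * g l j)) (\<lambda>l j. b1 * (a1 * g l j))"
    and "same_total (app Y2 (\<lambda>l j. (z * a2) * g l j)) (\<lambda>l j. b2 * ((z * a2) * g l j))"
    and "same_total (app Y3 (\<lambda>l j. z' * g l j)) (\<lambda>l j. b3 * (z' * g l j))"
  shows "same_total (app X g) (\<lambda>l j. (b1 * a1 - b2 * (z * a2) + b3 * z') * g l j)"
proof -
  have "same_total (app X g) (app (Y1 * U1 - scalar z * (Y2 * U2) + scalar z' * Y3) g)"
    by (rule row_eq_same_total[OF assms(1,2)])
  also have "app (Y1 * U1 - scalar z * (Y2 * U2) + scalar z' * Y3) g =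
     (\<lambda>l j. app Y1 (\<lambda>l j. a1 * g l j) l j - app Y2 (\<lambda>l j. (z * a2) * g l j) l j + app Y3 (\<lambda>l j. z' * g l j) l j)"
    using assms(3-6) by (intro ext) (simp add: app_scale mult.assoc)
  finally have "same_total (app X g) \<dots>" .
  moreover have "same_total \<dots> (\<lambda>l j. b1 * (a1 * g l j) - b2 * ((z * a2) * g l j) + b3 * (z' * g l j))"
    by (intro same_total_add same_total_diff assms)
  ultimately show ?thesis using same_total_trans by (simp add: algebra_simps)
qed

text \<open>The range extends one beyond A = k + 1, the largest index of the theorem, because a word
  with A = k + 2 at level \<open>Suc k\<close> comes from level \<open>k\<close> with the same
  \<open>A\<close>. The new value k + 3 is then reached by the recursion in \<open>A\<close>, by
  that in \<open>B\<close>, and at the corner from the words with B = k + 3 just obtained.\<close>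

lemma spectral:
  "eig r s g \<Longrightarrow> A \<le> k + 2 \<Longrightarrow> B \<le> k + 2 \<Longrightarrow>
   same_total (app (T.V k A B) g) (\<lambda>l j. (Q.schur A B (int r) (int s) * weight r s ^ k) * g l j)"
proof (induction k arbitrary: g A B)
  case 0
  then obtain c where c: "graded c g" by (auto simp: eig_def)
  note H = 0(1)[unfolded eig_def]
  have b12: "same_total (app (T.V 0 1 2) h) (\<lambda>l j. Q.ev2 (int r) (int s) * h l j)" if "eig r s h" for h
    using that unfolding eig_def by (metis row_eq_same_total[OF T.V_0(3)])
  have "A = 0 \<or> B = 0 \<or> A = 1 \<and> B = 1 \<or> A = 2 \<and> B = 1 \<or> A = 1 \<and> B = 2 \<or> A = 2 \<and> B = 2"
    using 0 by auto
  moreover have ?case if "A = 0 \<or> B = 0"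
    using that by (auto simp: V_zero same_total_def)
  moreover have ?case if "A = 1 \<and> B = 1"
    unfolding that[THEN conjunct1] that[THEN conjunct2] T.V_0(1) Q.schur_base by simp
  moreover have ?case if "A = 2 \<and> B = 1"
    using row_eq_same_total[OF T.V_0(2) c] that H unfolding that[THEN conjunct1] that[THEN conjunct2] Q.schur_base by simp
  moreover have ?case if "A = 1 \<and> B = 2"
    using b12[OF 0(1)] unfolding that[THEN conjunct1] that[THEN conjunct2] Q.schur_base by simp
  moreover have ?case if "A = 2 \<and> B = 2"
  proof -
    have "Z1 * Z2 \<in> pser" by auto
    then have "app (T.V 0 1 2 * T.H1 - scalar (Z1 * Z2)) g = (\<lambda>l j. app (T.V 0 1 2) (\<lambda>l j. Q.ev1 (int r) (int s) * g l j) l j - Z1 * Z2 * g l j)"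
      using H by (intro ext) simp
    with row_eq_same_total[OF T.V_0(4) c] have "same_total (app (T.V 0 2 2) g) \<dots>" by simp
    moreover have "same_total \<dots> (\<lambda>l j. Q.ev2 (int r) (int s) * (Q.ev1 (int r) (int s) * g l j) - Z1 * Z2 * g l j)"
      by (intro same_total_diff b12 eig_scale 0 ev_pser same_total_refl)
    ultimately show ?thesis
      using same_total_trans unfolding that[THEN conjunct1] that[THEN conjunct2] Q.schur_base by (simp add: algebra_simps)
  qed
  ultimately show ?case by blast
next
  case (Suc k)
  define e e1 e2 where "e = weight r s" and "e1 = Q.ev1 (int r) (int s)" and "e2 = Q.ev2 (int r) (int s)"
  have S0s: "e \<in> pser" "e1 \<in> pser" "e2 \<in> pser" "Z1 \<in> pser" "Z2 \<in> pser" "Z1 * (Z1 * Z2) \<in> pser" "Z2 * (Z1 * Z2) \<in> pser"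
    by (auto simp: e_def e1_def e2_def weight_pser ev_pser)
  have scm: "scalar Z1 * scalar (Z1 * Z2) = scalar (Z1 * (Z1 * Z2))" "scalar Z2 * scalar (Z1 * Z2) = scalar (Z2 * (Z1 * Z2))"
    by (rule colop_eqI; simp add: S0s pser_closed mult.assoc)+
  have small: "same_total (app (T.V (Suc k) A B) g) (\<lambda>l j. (Q.schur A B (int r) (int s) * e ^ Suc k) * g l j)"
    if "eig r s g" "A \<le> k + 2" "B \<le> k + 2" for A B g
  proof -
    have "app (T.V (Suc k) A B) g = app (T.V k A B) (\<lambda>l j. e * g l j)"
      using that by (simp add: T.V_Suc eig_def e_def)
    then show ?thesis
      using Suc.IH[OF eig_scale[OF that(1) S0s(1)] that(2,3)] by (simp add: e_def mult_ac)
  qed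
  have tH: "app (opT * T.H1) g = (\<lambda>l j. (e * e1) * g l j)" "app (opT * T.H2) g = (\<lambda>l j. (e * e2) * g l j)"
     if "eig r s g" for g
  proof -
    have "app opT (\<lambda>l j. a * g l j) = (\<lambda>l j. (e * a) * g l j)" for a
      using that by (intro ext) (simp only: app_scale eig_def e_def mult_ac)
    then show "app (opT * T.H1) g = (\<lambda>l j. (e * e1) * g l j)" "app (opT * T.H2) g = (\<lambda>l j. (e * e2) * g l j)"
      using that by (simp_all add: eig_def e1_def e2_def del: app_ops(5))
  qed
  have right: "same_total (app (T.V (Suc k) (k + 3) B) g) (\<lambda>l j. (Q.schur (k + 3) B (int r) (int s) * e ^ Suc k) * g l j)"
    if g: "eig r s g" and B: "B \<le> k + 2" for B g
  proof -
    from g obtain c where c: "graded c g" by (auto simp: eig_def)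
    have V: "T.row_eq (T.V (Suc k) (k + 3) B) (T.V k (k + 2) B * (opT * T.H1) - scalar Z1 * (T.V k (k + 1) B * (opT * T.H2)) + scalar (Z1 * (Z1 * Z2)) * (T.V (Suc k) k B))"
      using T.V_step[of B k] B by (simp add: scm T.V_Suc mult.assoc numeral_3_eq_3)
    have "same_total (app (T.V (Suc k) (k + 3) B) g) (\<lambda>l j. ((Q.schur (k + 2) B (int r) (int s) * e ^ k) * (e * e1) -
       (Q.schur (k + 1) B (int r) (int s) * e ^ k) * (Z1 * (e * e2)) + (Q.schur k B (int r) (int s) * e ^ Suc k) * (Z1 * (Z1 * Z2))) * g l j)"
      using B S0s
      by (intro same_total_comb[OF V c] tH g small Suc.IH[folded e_def] eig_scale pser_closed) auto
    then show ?thesis unfolding Q.schur_rec e1_def e2_def by (simp add: algebra_simps)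
  qed
  have up: "same_total (app (T.V (Suc k) A (k + 3)) g) (\<lambda>l j. (Q.schur A (k + 3) (int r) (int s) * e ^ Suc k) * g l j)"
    if g: "eig r s g" and A: "A \<le> k + 2" for A g
  proof -
    from g obtain c where c: "graded c g" by (auto simp: eig_def)
    have V: "T.row_eq (T.V (Suc k) A (k + 3)) (T.V k A (k + 2) * (opT * T.H2) - scalar Z2 * (T.V k A (k + 1) * (opT * T.H1)) + scalar (Z2 * (Z1 * Z2)) * (T.V (Suc k) A k))"
      using V_step'[of A k] A by (simp add: scm T.V_Suc mult.assoc numeral_3_eq_3)
    have "same_total (app (T.V (Suc k) A (k + 3)) g) (\<lambda>l j. ((Q.schur A (k + 2) (int r) (int s) * e ^ k) * (e * e2) -
       (Q.schur A (k + 1) (int r) (int s) * e ^ k) * (Z2 * (e * e1)) + (Q.schur A k (int r) (int s) * e ^ Suc k) * (Z2 * (Z1 * Z2))) * g l j)"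
      using A S0s
      by (intro same_total_comb[OF V c] tH g small Suc.IH[folded e_def] eig_scale pser_closed) auto
    then show ?thesis unfolding Q.schur_rec' e1_def e2_def by (simp add: algebra_simps)
  qed
  have corner: "same_total (app (T.V (Suc k) (k + 3) (k + 3)) g) (\<lambda>l j. (Q.schur (k + 3) (k + 3) (int r) (int s) * e ^ Suc k) * g l j)"
    if g: "eig r s g" for g
  proof -
    from g obtain c where c: "graded c g" by (auto simp: eig_def)
    have V: "T.row_eq (T.V (Suc k) (k + 3) (k + 3)) (T.V (Suc k) (k + 2) (k + 3) * T.H1 - scalar Z1 * (T.V (Suc k) (k + 1) (k + 3) * T.H2) + scalar (Z1 * (Z1 * Z2)) * (T.V (Suc k) k (k + 3)))"
      using T.V_corner[of "Suc k" k] by (simp add: scm mult.assoc numeral_3_eq_3)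
    have "same_total (app (T.V (Suc k) (k + 3) (k + 3)) g) (\<lambda>l j. ((Q.schur (k + 2) (k + 3) (int r) (int s) * e ^ Suc k) * e1 -
       (Q.schur (k + 1) (k + 3) (int r) (int s) * e ^ Suc k) * (Z1 * e2) + (Q.schur k (k + 3) (int r) (int s) * e ^ Suc k) * (Z1 * (Z1 * Z2))) * g l j)"
      using S0s g[unfolded eig_def, folded e1_def e2_def]
      by (intro same_total_comb[OF V c] up eig_scale g pser_closed) auto
    then show ?thesis unfolding Q.schur_rec[of k "k + 3"] e1_def e2_def by (simp add: algebra_simps)
  qed
  have "A \<le> k + 2 \<and> B \<le> k + 2 \<or> A = k + 3 \<and> B \<le> k + 2 \<or> A \<le> k + 2 \<and> B = k + 3 \<or> A = k + 3 \<and> B = k + 3"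
    using Suc.prems by auto
  then show ?case
    using small right up corner Suc.prems(1) unfolding e_def by blast
qed

end

section \<open>The partition sum as a matrix element\<close>

definition parts_with_head :: "nat \<Rightarrow> nat \<Rightarrow> (nat \<Rightarrow> nat) set" where
  "parts_with_head k L = {l \<in> Parts k. l 1 = L}"

definition pcons :: "nat \<Rightarrow> (nat \<Rightarrow> nat) \<Rightarrow> nat \<Rightarrow> nat" where
  "pcons L l i = (if i = 0 then 0 else if i = 1 then L else l (i - 1))"

lemma parts_with_head_0: "parts_with_head 0 L = (if L = 0 then {\<lambda>_. 0} else {})"
  by (auto simp: parts_with_head_def Parts_def)

lemma parts_with_head_Suc: "parts_with_head (Suc k) L = pcons L ` (\<Union>i\<le>L. parts_with_head k i)"
proof (intro equalityI subsetI)
  fix l assume l: "l \<in> parts_with_head (Suc k) L"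
  define l' where "l' i = (if i = 0 then 0 else l (Suc i))" for i
  have "l' \<in> Parts k" using l by (auto simp: l'_def parts_with_head_def Parts_def)
  moreover have "l' 1 \<le> L" using l by (cases k) (auto simp: l'_def parts_with_head_def Parts_def)
  moreover have "l = pcons L l'" using l by (auto simp: fun_eq_iff l'_def pcons_def parts_with_head_def Parts_def)
  ultimately show "l \<in> pcons L ` (\<Union>i\<le>L. parts_with_head k i)" by (auto simp: parts_with_head_def)
next
  fix l assume "l \<in> pcons L ` (\<Union>i\<le>L. parts_with_head k i)"
  then obtain l' where l': "l = pcons L l'" "l' \<in> Parts k" "l' 1 \<le> L" by (auto simp: parts_with_head_def)
  have "l (Suc i) \<le> l i" if "1 \<le> i" "i < Suc k" for i
  proof (cases "i = 1")
    case False
    then have "1 \<le> i - 1" "i - 1 < k" "Suc (i - 1) = i" using that by auto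
    moreover have "\<forall>i. 1 \<le> i \<longrightarrow> i < k \<longrightarrow> l' (Suc i) \<le> l' i" using l'(2) by (simp add: Parts_def)
    ultimately have "l' i \<le> l' (i - 1)" by metis
    then show ?thesis using l' that False by (simp add: pcons_def)
  qed (use l' in \<open>simp add: pcons_def\<close>)
  then show "l \<in> parts_with_head (Suc k) L" using l' by (auto simp: parts_with_head_def Parts_def pcons_def)
qed

lemma pcons_inj: "inj_on (pcons L) (Parts k)"
proof (rule inj_onI, rule ext)
  fix x y i assume xy: "x \<in> Parts k" "y \<in> Parts k" "pcons L x = pcons L y"
  show "x i = y i"
    using fun_cong[OF xy(3), of "Suc i"] xy(1,2) by (cases "i = 0") (auto simp: pcons_def Parts_def)
qed

lemma finite_parts_with_head: "finite (parts_with_head k L)"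
  by (induction k arbitrary: L) (simp_all add: parts_with_head_0 parts_with_head_Suc)

lemma sum_parts_with_head_Suc: "(\<Sum>l\<in>parts_with_head (Suc k) L. f l) = (\<Sum>i\<le>L. \<Sum>l\<in>parts_with_head k i. f (pcons L l))"
proof -
  have "inj_on (pcons L) (\<Union>i\<le>L. parts_with_head k i)"
    by (rule inj_on_subset[OF pcons_inj[of L k]]) (auto simp: parts_with_head_def)
  then have "(\<Sum>l\<in>parts_with_head (Suc k) L. f l) = (\<Sum>l\<in>(\<Union>i\<le>L. parts_with_head k i). f (pcons L l))"
    unfolding parts_with_head_Suc by (subst sum.reindex) auto
  also have "\<dots> = (\<Sum>i\<le>L. \<Sum>l\<in>parts_with_head k i. f (pcons L l))"
    by (rule sum.UNION_disjoint, simp, simp add: finite_parts_with_head) (auto simp: parts_with_head_def)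
  finally show ?thesis .
qed

context qser
begin

definition wfac :: "nat \<Rightarrow> nat \<Rightarrow> nat \<Rightarrow> (nat \<Rightarrow> nat) \<Rightarrow> (nat \<Rightarrow> nat) \<Rightarrow> ser" where
  "wfac a b i l u = Z1 ^ l i * Z2 ^ u i
          * cst (q powi (int (l i)^2 - int (l i) * int (u i) + int (u i)^2
                         - chi (i \<le> a) * int (l i) - chi (i \<le> b) * int (u i)))
          / cst (qpoch q q (int (l i) - int (l (Suc i))) * qpoch q q (int (u i) - int (u (Suc i))))"

definition wprod :: "nat \<Rightarrow> nat \<Rightarrow> nat \<Rightarrow> (nat \<Rightarrow> nat) \<Rightarrow> (nat \<Rightarrow> nat) \<Rightarrow> ser" where
  "wprod a b k l u = (\<Prod>i\<in>{1..k}. wfac a b i l u)"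

lemma wfac_pser: "wfac a b i l u \<in> pser"
  unfolding wfac_def divide_inverse cst_inverse[symmetric] by (intro pser_closed pser_power)

lemma wprod_monom_ideal:
  assumes "l \<in> parts_with_head k L" "u \<in> parts_with_head k M" shows "wprod a b k l u \<in> monom_ideal L M"
proof (cases k)
  case 0
  then have "L = 0" "M = 0" "wprod a b k l u = 1" using assms by (auto simp: parts_with_head_0 wprod_def split: if_splits)
  moreover have "1 \<in> monom_ideal 0 0" unfolding monom_ideal_def image_iff by (rule bexI[of _ 1]) auto
  ultimately show ?thesis by simp
next
  case (Suc k')
  have "wprod a b k l u = wfac a b 1 l u * (\<Prod>i\<in>{2..k}. wfac a b i l u)"
    unfolding wprod_def using Suc by (subst prod.atLeast_Suc_atMost) (auto simp: numeral_2_eq_2)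
  moreover have "wfac a b 1 l u \<in> monom_ideal L M"
  proof -
    have lu: "l 1 = L" "u 1 = M" using assms by (auto simp: parts_with_head_def)
    show ?thesis unfolding wfac_def lu divide_inverse cst_inverse[symmetric] mult.assoc[of "Z1 ^ L * Z2 ^ M"] monom_ideal_def
      by (intro imageI pser_closed)
  qed
  moreover have "(\<Prod>i\<in>{2..k}. wfac a b i l u) \<in> pser" using wfac_pser by auto
  ultimately show ?thesis using monom_ideal_mult by (simp only: mult.commute)
qed

definition delta :: "nat \<Rightarrow> nat \<Rightarrow> ser" where "delta l j = (if l = 0 \<and> j = 0 then 1 else 0)"

lemma wfac_1:
  assumes "l' \<in> parts_with_head k i" "u' \<in> parts_with_head k j" "i \<le> L" "j \<le> M"
  shows "wfac a b 1 (pcons L l') (pcons M u') =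
    (if 1 \<le> a then cst (inverse q ^ L) else 1) * (if 1 \<le> b then cst (inverse q ^ M) else 1) * (weight L M * inv_qfact (L - i) * inv_qfact (M - j))"
proof -
  have v: "pcons L l' 1 = L" "pcons M u' 1 = M" "pcons L l' (Suc 1) = i" "pcons M u' (Suc 1) = j"
    using assms by (auto simp: pcons_def parts_with_head_def)
  have k: "inv_qfact (L - i) = inverse (cst (qpoch q q (int L - int i)))" "inv_qfact (M - j) = inverse (cst (qpoch q q (int M - int j)))"
    using assms(3,4) by (simp_all add: inv_qfact_def cst_inverse of_nat_diff)
  have e: "cst (q powi (x - chi (1 \<le> a) * int L - chi (1 \<le> b) * int M)) =
     (if 1 \<le> a then cst (inverse q ^ L) else 1) * (if 1 \<le> b then cst (inverse q ^ M) else 1) * cst (q powi x)" for x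
  proof -
    have "q powi (x - chi (1 \<le> a) * int L - chi (1 \<le> b) * int M) =
       (if 1 \<le> a then inverse q ^ L else 1) * (if 1 \<le> b then inverse q ^ M else 1) * q powi x"
      by (auto simp: chi_def power_int_diff divide_inverse power_inverse)
    from arg_cong[OF this, of cst] show ?thesis unfolding cst_hom(2) by (simp only: if_distrib[of cst] cst_hom(5))
  qed
  show ?thesis unfolding wfac_def v e k weight_def
    by (simp add: divide_inverse cst_hom mult_ac)
qed

lemma wfac_pcons:
  "1 \<le> i \<Longrightarrow> wfac a b (Suc i) (pcons L l') (pcons M u') = wfac (a - 1) (b - 1) i l' u'"
proof -
  assume "1 \<le> i"
  then have "chi (Suc i \<le> a) = chi (i \<le> a - 1)" "chi (Suc i \<le> b) = chi (i \<le> b - 1)" by (auto simp: chi_def)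
  then show ?thesis using \<open>1 \<le> i\<close> by (simp add: wfac_def pcons_def)
qed

lemma wprod_Suc:
  assumes "l' \<in> parts_with_head k i" "u' \<in> parts_with_head k j" "i \<le> L" "j \<le> M"
  shows "wprod a b (Suc k) (pcons L l') (pcons M u') =
    (if 1 \<le> a then cst (inverse q ^ L) else 1) * (if 1 \<le> b then cst (inverse q ^ M) else 1) *
      (weight L M * inv_qfact (L - i) * inv_qfact (M - j)) * wprod (a - 1) (b - 1) k l' u'"
proof -
  have "wprod a b (Suc k) (pcons L l') (pcons M u') =
      wfac a b 1 (pcons L l') (pcons M u') * (\<Prod>i\<in>{1..k}. wfac a b (Suc i) (pcons L l') (pcons M u'))"
  proof -
    have "(\<Prod>i\<in>{1..Suc k}. f i) = f 1 * (\<Prod>i\<in>{1..k}. f (Suc i))" for f :: "nat \<Rightarrow> ser"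
      by (induction k) (simp_all add: mult_ac)
    then show ?thesis unfolding wprod_def .
  qed
  also have "(\<Prod>i\<in>{1..k}. wfac a b (Suc i) (pcons L l') (pcons M u')) = wprod (a - 1) (b - 1) k l' u'"
    unfolding wprod_def by (intro prod.cong refl wfac_pcons) auto
  finally show ?thesis unfolding wfac_1[OF assms] .
qed

text \<open>The outermost \<open>t\<close> carries lambda_1 and mu_1, its convolution sums over the
  next parts, and \<open>delta\<close> enforces lambda_(k+1) = mu_(k+1) = 0. At the origin
  \<open>P\<close> and \<open>R\<close> act as 1, so the induction can run over all \<open>a\<close>
  and \<open>b\<close>.\<close>

lemma row_delta:
  "app (T.rw k (Suc a) (Suc b)) delta L M = (\<Sum>l\<in>parts_with_head k L. \<Sum>u\<in>parts_with_head k M. wprod a b k l u)"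
proof (induction k arbitrary: a b L M)
  case 0
  show ?case by (auto simp: T.row_0 parts_with_head_0 wprod_def delta_def cst_hom)
next
  case (Suc k)
  define D where "D = (if 1 \<le> a then cst (inverse q ^ L) else 1) * (if 1 \<le> b then cst (inverse q ^ M) else 1)"
  have mx: "max 1 n = Suc (n - 1)" for n :: nat by auto
  have Cons: "T.rw (Suc k) (Suc a) (Suc b) =
      (if 1 < Suc a then opP else 1) * (if 1 < Suc b then opR else 1) * opT * T.rw k (Suc (a - 1)) (Suc (b - 1))"
    using T.row_Cons[of "Suc a" "Suc b" k, unfolded diff_Suc_1 mx] by blast
  have "app (T.rw (Suc k) (Suc a) (Suc b)) delta L M = D * tauf (app (T.rw k (Suc (a - 1)) (Suc (b - 1))) delta) L M"
    unfolding Cons D_def by (auto simp: mult.assoc)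
  also have "\<dots> = (\<Sum>i\<le>L. \<Sum>j\<le>M. \<Sum>l\<in>parts_with_head k i. \<Sum>u\<in>parts_with_head k j. D * (weight L M * inv_qfact (L - i) * inv_qfact (M - j)) * wprod (a - 1) (b - 1) k l u)"
    unfolding tauf_def qconv_def Suc.IH
    by (simp add: sum_distrib_left sum_distrib_right mult_ac)
  also have "\<dots> = (\<Sum>i\<le>L. \<Sum>j\<le>M. \<Sum>l\<in>parts_with_head k i. \<Sum>u\<in>parts_with_head k j. wprod a b (Suc k) (pcons L l) (pcons M u))"
    by (intro sum.cong refl) (simp add: wprod_Suc D_def)
  also have "\<dots> = (\<Sum>i\<le>L. \<Sum>l\<in>parts_with_head k i. \<Sum>j\<le>M. \<Sum>u\<in>parts_with_head k j. wprod a b (Suc k) (pcons L l) (pcons M u))"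
    by (intro sum.cong refl sum.swap)
  also have "\<dots> = (\<Sum>l\<in>parts_with_head (Suc k) L. \<Sum>u\<in>parts_with_head (Suc k) M. wprod a b (Suc k) l u)"
    by (simp add: sum_parts_with_head_Suc)
  finally show ?case .
qed

text \<open>Lowering \<open>a\<close> and \<open>b\<close> by one changes the product by
  q^(lambda_a) q^(mu_b) only, so the second part of the prefactor is w/q times the product for (a -
  1, b - 1).\<close>

lemma lhs_term_wprod:
  assumes "a \<le> k" "b \<le> k"
  shows "lhs_term q a b k l u = wprod a b k l u -
     (if a = 0 \<or> b = 0 then 0 else Z1 * Z2 * (cst (inverse q) * wprod (a - 1) (b - 1) k l u))"
proof (cases "a = 0 \<or> b = 0")
  case True
  then show ?thesis by (simp add: lhs_term_def wprod_def wfac_def)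
next
  case False
  define c where "c m n = (if n = m then 1 else (0::int))" for m n :: nat
  have ch: "chi (i \<le> a) = chi (i \<le> a - 1) + c a i" if "1 \<le> i" for a i
    using that by (auto simp: chi_def c_def)
  have f: "wfac a b i l u * cst (q powi (c a i * int (l i) + c b i * int (u i))) = wfac (a - 1) (b - 1) i l u"
    if "i \<in> {1..k}" for i
  proof -
    have "q powi x * q powi y = q powi (x + y)" for x y by (simp add: power_int_add)
    then have m: "cst (q powi x) * cst (q powi y) = cst (q powi (x + y))" for x y by (simp add: cst_hom(2)[symmetric])
    have "wfac a b i l u * cst (q powi (c a i * int (l i) + c b i * int (u i))) =
       Z1 ^ l i * Z2 ^ u i * (cst (q powi (int (l i)^2 - int (l i) * int (u i) + int (u i)^2
                         - chi (i \<le> a) * int (l i) - chi (i \<le> b) * int (u i))) * cst (q powi (c a i * int (l i) + c b i * int (u i))))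
          / cst (qpoch q q (int (l i) - int (l (Suc i))) * qpoch q q (int (u i) - int (u (Suc i))))"
      unfolding wfac_def by simp
    then show ?thesis
      unfolding m wfac_def using ch[of i a] ch[of i b] that by (simp add: algebra_simps)
  qed
  have scalar: "(\<Sum>i\<in>{1..k}. c a i * int (l i) + c b i * int (u i)) = int (l a) + int (u b)"
    using False assms by (simp add: sum.distrib c_def if_distrib[of "\<lambda>x. x * _"] sum.delta cong: if_cong)
  have pc: "(\<Prod>i\<in>I. cst (q powi g i)) = cst (q powi (\<Sum>i\<in>I. g i))" if "finite I" for I :: "nat set" and g
    using that by induction (simp_all add: cst_hom power_int_add)
  have e1: "wprod a b k l u * cst (q powi (int (l a) + int (u b))) = wprod (a - 1) (b - 1) k l u"
    unfolding wprod_def scalar[symmetric] pc[OF finite_atLeastAtMost, symmetric] prod.distrib[symmetric]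
    by (intro prod.cong refl f)
  have e2: "cst (q powi (int (l a) + int (u b) - 1)) = cst (inverse q) * cst (q powi (int (l a) + int (u b)))"
    by (simp add: cst_hom(2)[symmetric] power_int_diff divide_inverse)
  have e3: "lhs_term q a b k l u = (1 - Z1 * Z2 * cst (q powi (int (l a) + int (u b) - 1))) * wprod a b k l u"
    using False by (simp add: lhs_term_def wprod_def wfac_def)
  show ?thesis unfolding e3 e2 e1[symmetric] using False by (simp add: right_diff_distrib left_diff_distrib mult_ac)
qed

lemma V_delta:
  assumes "a \<le> k" "b \<le> k"
  shows "app (T.V k (Suc a) (Suc b)) delta L M = (\<Sum>l\<in>parts_with_head k L. \<Sum>u\<in>parts_with_head k M. lhs_term q a b k l u)"
proof -
  have Z: "Z1 * Z2 \<in> pser" "cst (inverse q) \<in> pser" by auto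
  have r: "app (T.rw k a b) delta L M = (\<Sum>l\<in>parts_with_head k L. \<Sum>u\<in>parts_with_head k M. (if a = 0 \<or> b = 0 then 0 else wprod (a - 1) (b - 1) k l u))"
    using row_delta[of k "a - 1" "b - 1" L M] by (cases a; cases b) auto
  show ?thesis unfolding T.V_def lhs_term_wprod[OF assms]
    by (cases "a = 0 \<or> b = 0") (simp_all add: Z row_delta r sum_subtractf sum_distrib_left)
qed

lemma lhs_term_monom_ideal:
  assumes "a \<le> k" "b \<le> k" "l \<in> parts_with_head k L" "u \<in> parts_with_head k M"
  shows "lhs_term q a b k l u \<in> monom_ideal L M"
proof -
  have "- (Z1 * Z2 * cst (inverse q)) * wprod (a - 1) (b - 1) k l u \<in> monom_ideal L M"
    using wprod_monom_ideal[OF assms(3,4)] by (intro monom_ideal_mult pser_closed)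
  from monom_ideal_add[OF wprod_monom_ideal[OF assms(3,4)] this] show ?thesis
    using wprod_monom_ideal[OF assms(3,4)] by (auto simp: lhs_term_wprod[OF assms(1,2)] mult.assoc)
qed

text \<open>A summand is divisible by z1^(lambda_1) z2^(mu_1), so only partitions with bounded
  largest parts contribute to one coefficient.\<close>

lemma lhs_has_sum:
  assumes ab: "a \<le> k" "b \<le> k" and tot: "total m n (app (T.V k (Suc a) (Suc b)) delta) v"
  shows "((\<lambda>(l, u). coeff2 (lhs_term q a b k l u) m n) has_sum v) (Parts k \<times> Parts k)"
proof -
  obtain N where N: "(\<Sum>L\<le>N. \<Sum>M\<le>N. coeff2 (app (T.V k (Suc a) (Suc b)) delta L M) m n) = v" "nat m \<le> N" "nat n \<le> N"
  proof -
    have "eventually (\<lambda>N. (\<Sum>L\<le>N. \<Sum>M\<le>N. coeff2 (app (T.V k (Suc a) (Suc b)) delta L M) m n) = v \<and> max (nat m) (nat n) \<le> N) sequentially"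
      using tot unfolding total_def by (intro eventually_conj eventually_ge_at_top)
    from eventually_happens'[OF sequentially_bot this] show ?thesis using that by auto
  qed
  define B where "B = (\<Union>L\<le>N. parts_with_head k L)"
  have fin: "finite B" by (simp add: B_def finite_parts_with_head)
  have sumB: "(\<Sum>l\<in>B. f l) = (\<Sum>L\<le>N. \<Sum>l\<in>parts_with_head k L. f l)" for f :: "(nat \<Rightarrow> nat) \<Rightarrow> complex"
    unfolding B_def by (rule sum.UNION_disjoint, simp, simp add: finite_parts_with_head) (auto simp: parts_with_head_def)
  have "((\<lambda>(l, u). coeff2 (lhs_term q a b k l u) m n) has_sum (\<Sum>(l, u)\<in>B \<times> B. coeff2 (lhs_term q a b k l u) m n)) (Parts k \<times> Parts k)"
  proof (rule has_sum_finite_neutralI)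
    show "finite (B \<times> B)" using fin by simp
    show "B \<times> B \<subseteq> Parts k \<times> Parts k" by (auto simp: B_def parts_with_head_def)
    show "(case x of (l, u) \<Rightarrow> coeff2 (lhs_term q a b k l u) m n) = 0" if "x \<in> Parts k \<times> Parts k - B \<times> B" for x
    proof -
      obtain l u where x: "x = (l, u)" by (cases x)
      have "l \<in> parts_with_head k (l 1)" "u \<in> parts_with_head k (u 1)" using that x by (auto simp: parts_with_head_def)
      note I = lhs_term_monom_ideal[OF ab this]
      have "N < l 1 \<or> N < u 1" using that x by (auto simp: B_def parts_with_head_def not_le)
      then have "m < int (l 1) \<or> n < int (u 1)" using N(2,3) by linarith
      then show ?thesis using coeff2_monom_ideal[OF I] x by simp
    qed
  qed simp
  also have "(\<Sum>(l, u)\<in>B \<times> B. coeff2 (lhs_term q a b k l u) m n) = (\<Sum>l\<in>B. \<Sum>u\<in>B. coeff2 (lhs_term q a b k l u) m n)"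
    by (simp add: sum.cartesian_product)
  also have "\<dots> = (\<Sum>L\<le>N. \<Sum>l\<in>parts_with_head k L. \<Sum>M\<le>N. \<Sum>u\<in>parts_with_head k M. coeff2 (lhs_term q a b k l u) m n)"
    by (simp add: sumB)
  also have "\<dots> = (\<Sum>L\<le>N. \<Sum>M\<le>N. \<Sum>l\<in>parts_with_head k L. \<Sum>u\<in>parts_with_head k M. coeff2 (lhs_term q a b k l u) m n)"
    by (intro sum.cong refl sum.swap)
  also have "\<dots> = v" unfolding N(1)[symmetric] V_delta[OF ab] by simp
  finally show ?thesis .
qed

end

section \<open>Coefficientwise limits\<close>

text \<open>Limits of complex numbers in each coefficient: for a numerical q, the coefficients of
  the finite products (z;q)_N need not become constant. Restricted to power series, each coefficient
  of a product is a finite sum.\<close>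

definition conv :: "(nat \<Rightarrow> ser) \<Rightarrow> ser \<Rightarrow> bool" where
  "conv X Y \<longleftrightarrow> (\<exists>F G. (\<forall>N. X N = lift2 (F N)) \<and> Y = lift2 G \<and>
     (\<forall>i j. (\<lambda>N. fps_nth (fps_nth (F N) j) i) \<longlonglongrightarrow> fps_nth (fps_nth G j) i))"

lemma convI:
  "(\<And>N. X N = lift2 (F N)) \<Longrightarrow> Y = lift2 G \<Longrightarrow>
   (\<And>i j. (\<lambda>N. fps_nth (fps_nth (F N) j) i) \<longlonglongrightarrow> fps_nth (fps_nth G j) i) \<Longrightarrow> conv X Y"
  unfolding conv_def by blast

lemma conv_coeff2: "conv X Y \<Longrightarrow> (\<lambda>N. coeff2 (X N) m n) \<longlonglongrightarrow> coeff2 Y m n"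
  unfolding conv_def by (auto simp: coeff2_lift2)

lemma conv_const: "Y \<in> pser \<Longrightarrow> conv (\<lambda>_. Y) Y"
  unfolding pser_def by (auto intro: convI)

lemma conv_mult:
  assumes "conv X Y" "conv X' Y'" shows "conv (\<lambda>N. X N * X' N) (Y * Y')"
proof -
  obtain F G F' G' where FG: "\<forall>N. X N = lift2 (F N)" "Y = lift2 G" "\<forall>N. X' N = lift2 (F' N)" "Y' = lift2 G'"
    and l: "\<And>i j. (\<lambda>N. fps_nth (fps_nth (F N) j) i) \<longlonglongrightarrow> fps_nth (fps_nth G j) i"
      "\<And>i j. (\<lambda>N. fps_nth (fps_nth (F' N) j) i) \<longlonglongrightarrow> fps_nth (fps_nth G' j) i"
    using assms unfolding conv_def by metis
  have "(\<lambda>N. fps_nth (fps_nth (F N * F' N) j) i) \<longlonglongrightarrow> fps_nth (fps_nth (G * G') j) i" for i j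
    unfolding fps_mult_nth fps_sum_nth by (intro tendsto_intros l)
  then show ?thesis
    unfolding conv_def using FG by (intro exI[of _ "\<lambda>N. F N * F' N"] exI[of _ "G * G'"]) (simp add: lift2_mult)
qed

lemma conv_cst: "f \<longlonglongrightarrow> c \<Longrightarrow> conv (\<lambda>N. cst (f N)) (cst c)"
  unfolding conv_def cst_lift2
  by (intro exI[of _ "\<lambda>N. fps_const (fps_const (f N))"] exI[of _ "fps_const (fps_const c)"]) auto

lemma conv_subseq: "conv X Y \<Longrightarrow> filterlim h at_top sequentially \<Longrightarrow> conv (\<lambda>N. X (h N)) Y"
proof -
  assume "conv X Y" and h: "filterlim h at_top sequentially"
  then obtain F G where FG: "\<forall>N. X N = lift2 (F N)" "Y = lift2 G"
    "\<And>i j. (\<lambda>N. fps_nth (fps_nth (F N) j) i) \<longlonglongrightarrow> fps_nth (fps_nth G j) i" unfolding conv_def by metis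
  have "(\<lambda>N. fps_nth (fps_nth (F (h N)) j) i) \<longlonglongrightarrow> fps_nth (fps_nth G j) i" for i j
    by (rule filterlim_compose[OF FG(3) h])
  then show ?thesis unfolding conv_def using FG by (intro exI[of _ "\<lambda>N. F (h N)"] exI[of _ G]) auto
qed

definition e1_fps :: "complex fps \<Rightarrow> complex fps fps" where "e1_fps f = fps_const f"
definition e2_fps :: "complex fps \<Rightarrow> complex fps fps" where "e2_fps f = Abs_fps (\<lambda>n. fps_const (fps_nth f n))"
definition e3_fps :: "complex fps \<Rightarrow> complex fps fps" where "e3_fps f = Abs_fps (\<lambda>n. fps_const (fps_nth f n) * fps_X ^ n)"

lemma at_lift2: "at_z1 f = lift2 (e1_fps f)" "at_z2 f = lift2 (e2_fps f)" "at_z1z2 f = lift2 (e3_fps f)"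
proof -
  have "Abs_fps (\<lambda>n. fps_to_fls (fps_nth (fps_const f) n)) = fps_const (fps_to_fls f)"
    by (simp add: fps_eq_iff)
  then show "at_z1 f = lift2 (e1_fps f)" by (simp add: at_z1_def lift2_def e1_fps_def)
  show "at_z2 f = lift2 (e2_fps f)" by (simp add: at_z2_def lift2_def e2_fps_def)
  show "at_z1z2 f = lift2 (e3_fps f)"
    by (simp add: at_z1z2_def lift2_def e3_fps_def fls_times_fps_to_fls fps_to_fls_power)
qed

lemma e_mult:
  "e1_fps (f * g) = e1_fps f * e1_fps g" "e2_fps (f * g) = e2_fps f * e2_fps g" "e3_fps (f * g) = e3_fps f * e3_fps g"
proof -
  show "e1_fps (f * g) = e1_fps f * e1_fps g" by (simp add: e1_fps_def)
  have c: "fps_const (\<Sum>i\<in>I. h i) = (\<Sum>i\<in>I. fps_const (h i))" for h :: "nat \<Rightarrow> complex" and I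
    by (induction I rule: infinite_finite_induct) (auto simp: fps_const_add[symmetric] simp del: fps_const_add)
  show "e2_fps (f * g) = e2_fps f * e2_fps g"
    by (rule fps_ext) (simp add: e2_fps_def fps_mult_nth c)
  show "e3_fps (f * g) = e3_fps f * e3_fps g"
  proof (rule fps_ext)
    fix n
    have eq: "fps_const (fps_nth f i * fps_nth g (n - i)) * fps_X ^ n =
       (fps_const (fps_nth f i) * fps_X ^ i) * (fps_const (fps_nth g (n - i)) * fps_X ^ (n - i))" if "i \<in> {0..n}" for i
    proof -
      have "(fps_X :: complex fps) ^ n = fps_X ^ i * fps_X ^ (n - i)" using that by (simp add: power_add[symmetric])
      then show ?thesis by (simp add: fps_const_mult[symmetric] mult_ac del: fps_const_mult)
    qed
    show "fps_nth (e3_fps (f * g)) n = fps_nth (e3_fps f * e3_fps g) n"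
      unfolding e3_fps_def fps_nth_Abs_fps fps_mult_nth c sum_distrib_right by (intro sum.cong refl eq)
  qed
qed

lemma e_diff:
  "e1_fps (f - g) = e1_fps f - e1_fps g" "e2_fps (f - g) = e2_fps f - e2_fps g" "e3_fps (f - g) = e3_fps f - e3_fps g"
  by (simp_all add: e1_fps_def e2_fps_def e3_fps_def fps_eq_iff left_diff_distrib)

lemma at_hom:
  "at_z1 (f * g) = at_z1 f * at_z1 g" "at_z2 (f * g) = at_z2 f * at_z2 g" "at_z1z2 (f * g) = at_z1z2 f * at_z1z2 g"
  "at_z1 (f - g) = at_z1 f - at_z1 g" "at_z2 (f - g) = at_z2 f - at_z2 g" "at_z1z2 (f - g) = at_z1z2 f - at_z1z2 g"
  by (simp_all add: at_lift2 e_mult e_diff lift2_mult lift2_diff)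

lemma at_base:
  "at_z1 (fps_const c) = cst c" "at_z2 (fps_const c) = cst c" "at_z1z2 (fps_const c) = cst c"
  "at_z1 fps_X = Z1" "at_z2 fps_X = Z2" "at_z1z2 fps_X = Z1 * Z2"
proof -
  have "e2_fps (fps_const c) = fps_const (fps_const c)" "e3_fps (fps_const c) = fps_const (fps_const c)"
    by (simp_all add: e2_fps_def e3_fps_def fps_eq_iff)
  then show "at_z1 (fps_const c) = cst c" "at_z2 (fps_const c) = cst c" "at_z1z2 (fps_const c) = cst c"
    by (simp_all add: at_lift2 cst_lift2 e1_fps_def)
  have "e2_fps fps_X = fps_X" "e3_fps fps_X = fps_const fps_X * fps_X"
    by (auto simp: e2_fps_def e3_fps_def intro!: fps_ext)
  then show "at_z1 fps_X = Z1" "at_z2 fps_X = Z2" "at_z1z2 fps_X = Z1 * Z2"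
    by (simp_all add: at_lift2 Z1_lift2 Z2_lift2 lift2_mult e1_fps_def)
qed

lemma at_one: "at_z1 1 = 1" "at_z2 1 = 1" "at_z1z2 1 = 1"
  using at_base(1-3)[of 1] by (simp_all add: cst_hom)

lemma at_inverse:
  assumes "fps_nth f 0 \<noteq> 0"
  shows "at_z1 (inverse f) = inverse (at_z1 f)" "at_z2 (inverse f) = inverse (at_z2 f)" "at_z1z2 (inverse f) = inverse (at_z1z2 f)"
proof -
  have "f * inverse f = 1" using assms by (simp add: inverse_mult_eq_1')
  then have "at_z1 f * at_z1 (inverse f) = 1" "at_z2 f * at_z2 (inverse f) = 1" "at_z1z2 f * at_z1z2 (inverse f) = 1"
    by (simp_all add: at_hom[symmetric] at_one)
  then show "at_z1 (inverse f) = inverse (at_z1 f)" "at_z2 (inverse f) = inverse (at_z2 f)" "at_z1z2 (inverse f) = inverse (at_z1z2 f)"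
    by (metis inverse_unique)+
qed

lemma conv_at:
  assumes "\<And>n. (\<lambda>N. fps_nth (f N) n) \<longlonglongrightarrow> fps_nth g n"
  shows "conv (\<lambda>N. at_z1 (f N)) (at_z1 g)" "conv (\<lambda>N. at_z2 (f N)) (at_z2 g)" "conv (\<lambda>N. at_z1z2 (f N)) (at_z1z2 g)"
proof -
  have l: "(\<lambda>N. fps_nth (fps_nth (e1_fps (f N)) j) i) \<longlonglongrightarrow> fps_nth (fps_nth (e1_fps g) j) i"
    "(\<lambda>N. fps_nth (fps_nth (e2_fps (f N)) j) i) \<longlonglongrightarrow> fps_nth (fps_nth (e2_fps g) j) i"
    "(\<lambda>N. fps_nth (fps_nth (e3_fps (f N)) j) i) \<longlonglongrightarrow> fps_nth (fps_nth (e3_fps g) j) i" for i j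
    using assms by (auto simp: e1_fps_def e2_fps_def e3_fps_def intro!: tendsto_mult)
  show "conv (\<lambda>N. at_z1 (f N)) (at_z1 g)" unfolding at_lift2 by (rule convI[OF refl refl l(1)])
  show "conv (\<lambda>N. at_z2 (f N)) (at_z2 g)" unfolding at_lift2 by (rule convI[OF refl refl l(2)])
  show "conv (\<lambda>N. at_z1z2 (f N)) (at_z1z2 g)" unfolding at_lift2 by (rule convI[OF refl refl l(3)])
qed

section \<open>Infinite products as coefficientwise limits\<close>

definition fprod :: "complex \<Rightarrow> nat \<Rightarrow> complex fps" where
  "fprod q N = (\<Prod>j<N. 1 - fps_const (q ^ j) * fps_X)"

lemma fprod_0: "fps_nth (fprod q N) 0 = 1"
  by (induction N) (simp_all add: fprod_def fps_mult_nth)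

lemma fprod_Suc: "fps_nth (fprod q (Suc N)) (Suc n) = fps_nth (fprod q N) (Suc n) - q ^ N * fps_nth (fprod q N) n"
proof -
  have "fprod q (Suc N) = fprod q N - fps_const (q ^ N) * (fprod q N * fps_X)"
    by (simp add: fprod_def algebra_simps)
  then show ?thesis by simp
qed

text \<open>By \<open>fprod_Suc\<close> a coefficient is a partial sum of q^j times the coefficient
  one degree lower, which is bounded by induction; the geometric series dominates.\<close>

lemma fprod_tendsto:
  assumes "norm q < 1" shows "(\<lambda>N. fps_nth (fprod q N) n) \<longlonglongrightarrow> fps_nth (qinf_fps q) n"
proof -
  have "convergent (\<lambda>N. fps_nth (fprod q N) n)"
  proof (induction n)
    case 0
    show ?case by (simp add: fprod_0 convergent_const)
  next
    case (Suc n)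
    then have "Bseq (\<lambda>N. fps_nth (fprod q N) n)" by (rule convergent_imp_Bseq)
    then obtain K where K: "\<And>N. norm (fps_nth (fprod q N) n) \<le> K" by (auto simp: Bseq_def)
    have "summable (\<lambda>j. - (q ^ j * fps_nth (fprod q j) n))"
    proof (rule summable_comparison_test')
      show "summable (\<lambda>j. norm q ^ j * K)" using assms by (intro summable_mult2 summable_geometric) simp
      show "norm (- (q ^ j * fps_nth (fprod q j) n)) \<le> norm q ^ j * K" if "0 \<le> j" for j
        using K by (simp add: norm_mult norm_power mult_left_mono)
    qed
    then have c: "convergent (\<lambda>N. \<Sum>j<N. - (q ^ j * fps_nth (fprod q j) n))" by (simp add: summable_iff_convergent)
    have "fps_nth (fprod q N) (Suc n) = (\<Sum>j<N. - (q ^ j * fps_nth (fprod q j) n))" for N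
      by (induction N) (simp_all add: fprod_Suc, simp add: fprod_def)
    then show ?case using c by simp
  qed
  then show ?thesis by (simp add: convergent_LIMSEQ_iff qinf_fps_def fprod_def)
qed

lemma inverse_fprod_tendsto:
  assumes "norm q < 1" shows "(\<lambda>N. fps_nth (inverse (fprod q N)) n) \<longlonglongrightarrow> fps_nth (inverse (qinf_fps q)) n"
proof -
  have q0: "fps_nth (qinf_fps q) 0 = 1"
    using LIMSEQ_unique[OF fprod_tendsto[OF assms, of 0]] by (simp add: fprod_0)
  have rec: "fps_nth (inverse f) n = - (\<Sum>i=1..n. fps_nth f i * fps_nth (inverse f) (n - i))"
    if "fps_nth f 0 = 1" "n \<noteq> 0" for f :: "complex fps" and n
  proof -
    have "f * inverse f = 1" using that by (simp add: inverse_mult_eq_1')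
    then have "(\<Sum>i=0..n. fps_nth f i * fps_nth (inverse f) (n - i)) = 0"
      using that(2) by (metis fps_mult_nth fps_one_nth)
    then show ?thesis using that(1) by (simp add: sum.atLeast_Suc_atMost add_eq_0_iff)
  qed
  show ?thesis
  proof (induction n rule: less_induct)
    case (less n)
    show ?case
    proof (cases "n = 0")
      case False
      show ?thesis unfolding rec[OF fprod_0 False] rec[OF q0 False]
        by (intro tendsto_intros fprod_tendsto[OF assms] less) (use False in auto)
    qed (simp add: fprod_0 q0)
  qed
qed

context qser
begin

lemma at_fprod:
  "at_z1 (fprod q N) = Q.p1 (int N)" "at_z2 (fprod q N) = Q.p2 (int N)" "at_z1z2 (fprod q N) = Q.pw (int N)"
proof -
  have q: "qpoch z (cst q) (int (Suc N)) = qpoch z (cst q) (int N) * (1 - cst (q ^ N) * z)" for z N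
    by (simp add: qpoch_def nat_add_distrib cst_power mult.commute)
  have S: "fprod q (Suc N) = fprod q N * (1 - fps_const (q ^ N) * fps_X)" for N by (simp add: fprod_def)
  have Z: "fprod q 0 = 1" by (simp add: fprod_def)
  show "at_z1 (fprod q N) = Q.p1 (int N)"
    by (induction N) (simp_all only: Z S q at_hom at_base at_one, simp add: qpoch_def)
  show "at_z2 (fprod q N) = Q.p2 (int N)"
    by (induction N) (simp_all only: Z S q at_hom at_base at_one, simp add: qpoch_def)
  show "at_z1z2 (fprod q N) = Q.pw (int N)"
    by (induction N) (simp_all only: Z S q at_hom at_base at_one, simp add: qpoch_def)
qed

abbreviation "A1 \<equiv> at_z1 (qinf_fps q)"
abbreviation "A2 \<equiv> at_z2 (qinf_fps q)"
abbreviation "A3 \<equiv> at_z1z2 (qinf_fps q)"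

lemma qinf_0: "fps_nth (qinf_fps q) 0 = 1"
  using LIMSEQ_unique[OF fprod_tendsto[OF q_less, of 0]] by (simp add: fprod_0)

lemma A_nonzero: "A1 \<noteq> 0" "A2 \<noteq> 0" "A3 \<noteq> 0"
  and A_inverse_pser: "inverse A1 \<in> pser" "inverse A2 \<in> pser" "inverse A3 \<in> pser"
proof -
  have "qinf_fps q * inverse (qinf_fps q) = 1" using qinf_0 by (simp add: inverse_mult_eq_1')
  then have "A1 * at_z1 (inverse (qinf_fps q)) = 1" "A2 * at_z2 (inverse (qinf_fps q)) = 1" "A3 * at_z1z2 (inverse (qinf_fps q)) = 1"
    by (simp_all add: at_hom[symmetric] at_one)
  then show "A1 \<noteq> 0" "A2 \<noteq> 0" "A3 \<noteq> 0" by auto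
  show "inverse A1 \<in> pser" "inverse A2 \<in> pser" "inverse A3 \<in> pser"
    using at_inverse[of "qinf_fps q"] qinf_0 unfolding pser_def by (metis at_lift2 rangeI zero_neq_one)+
qed

lemma conv_p:
  assumes "filterlim h at_top sequentially"
  shows "conv (\<lambda>N. Q.pw (int (h N))) A3" "conv (\<lambda>N. inverse (Q.p1 (int (h N)))) (inverse A1)"
    "conv (\<lambda>N. inverse (Q.p2 (int (h N)))) (inverse A2)" "conv (\<lambda>N. inverse (Q.pw (int (h N)))) (inverse A3)"
proof -
  have "inverse (Q.p1 (int N)) = at_z1 (inverse (fprod q N))" "inverse (Q.p2 (int N)) = at_z2 (inverse (fprod q N))"
    "inverse (Q.pw (int N)) = at_z1z2 (inverse (fprod q N))" for N
    by (simp_all add: at_inverse fprod_0 at_fprod)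
  moreover have "inverse A1 = at_z1 (inverse (qinf_fps q))" "inverse A2 = at_z2 (inverse (qinf_fps q))" "inverse A3 = at_z1z2 (inverse (qinf_fps q))"
    using qinf_0 by (simp_all add: at_inverse)
  ultimately show "conv (\<lambda>N. Q.pw (int (h N))) A3" "conv (\<lambda>N. inverse (Q.p1 (int (h N)))) (inverse A1)"
    "conv (\<lambda>N. inverse (Q.p2 (int (h N)))) (inverse A2)" "conv (\<lambda>N. inverse (Q.pw (int (h N)))) (inverse A3)"
    unfolding at_fprod[symmetric]
    by (simp_all only:)
       (intro conv_subseq[OF _ assms] conv_at fprod_tendsto[OF q_less] inverse_fprod_tendsto[OF q_less])+
qed

lemma qpoch_ratio_tendsto: "(\<lambda>N. qpoch q q (int N) * inverse (qpoch q q (int N - int l))) \<longlonglongrightarrow> 1"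
proof (induction l)
  case 0
  have "qpoch q q (int N) \<noteq> 0" for N
    using q_power_neq_1[of "Suc _"] by (auto simp: qpoch_def)
  then show ?case by simp
next
  case (Suc l)
  have "inverse (qpoch q q (int N - int (Suc l))) = (1 - q powi (int N - int l)) * inverse (qpoch q q (int N - int l))" for N
    using inverse_qpoch_rec[OF q0 q_power_neq_1, of "int N - int l"] by (simp add: algebra_simps)
  then have eq: "qpoch q q (int N) * inverse (qpoch q q (int N - int (Suc l))) =
     qpoch q q (int N) * inverse (qpoch q q (int N - int l)) * (1 - q ^ N * inverse (q ^ l))" for N
    by (simp add: power_int_diff divide_inverse)
  have "(\<lambda>N. q ^ N) \<longlonglongrightarrow> 0" using q_less by (rule LIMSEQ_power_zero)
  then have "(\<lambda>N. qpoch q q (int N) * inverse (qpoch q q (int N - int l)) * (1 - q ^ N * inverse (q ^ l))) \<longlonglongrightarrow> 1 * (1 - 0 * inverse (q ^ l))"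
    by (intro tendsto_mult tendsto_diff tendsto_const Suc)
  then show ?case unfolding eq by simp
qed


lemma weight_nonzero: "weight l j \<noteq> 0"
proof -
  have "Z1 \<noteq> 0" "Z2 \<noteq> 0" by (simp_all add: Z1_def Z2_def)
  moreover have "cst (q powi i) \<noteq> 0" for i using cst_eq_iff[of "q powi i" 0] by (simp add: cst_hom)
  ultimately show ?thesis by (simp add: weight_def)
qed

text \<open>Let L = M tend to infinity in the eigenvalue equation for the transfer operator; multiplying by
  (q;q)_L^2 avoids the constant (q;q)_infinity.\<close>

lemma total_Psi:
  assumes F: "F \<in> pser"
  shows "total m n (\<lambda>l j. F * Psi r s l j) (coeff2 (F * weight r s / (A1 * A3 * A2)) m n)"
proof -
  define g where "g = (\<lambda>l j. F * Psi r s l j)"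
  have gg: "graded 0 g" unfolding g_def by (intro graded_diag Psi_graded F)
  define B where "B = nat m + nat n"
  define v where "v = (\<Sum>l\<le>B. \<Sum>j\<le>B. coeff2 (g l j) m n)"
  have gz: "coeff2 (g l j) m n = 0" if "B < l \<or> B < j" for l j
  proof (rule coeff2_monom_ideal[of _ l j])
    show "g l j \<in> monom_ideal l j" using gg unfolding graded_def by (metis diff_zero)
    have "m \<le> int B" "n \<le> int B" by (simp_all add: B_def)
    then show "m < int l \<or> n < int j" using that by linarith
  qed
  have box: "(\<Sum>l\<le>N. \<Sum>j\<le>N. coeff2 (g l j) m n * c l j) = (\<Sum>l\<le>B. \<Sum>j\<le>B. coeff2 (g l j) m n * c l j)"
    if "B \<le> N" for N and c :: "nat \<Rightarrow> nat \<Rightarrow> complex"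
  proof -
    have "(\<Sum>j\<le>N. coeff2 (g l j) m n * c l j) = (\<Sum>j\<le>B. coeff2 (g l j) m n * c l j)" for l
      using that by (intro sum.mono_neutral_right) (auto simp: gz)
    moreover have "(\<Sum>l\<le>N. \<Sum>j\<le>B. coeff2 (g l j) m n * c l j) = (\<Sum>l\<le>B. \<Sum>j\<le>B. coeff2 (g l j) m n * c l j)"
      using that by (intro sum.mono_neutral_right) (auto simp: gz)
    ultimately show ?thesis by simp
  qed
  have tot: "total m n g v"
    unfolding total_def v_def
    by (rule eventually_mono[OF eventually_ge_at_top[of B]]) (rule box[of _ "\<lambda>_ _. 1", unfolded mult_1_right])
  define c where "c N l = qpoch q q (int N) * inverse (qpoch q q (int N - int l))" for N l
  have clim: "(\<lambda>N. c (h N) l) \<longlonglongrightarrow> 1" if "filterlim h at_top sequentially" for h l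
    using filterlim_compose[OF qpoch_ratio_tendsto that] by (simp add: c_def)
  \<comment> \<open>With L = M = \<open>h N\<close>, all indices shifted by r - s are natural
    numbers that tend to infinity.\<close>
  define h where "h N = N + r + s" for N
  have h: "filterlim h at_top sequentially"
    unfolding h_def by (rule filterlim_at_top_mono[OF filterlim_ident]) auto
  \<comment> \<open>The eigenvalue equation for \<open>t\<close> with the common factor
    \<open>weight L M\<close> cancelled.\<close>
  have id: "qconv L (\<lambda>l. qconv M (g l)) = F * (weight r s * Q.theta (int r) (int s) (int L) (int M))" for L M
  proof -
    have "weight L M * qconv L (\<lambda>l. qconv M (Psi r s l)) = weight L M * (weight r s * Q.theta (int r) (int s) (int L) (int M))"
      using fun_cong[OF fun_cong[OF Psi_tau[of r s]], of L M] by (simp add: tauf_def Psi_def mult_ac)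
    then show ?thesis using weight_nonzero by (simp add: g_def qconv_scale)
  qed
  define X where "X N = cst (c (h N) r) * cst (c (h N) s) * (Q.pw (int (2 * h N + 1)) * (inverse (Q.p1 (int (N + 2 * r + 1)))
      * (inverse (Q.p2 (int (N + 2 * s + 1))) * (inverse (Q.pw (int (h N + s + 1))) * inverse (Q.pw (int (h N + r + 1)))))))" for N
  have XTh: "cst (qpoch q q (int (h N)) ^ 2) * Q.theta (int r) (int s) (int (h N)) (int (h N)) = X N" for N
  proof -
    have i: "int (h N) + int (h N) + 1 = int (2 * h N + 1)" "int (h N) + int r - int s + 1 = int (N + 2 * r + 1)"
      "int (h N) + int s - int r + 1 = int (N + 2 * s + 1)" "int (h N) + int s + 1 = int (h N + s + 1)" "int (h N) + int r + 1 = int (h N + r + 1)"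
      by (simp_all add: h_def)
    show ?thesis
      unfolding X_def Q.theta_def i c_def divide_inverse inverse_mult_distrib cst_hom cst_inverse qpoch_cst power2_eq_square
      by (simp only: mult_ac)
  qed
  have "conv X (cst 1 * cst 1 * (A3 * (inverse A1 * (inverse A2 * (inverse A3 * inverse A3)))))"
    unfolding X_def
    by (intro conv_mult conv_cst clim h conv_p)
       (rule filterlim_at_top_mono[OF filterlim_ident]; auto simp: h_def)+
  \<comment> \<open>The numerator (w;q)_(L+M+1) cancels one of the two such factors in the
    denominator of \<open>theta\<close>.\<close>
  moreover have "cst 1 * cst 1 * (A3 * (inverse A1 * (inverse A2 * (inverse A3 * inverse A3)))) = inverse (A1 * A3 * A2)"
    using A_nonzero by (simp add: cst_hom field_simps)
  ultimately have "conv X (inverse (A1 * A3 * A2))" by simp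
  then have "conv (\<lambda>N. F * weight r s * X N) (F * weight r s * inverse (A1 * A3 * A2))"
    by (intro conv_mult conv_const pser_closed F weight_pser)
  from conv_coeff2[OF this]
  have lim1: "(\<lambda>N. coeff2 (F * weight r s * X N) m n) \<longlonglongrightarrow> coeff2 (F * weight r s / (A1 * A3 * A2)) m n"
    by (simp add: divide_inverse)
  have eq: "coeff2 (F * weight r s * X N) m n = (\<Sum>l\<le>B. \<Sum>j\<le>B. coeff2 (g l j) m n * (c (h N) l * c (h N) j))"
    if "B \<le> h N" for N
  proof -
    have k: "cst (qpoch q q (int (h N))) * inv_qfact (h N - l) = cst (c (h N) l)" if "l \<le> h N" for l
      using that by (simp add: inv_qfact_def c_def cst_hom of_nat_diff)
    have "F * weight r s * X N = cst (qpoch q q (int (h N))) * cst (qpoch q q (int (h N))) * qconv (h N) (\<lambda>l. qconv (h N) (g l))"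
      unfolding XTh[symmetric] id cst_hom power2_eq_square by (simp only: mult_ac)
    also have "\<dots> = (\<Sum>l\<le>h N. \<Sum>j\<le>h N. (cst (qpoch q q (int (h N))) * inv_qfact (h N - l)) * ((cst (qpoch q q (int (h N))) * inv_qfact (h N - j)) * g l j))"
      unfolding qconv_def sum_distrib_left sum_distrib_right by (simp only: mult_ac)
    also have "\<dots> = (\<Sum>l\<le>h N. \<Sum>j\<le>h N. cst (c (h N) l) * (cst (c (h N) j) * g l j))"
      by (intro sum.cong refl) (simp add: k)
    finally have sum: "F * weight r s * X N = (\<Sum>l\<le>h N. \<Sum>j\<le>h N. cst (c (h N) l) * (cst (c (h N) j) * g l j))" .
    have "coeff2 (F * weight r s * X N) m n = (\<Sum>l\<le>h N. \<Sum>j\<le>h N. coeff2 (g l j) m n * (c (h N) l * c (h N) j))"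
      unfolding sum coeff2_sum coeff2_simps by (simp only: mult_ac)
    then show ?thesis using box[OF that] by simp
  qed
  have "(\<lambda>N. \<Sum>l\<le>B. \<Sum>j\<le>B. coeff2 (g l j) m n * (c (h N) l * c (h N) j)) \<longlonglongrightarrow> (\<Sum>l\<le>B. \<Sum>j\<le>B. coeff2 (g l j) m n * (1 * 1))"
    by (intro tendsto_sum tendsto_mult tendsto_const clim h)
  then have lim0: "(\<lambda>N. \<Sum>l\<le>B. \<Sum>j\<le>B. coeff2 (g l j) m n * (c (h N) l * c (h N) j)) \<longlonglongrightarrow> v"
    by (simp add: v_def)
  have "\<forall>\<^sub>F N in sequentially. (\<Sum>l\<le>B. \<Sum>j\<le>B. coeff2 (g l j) m n * (c (h N) l * c (h N) j)) = coeff2 (F * weight r s * X N) m n"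
    by (rule eventually_mono[OF eventually_ge_at_top[of B]], rule eq[symmetric]) (simp add: h_def)
  from Lim_transform_eventually[OF lim0 this]
  have "(\<lambda>N. coeff2 (F * weight r s * X N) m n) \<longlonglongrightarrow> v" .
  from LIMSEQ_unique[OF this lim1] tot show ?thesis by (simp add: g_def)
qed

definition delta_coeff :: "nat \<Rightarrow> nat \<Rightarrow> ser" where "delta_coeff r s = Q.vandermonde (int r) (int s) * Q.omega r s"

lemma vandermonde_units:
  "1 - Z1 * cst q powi i \<in> pser" "1 - Z2 * cst q powi i \<in> pser" "1 - Z1 * Z2 * cst q powi i \<in> pser"
  "inverse (1 - Z1 * cst q powi i) \<in> pser" "inverse (1 - Z2 * cst q powi i) \<in> pser" "inverse (1 - Z1 * Z2 * cst q powi i) \<in> pser"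
  unfolding cst_powi[symmetric] by (auto intro: pser_inverse_1)

lemma delta_coeff_pser: "delta_coeff r s \<in> pser"
proof -
  have "Q.omega r s \<in> pser"
    unfolding Q.omega_def cst_power[symmetric] by (intro pser_closed pser_power p_pser rq_pser)
  moreover have "Q.vandermonde (int r) (int s) \<in> pser" unfolding Q.vandermonde_def by (intro pser_closed vandermonde_units)
  ultimately show ?thesis unfolding delta_coeff_def by (intro pser_closed)
qed

lemma schur_pser: "Q.schur A B r s \<in> pser"
proof -
  have "Q.bialt A B r s \<in> pser"
    unfolding Q.bialt_def Let_def cst_powi[symmetric] cst_inverse[symmetric] by (intro pser_closed pser_power)
  moreover have "inverse (Q.bialt 1 1 r s) \<in> pser"
    unfolding Q.bialt_1_1 Q.vandermonde_def inverse_mult_distrib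
    unfolding inverse_inverse_eq by (intro pser_closed vandermonde_units) (auto simp: cst_powi[symmetric])
  ultimately show ?thesis unfolding Q.schur_def divide_inverse by (intro pser_closed)
qed

lemma delta_Psi: "L \<le> B \<Longrightarrow> M \<le> B \<Longrightarrow> delta L M = (\<Sum>r\<le>B. \<Sum>s\<le>B. delta_coeff r s * Psi r s L M)"
proof -
  assume LM: "L \<le> B" "M \<le> B"
  have "(\<Sum>s\<le>B. delta_coeff r s * Psi r s L M) = (\<Sum>s\<le>M. delta_coeff r s * Psi r s L M)" for r
    using LM by (intro sum.mono_neutral_right) (auto simp: Psi_zero)
  moreover have "(\<Sum>r\<le>B. \<Sum>s\<le>M. delta_coeff r s * Psi r s L M) = (\<Sum>r\<le>L. \<Sum>s\<le>M. delta_coeff r s * Psi r s L M)"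
    using LM by (intro sum.mono_neutral_right) (auto simp: Psi_zero)
  moreover have "(\<Sum>r\<le>L. \<Sum>s\<le>M. delta_coeff r s * Psi r s L M) =
     weight L M * (\<Sum>r\<le>L. \<Sum>s\<le>M. Q.vandermonde (int r) (int s) * Q.omega r s * Q.theta (int r) (int s) (int L) (int M))"
    unfolding sum_distrib_left delta_coeff_def Psi_def by (simp only: mult_ac)
  moreover have "weight 0 0 = 1" by (simp add: weight_def cst_hom)
  ultimately show ?thesis unfolding Q.delta_expansion by (simp add: delta_def)
qed

section \<open>Cutting off the expansion of the unit vector at a box\<close>

definition zero_on_box :: "nat \<Rightarrow> (nat \<Rightarrow> nat \<Rightarrow> ser) \<Rightarrow> bool" where
  "zero_on_box B g \<longleftrightarrow> (\<forall>l\<le>B. \<forall>j\<le>B. g l j = 0)"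

text \<open>Such operators do not lower the degree, and are causal; hence a column vanishing on a large box does not contribute
  to a given coefficient.\<close>

definition tight :: "colop \<Rightarrow> bool" where
  "tight A \<longleftrightarrow> (\<forall>c g. graded c g \<longrightarrow> graded c (app A g)) \<and> (\<forall>B g. zero_on_box B g \<longrightarrow> zero_on_box B (app A g))"

lemma tight_mult: "tight A \<Longrightarrow> tight A' \<Longrightarrow> tight (A * A')"
  by (simp add: tight_def)

lemma tight_basic: "tight opP" "tight opR" "tight opT" "tight 1" "a \<in> pser \<Longrightarrow> tight (scalar a)" "tight 0"
proof -
  show "tight opP" "tight opR" "tight 1" "a \<in> pser \<Longrightarrow> tight (scalar a)" "tight 0"
    by (auto simp: tight_def zero_on_box_def graded_diag pser_closed) (auto simp: graded_def)
  show "tight opT"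
    unfolding tight_def app_ops
  proof (intro conjI allI impI)
    fix c g assume "graded c g" then show "graded c (tauf g)" using graded_tauf graded_mono by blast
  next
    fix B g assume "zero_on_box B g"
    then show "zero_on_box B (tauf g)" by (simp add: zero_on_box_def tauf_def qconv_def)
  qed
qed

lemma tight_row: "tight (T.rw k A B)"
proof (induction k)
  case 0
  show ?case unfolding T.row_0 by (auto intro: tight_mult tight_basic)
next
  case (Suc k)
  then show ?case unfolding T.row_Suc by (auto intro: tight_mult tight_basic)
qed

lemma tight_diff: "tight A \<Longrightarrow> tight A' \<Longrightarrow> tight (A - A')"
proof -
  assume A: "tight A" "tight A'"
  have "graded c (app (A - A') g)" if "graded c g" for c g
  proof -
    have "graded c (\<lambda>l j. app A g l j + (- 1) * app A' g l j)"
      using A that by (intro graded_add graded_diag) (auto simp: tight_def)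
    moreover have "app (A - A') g = (\<lambda>l j. app A g l j + (- 1) * app A' g l j)" by (intro ext) simp
    ultimately show ?thesis by simp
  qed
  then show ?thesis using A by (auto simp: tight_def zero_on_box_def)
qed

lemma tight_V: "tight (T.V k A B)"
  unfolding T.V_def by (intro tight_diff tight_mult tight_row tight_basic pser_closed)

lemma app_sum: "app A (\<lambda>l j. \<Sum>i\<in>I. f i l j) l j = (\<Sum>i\<in>I. app A (f i) l j)"
proof (induction I rule: infinite_finite_induct)
  case (insert i I)
  then show ?case by (simp add: app_add)
qed (use app_scale[of A 0 "\<lambda>_ _. 0"] in simp_all)

text \<open>For a fixed coefficient the expansion is cut off at the box \<open>B\<close>. The
  remainder stays zero on the box under the word, and outside it has too high degree to
  contribute.\<close>

lemma total_V_delta: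
  assumes ab: "a \<le> k" "b \<le> k" and B: "m \<le> int B" "n \<le> int B"
  shows "total m n (app (T.V k (Suc a) (Suc b)) delta)
    (\<Sum>(r, s)\<in>{..B} \<times> {..B}. coeff2 (Q.schur (Suc a) (Suc b) (int r) (int s) * weight r s ^ k * delta_coeff r s * weight r s / (A1 * A3 * A2)) m n)"
proof -
  let ?V = "T.V k (Suc a) (Suc b)"
  define f where "f = (\<lambda>(r, s) l j. delta_coeff r s * Psi r s l j)"
  define rest where "rest = (\<lambda>l j. delta l j - (\<Sum>y\<in>{..B} \<times> {..B}. f y l j))"
  have f_graded: "graded 0 (f y)" for y
    unfolding f_def by (cases y) (auto intro!: graded_diag Psi_graded delta_coeff_pser)
  have d_graded: "graded 0 delta"
  proof -
    have "1 \<in> monom_ideal 0 0" unfolding monom_ideal_def image_iff by (rule bexI[of _ 1]) auto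
    then show ?thesis by (simp add: graded_def delta_def)
  qed
  have s_graded: "graded 0 (\<lambda>l j. \<Sum>y\<in>I. f y l j)" for I
    by (induction I rule: infinite_finite_induct) (auto intro: graded_add f_graded simp: graded_def[of 0 "\<lambda>_ _. 0"])
  have "graded 0 (\<lambda>l j. delta l j + (- 1) * (\<Sum>y\<in>{..B} \<times> {..B}. f y l j))"
    by (intro graded_add d_graded graded_diag s_graded) auto
  then have r_graded: "graded 0 rest" by (simp add: rest_def)
  have r_zero: "zero_on_box B rest"
    by (auto simp: zero_on_box_def rest_def f_def delta_Psi sum.cartesian_product case_prod_unfold)
  have Vr: "graded 0 (app ?V rest)" "zero_on_box B (app ?V rest)"
    using tight_V[of k "Suc a" "Suc b"] r_graded r_zero unfolding tight_def by blast+
  have "coeff2 (app ?V rest l j) m n = 0" for l j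
  proof (cases "l \<le> B \<and> j \<le> B")
    case True
    then show ?thesis using Vr(2) by (simp add: zero_on_box_def)
  next
    case False
    have "app ?V rest l j \<in> monom_ideal l j" using Vr(1) unfolding graded_def by (metis diff_zero)
    moreover have "m < int l \<or> n < int j" using B False by linarith
    ultimately show ?thesis by (rule coeff2_monom_ideal)
  qed
  then have tot_rest: "total m n (app ?V rest) 0" by (simp add: total_def)
  have tot_f: "total m n (app ?V (f (r, s))) (coeff2 (Q.schur (Suc a) (Suc b) (int r) (int s) * weight r s ^ k * delta_coeff r s * weight r s / (A1 * A3 * A2)) m n)" for r s
  proof -
    have "same_total (app ?V (f (r, s))) (\<lambda>l j. (Q.schur (Suc a) (Suc b) (int r) (int s) * weight r s ^ k * delta_coeff r s) * Psi r s l j)"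
      using spectral[OF eig_scale[OF eig_Psi delta_coeff_pser], of "Suc a" k "Suc b" r s] ab by (simp add: f_def mult.assoc)
    then show ?thesis
      by (rule same_total_total) (intro total_Psi pser_closed schur_pser pser_power weight_pser delta_coeff_pser)
  qed
  have "app ?V delta l j = (\<Sum>y\<in>{..B} \<times> {..B}. app ?V (f y) l j) + app ?V rest l j" for l j
  proof -
    have "delta = (\<lambda>l j. (\<Sum>y\<in>{..B} \<times> {..B}. f y l j) + rest l j)" by (simp add: rest_def)
    then have "app ?V delta l j = app ?V (\<lambda>l j. (\<Sum>y\<in>{..B} \<times> {..B}. f y l j) + rest l j) l j" by simp
    then show ?thesis by (simp only: app_add app_sum)
  qed
  then have "app ?V delta = (\<lambda>l j. (\<Sum>y\<in>{..B} \<times> {..B}. app ?V (f y) l j) + app ?V rest l j)" by blast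
  moreover have "total m n (\<lambda>l j. (\<Sum>y\<in>{..B} \<times> {..B}. app ?V (f y) l j) + app ?V rest l j)
     ((\<Sum>y\<in>{..B} \<times> {..B}. case y of (r, s) \<Rightarrow> coeff2 (Q.schur (Suc a) (Suc b) (int r) (int s) * weight r s ^ k * delta_coeff r s * weight r s / (A1 * A3 * A2)) m n) + 0)"
    by (intro total_add total_sum tot_rest) (auto intro: tot_f)
  ultimately show ?thesis by simp
qed

end

section \<open>The summands of the right-hand side\<close>

lemma det3_expand:
  "det3 M = M 1 1 * M 2 2 * M 3 3 + M 1 2 * M 2 3 * M 3 1 + M 1 3 * M 2 1 * M 3 2
          - M 1 1 * M 2 3 * M 3 2 - M 1 2 * M 2 1 * M 3 3 - M 1 3 * M 2 2 * M 3 1"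
proof -
  have f123: "finite {2::nat, 3}" "1 \<notin> {2::nat, 3}" and f23: "finite {3::nat}" "2 \<notin> {3::nat}" by auto
  have s3: "{p. p permutes {3::nat}} = {id}" by auto
  show ?thesis
    unfolding det3_def sum_over_permutations_insert[OF f123] sum_over_permutations_insert[OF f23] s3
    by (simp add: sign_swap_id permutation_swap_id sign_compose sign_id transpose_def algebra_simps)
qed

context qfield
begin

text \<open>Here \<open>X i\<close> is x_i q^(y_i) with x_3 = 1. Extracting its power with exponent
  nu_i from row i leaves the alternant of the inverses. The second factor is the product of the
  q^(-nu_i y_i), because the sum of the nu_i y_i is A r + B s.\<close>

lemma det3_bialt:
  fixes X :: "nat \<Rightarrow> 'a" and \<nu> :: "nat \<Rightarrow> int"
  assumes X: "X 1 = w * q powi r" "X 2 = z2 * q powi (s - r)" "X 3 = inverse (q powi s)"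
    and \<nu>: "\<nu> 1 = int A + int B" "\<nu> 2 = int B" "\<nu> 3 = 0" and nz: "z1 \<noteq> 0" "z2 \<noteq> 0"
  shows "det3 (\<lambda>i j. X i powi (\<nu> i - \<nu> j)) * (inverse (q powi r) ^ A * inverse (q powi s) ^ B) = bialt A B r s"
proof -
  define x y z where "x = X 1" and "y = X 2" and "z = X 3"
  have w0: "w \<noteq> 0" using nz w_def by simp
  have xyz: "x \<noteq> 0" "y \<noteq> 0" "z \<noteq> 0" using X w0 nz q0 by (simp_all add: x_def y_def z_def)
  have b: "bialt A B r s = (w / x) ^ A * z ^ B - (w / y) ^ A * z ^ B - (w / x) ^ A * y ^ B + (w / z) ^ A * y ^ B + (w / y) ^ A * x ^ B - (w / z) ^ A * x ^ B"
  proof -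
    have "w / x = inverse (q powi r)" "w / y = z1 * q powi (r - s)" "w / z = w * q powi s"
      unfolding x_def y_def z_def X powi_split w_def using nz q0 by (simp_all add: field_simps)
    moreover have "x = w * q powi r" "y = z2 * q powi (s - r)" "z = inverse (q powi s)"
      using X by (simp_all add: x_def y_def z_def)
    ultimately show ?thesis by (simp add: bialt_def Let_def w0)
  qed
  have g: "inverse (q powi r) = w / x" "inverse (q powi s) = z"
    using X w0 q0 by (simp_all add: x_def z_def field_simps)
  have p: "v powi (int A + int B - int B) = v ^ A" "v powi (int A + int B - 0) = v ^ A * v ^ B"
    "v powi (int B - (int A + int B)) = inverse (v ^ A)" "v powi (int B - 0) = v ^ B"
    "v powi (0 - (int A + int B)) = inverse (v ^ A * v ^ B)" "v powi (0 - int B) = inverse (v ^ B)" if "v \<noteq> 0" for v :: 'a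
    using that by (simp_all add: power_int_add power_int_diff power_int_minus divide_inverse)
  show ?thesis
    unfolding det3_expand \<nu> b g x_def[symmetric] y_def[symmetric] z_def[symmetric] diff_self power_int_0_right
      p[OF xyz(1)] p[OF xyz(2)] p[OF xyz(3)]
    using xyz by (simp add: power_divide field_simps)
qed

text \<open>Treats the negative index y_3 = -s in the factor i = 3 of the product.\<close>

lemma reflect_unit:
  assumes "w \<noteq> 0"
  shows "qpoch 1 q (- int s) / qpoch (q / w) q (- int s) = (q / w) ^ s * pw (int s) * rq (int s)"
proof (induction s)
  case 0
  show ?case by (simp add: qpoch_def)
next
  case (Suc s)
  have q1: "q powi j \<noteq> 1" if "j < 0" for j
  proof -
    have "q ^ nat (- j) \<noteq> 1" using qn[of "nat (- j)"] that by simp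
    then show ?thesis using that by (simp add: power_int_def power_inverse)
  qed
  have w1: "q / w * q powi j \<noteq> 1" for j
  proof
    assume "q / w * q powi j = 1"
    then have "w = q powi (j + 1)" using assms q0 by (simp add: field_simps power_int_add)
    then have "w * q powi (- (j + 1)) = 1" unfolding power_int_minus using q0 by simp
    then show False using nw by blast
  qed
  let ?j = "- int (Suc s)"
  have 1: "qpoch 1 q (- int s) = qpoch 1 q ?j * (1 - q powi ?j)"
    using qpoch_rec[OF q0, of 1 ?j] q1 by simp
  have 2: "qpoch (q / w) q (- int s) = qpoch (q / w) q ?j * (1 - q / w * q powi ?j)"
    using qpoch_rec[OF q0, of "q / w" ?j] w1 by simp
  have 3: "pw (int (Suc s)) = pw (int s) * (1 - w * q powi int s)"
    using pw_rec[of "int s"] by (simp add: add.commute)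
  have 4: "rq (int s) = (1 - q powi int (Suc s)) * rq (int (Suc s))"
    using rq_rec[of "int (Suc s)"] by simp
  have nz: "1 - q powi ?j \<noteq> 0" "1 - q / w * q powi ?j \<noteq> 0" "1 - q powi int (Suc s) \<noteq> 0"
    using q1[of ?j] w1 qn[of "Suc s"] by (simp, simp, simp only: power_int_of_nat, simp)
  define x where "x = q ^ s"
  have x0: "x \<noteq> 0" using q0 by (simp add: x_def)
  have e: "q powi ?j = inverse (q * x)" "q powi int (Suc s) = q * x" "q powi int s = x"
    using q0 by (simp_all add: x_def power_int_def power_inverse nat_add_distrib)
  have "qpoch 1 q ?j / qpoch (q / w) q ?j = (qpoch 1 q (- int s) / qpoch (q / w) q (- int s)) * ((1 - q / w * q powi ?j) / (1 - q powi ?j))"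
    unfolding 1 2 using nz by simp
  also have "\<dots> = (q / w) ^ s * pw (int s) * ((1 - q powi int (Suc s)) * rq (int (Suc s))) * ((1 - q / w * q powi ?j) / (1 - q powi ?j))"
    unfolding Suc.IH 4 by simp
  also have "(1 - q / w * q powi ?j) / (1 - q powi ?j) = (q / w) * (1 - w * q powi int s) / (1 - q powi int (Suc s))"
    using nz assms q0 x0 unfolding e by (simp add: field_simps)
  also have "(q / w) ^ s * pw (int s) * ((1 - q powi int (Suc s)) * rq (int (Suc s))) * \<dots> = (q / w) ^ Suc s * pw (int (Suc s)) * rq (int (Suc s))"
    unfolding 3 using nz(3) by simp
  finally show ?case .
qed

text \<open>Treats the denominator (q x_2/x_1; q)_(y_2). As y_2 = s - r may have either sign, the
  induction runs in both directions.\<close>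

lemma reflect_z1:
  assumes "z1 \<noteq> 0"
  shows "qpoch (q / z1) q n * p1 (- n) * (- z1) powi n = q powi (n * (n + 1) div 2)"
proof -
  define f where "f n = qpoch (q / z1) q n * p1 (- n) * (- z1) powi n" for n
  have w1: "q / z1 * q powi j \<noteq> 1" for j
  proof
    assume "q / z1 * q powi j = 1"
    then have "z1 = q powi (j + 1)" using assms q0 by (simp add: field_simps power_int_add)
    then have "z1 * q powi (- (j + 1)) = 1" unfolding power_int_minus using q0 by simp
    then show False using nz1 by blast
  qed
  have step: "f (n + 1) = f n * q powi (n + 1)" for n
  proof -
    have 1: "qpoch (q / z1) q (n + 1) = qpoch (q / z1) q n * (1 - q / z1 * q powi n)"
      by (rule qpoch_rec[OF q0 w1])
    have 2: "p1 (- n) = p1 (- (n + 1)) * (1 - z1 * q powi (- (n + 1)))"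
      using p1_rec[of "- (n + 1)"] by simp
    have 3: "(1 - q / z1 * q powi n) * (- z1) = (1 - z1 * q powi (- (n + 1))) * q powi (n + 1)"
    proof -
      have e: "q powi (- (n + 1)) = inverse (q powi n * q)" "q powi (n + 1) = q powi n * q"
        using q0 by (simp_all only: power_int_minus) (simp_all add: power_int_add)
      show ?thesis unfolding e using assms q0 by (simp add: field_simps)
    qed
    have "f (n + 1) = qpoch (q / z1) q n * p1 (- (n + 1)) * ((1 - q / z1 * q powi n) * (- z1)) * (- z1) powi n"
      unfolding f_def 1 using assms by (simp add: power_int_add mult_ac)
    then show ?thesis unfolding 3 f_def 2 by (simp add: mult_ac)
  qed
  have T: "(n + 1) * (n + 1 + 1) div 2 = n * (n + 1) div 2 + (n + 1)" for n :: int
  proof -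
    have "(n + 1) * (n + 1 + 1) = n * (n + 1) + 2 * (n + 1)" by (simp add: algebra_simps)
    then show ?thesis by simp
  qed
  have "f n = q powi (n * (n + 1) div 2)"
  proof (induction n rule: int_induct[of _ 0])
    case base
    show ?case by (simp add: f_def qpoch_def)
  next
    case (step1 i)
    then show ?case unfolding step T using q0 by (simp add: power_int_add)
  next
    case (step2 i)
    have "f i = f (i - 1) * q powi i" using step[of "i - 1"] by simp
    moreover have "i * (i + 1) div 2 = (i - 1) * (i - 1 + 1) div 2 + i" using T[of "i - 1"] by simp
    ultimately show ?case using step2 q0 by (simp add: power_int_add)
  qed
  then show ?thesis by (simp add: f_def)
qed

text \<open>One of the k + 2 copies of \<open>weight\<close> is consumed here: its monomial and its
  quadratic power of q combine with those from the two reflections to the sign and the binomial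
  powers in \<open>omega\<close>. The surplus q^(r+s) cancels against
  \<open>bialt_1_1\<close>.\<close>

lemma coefficient_omega:
  fixes r s :: nat
  assumes nz: "z1 \<noteq> 0" "z2 \<noteq> 0"
  shows "pw (int r) * p2 (int s - int r) * qpoch 1 q (- int s)
       / (qpoch q q (int r) * qpoch (q / z1) q (int s - int r) * qpoch (q / w) q (- int s))
       * (z1 ^ r * z2 ^ s * q powi (int r ^ 2 - int r * int s + int s ^ 2)) = q powi (int r + int s) * omega r s"
proof -
  have w0: "w \<noteq> 0" using nz w_def by simp
  define n where "n = int s - int r"
  define m where "m = n * (n + 1) div 2"
  have mm: "2 * m = n * (n + 1)" unfolding m_def by simp
  have inv: "inverse (qpoch (q / z1) q n) = p1 (- n) * (- z1) powi n * q powi (- m)"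
  proof -
    have "qpoch (q / z1) q n * (p1 (- n) * (- z1) powi n * q powi (- m)) = q powi m * q powi (- m)"
      using reflect_z1[OF nz(1), of n] by (simp add: m_def mult.assoc)
    also have "\<dots> = 1" using q0 by (simp add: power_int_minus)
    finally show ?thesis by (metis inverse_unique)
  qed
  have mono: "(q / w) ^ s * (- z1) powi n * (z1 ^ r * z2 ^ s) = (- 1) ^ (r + s) * q ^ s"
  proof -
    define e f where "e = (- 1 :: 'a) ^ r" and "f = (- 1 :: 'a) ^ s"
    have ee: "e * e = 1" unfolding e_def power_add[symmetric] by simp
    then have e0: "e \<noteq> 0" by auto
    have p: "(- z1) powi n = f * z1 ^ s / (e * z1 ^ r)"
      unfolding n_def e_def f_def power_minus[of z1, symmetric] using nz by (simp add: power_int_diff)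
    have w: "(q / w) ^ s = q ^ s / (z1 ^ s * z2 ^ s)" by (simp add: w_def power_divide power_mult_distrib)
    have "(q / w) ^ s * (- z1) powi n * (z1 ^ r * z2 ^ s) = q ^ s * (f / e)"
      unfolding p w using nz e0 by (simp add: field_simps)
    also have "f / e = e * f" using ee e0 by (simp add: field_simps mult.assoc[symmetric])
    finally show ?thesis unfolding e_def f_def power_add[symmetric] by (simp only: mult.commute)
  qed
  have ch2: "2 * int (n choose 2) = int n * (int n - 1)" for n
  proof (induction n)
    case (Suc n)
    have "Suc n choose 2 = n + (n choose 2)" by (simp add: numeral_2_eq_2)
    then show ?case using Suc by (simp add: algebra_simps)
  qed simp
  have ex: "int s - m + (int r ^ 2 - int r * int s + int s ^ 2) = int r + int s + int (r choose 2) + int (s choose 2)"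
  proof -
    have "2 * (int s - m + (int r ^ 2 - int r * int s + int s ^ 2)) = 2 * (int r + int s + int (r choose 2) + int (s choose 2))"
      unfolding distrib_left right_diff_distrib mm ch2 by (simp add: n_def power2_eq_square algebra_simps)
    then show ?thesis by simp
  qed
  have "pw (int r) * p2 n * qpoch 1 q (- int s) / (qpoch q q (int r) * qpoch (q / z1) q n * qpoch (q / w) q (- int s))
       * (z1 ^ r * z2 ^ s * q powi (int r ^ 2 - int r * int s + int s ^ 2)) =
     pw (int r) * p2 n * rq (int r) * inverse (qpoch (q / z1) q n) * (qpoch 1 q (- int s) / qpoch (q / w) q (- int s))
       * (z1 ^ r * z2 ^ s * q powi (int r ^ 2 - int r * int s + int s ^ 2))"
    by (simp add: divide_inverse)
  also have "\<dots> = pw (int r) * p2 n * rq (int r) * p1 (- n) * pw (int s) * rq (int s) *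
      ((q / w) ^ s * (- z1) powi n * (z1 ^ r * z2 ^ s)) * (q powi (- m) * q powi (int r ^ 2 - int r * int s + int s ^ 2))"
    unfolding inv reflect_unit[OF w0] by (simp only: mult_ac)
  also have "\<dots> = pw (int r) * p2 n * rq (int r) * p1 (- n) * pw (int s) * rq (int s) * (- 1) ^ (r + s) *
      q powi (int s - m + (int r ^ 2 - int r * int s + int s ^ 2))"
    unfolding mono using q0 by (simp add: power_int_add power_int_diff power_int_minus divide_inverse mult_ac)
  also have "\<dots> = q powi (int r + int s) * omega r s"
    unfolding ex omega_def n_def using q0 by (simp add: power_int_add mult_ac)
  finally show ?thesis unfolding n_def .
qed

end

context qser
begin

text \<open>Of the k + 2 copies of \<open>weight\<close>, k are the eigenvalue of t^k, one comes
  from \<open>total_Psi\<close>, and one goes into \<open>omega\<close>. The alternant becomes Schur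
  function times Vandermonde.\<close>

lemma rhs_term_eq:
  "rhs_term q a b k (int r, int s - int r, - int s) =
     Q.schur (Suc a) (Suc b) (int r) (int s) * weight r s ^ k * (Q.vandermonde (int r) (int s) * Q.omega r s) * weight r s
       / (at_z1 (qinf_fps q) * at_z1z2 (qinf_fps q) * at_z2 (qinf_fps q))"
proof -
  let ?y = "(int r, int s - int r, - int s)" and ?c = "cst q"
  have c0: "?c \<noteq> 0" by (rule Q.q0)
  have Z0: "Z1 \<noteq> 0" "Z2 \<noteq> 0" by (simp_all add: Z1_def Z2_def)
  have yv: "yv ?y 1 = int r" "yv ?y 2 = int s - int r" "yv ?y 3 = - int s" by (simp_all add: yv_def)
  have xv: "xv 1 = Z1 * Z2" "xv 2 = Z2" "xv 3 = 1" by (simp_all add: xv_def)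
  have nu: "nu a b 1 = int (Suc a) + int (Suc b)" "nu a b 2 = int (Suc b)" "nu a b 3 = 0" by (simp_all add: nu_def)
  define det where "det = det3 (\<lambda>i j. (xv i * ?c powi yv ?y i) powi (nu a b i - nu a b j))"
  define G where "G = inverse (?c powi int r) ^ Suc a * inverse (?c powi int s) ^ Suc b"
  define E where "E = int r ^ 2 - int r * int s + int s ^ 2"
  have W: "weight r s = Z1 ^ r * Z2 ^ s * ?c powi E" by (simp add: weight_def E_def cst_powi)
  have detG: "det * G = Q.bialt (Suc a) (Suc b) (int r) (int s)"
    unfolding det_def G_def
    by (rule Q.det3_bialt) (simp_all only: yv xv nu Z0 not_False_eq_True power_int_minus mult_1_left)
  define ratio where "ratio = Q.pw (int r) * Q.p2 (int s - int r) * qpoch 1 ?c (- int s)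
       / (qpoch ?c ?c (int r) * qpoch (?c / Z1) ?c (int s - int r) * qpoch (?c / (Z1 * Z2)) ?c (- int s))"
  have ratio: "ratio * weight r s = ?c powi (int r + int s) * Q.omega r s"
    unfolding ratio_def W E_def by (rule Q.coefficient_omega[OF Z0])
  have x: "(Z1 * Z2) powi ((int k + 2) * int r) * Z2 powi ((int k + 2) * (int s - int r)) = (Z1 ^ r * Z2 ^ s) ^ (k + 2)"
  proof -
    have e: "(int k + 2) * int r = int (r * (k + 2))" "(int k + 2) * (int s - int r) = int (s * (k + 2)) - int (r * (k + 2))"
      by (simp_all add: algebra_simps)
    show ?thesis
      unfolding e power_int_of_nat power_int_diff[OF disjI1[OF Z0(2)]] power_mult_distrib power_mult[symmetric]
      using Z0 by simp
  qed
  \<comment> \<open>As the y_i add up to 0, the three binomials give half the sum of their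
    squares.\<close>
  have b2: "binom2 (int r) + binom2 (int s - int r) + binom2 (- int s) = E"
  proof -
    have h: "2 * binom2 n = n * (n - 1)" for n unfolding binom2_def by (cases "even n") auto
    have "2 * (binom2 (int r) + binom2 (int s - int r) + binom2 (- int s)) = 2 * E"
      unfolding distrib_left h E_def by (simp add: power2_eq_square algebra_simps)
    then show ?thesis by simp
  qed
  have cc: "?c powi ((int k + 2) * binom2 (int r) - nu a b 1 * int r) * ?c powi ((int k + 2) * binom2 (int s - int r) - nu a b 2 * (int s - int r))
      * ?c powi ((int k + 2) * binom2 (- int s) - nu a b 3 * (- int s)) = (?c powi E) ^ (k + 2) * G"
  proof -
    have G': "G = ?c powi (- (int r * int (Suc a)) - int s * int (Suc b))"
      unfolding G_def power_inverse power_int_power' power_int_diff[OF disjI1[OF c0]] power_int_minus divide_inverse ..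
    have "(?c powi E) ^ (k + 2) = ?c powi (E * (int k + 2))"
      by (simp only: power_int_power' of_nat_add of_nat_numeral)
    then show ?thesis unfolding G' nu
      using c0 by (simp add: power_int_add[symmetric] b2[symmetric] algebra_simps)
  qed
  have P: "(\<Prod>i\<in>{1,2,3}. xv i powi ((int k + 2) * yv ?y i)
          * ?c powi ((int k + 2) * binom2 (yv ?y i) - nu a b i * yv ?y i)
          * qpoch (xv i / xv 3) ?c (yv ?y i) / qpoch (?c * xv i / xv 1) ?c (yv ?y i)) =
     ((Z1 * Z2) powi ((int k + 2) * int r) * Z2 powi ((int k + 2) * (int s - int r))) *
     (?c powi ((int k + 2) * binom2 (int r) - nu a b 1 * int r) * ?c powi ((int k + 2) * binom2 (int s - int r) - nu a b 2 * (int s - int r))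
      * ?c powi ((int k + 2) * binom2 (- int s) - nu a b 3 * (- int s))) * ratio"
  proof -
    have d: "(\<Prod>i\<in>{1,2,3}. f i) = f 1 * f 2 * f 3" for f :: "nat \<Rightarrow> ser" by simp
    have q: "?c * (Z1 * Z2) / (Z1 * Z2) = ?c" "?c * Z2 / (Z1 * Z2) = ?c / Z1" "?c * 1 / (Z1 * Z2) = ?c / (Z1 * Z2)"
      "Z1 * Z2 / 1 = Z1 * Z2" "Z2 / 1 = Z2" "1 / 1 = (1 :: ser)" using Z0 by simp_all
    show ?thesis unfolding d yv xv unfolding q ratio_def power_int_1_left unfolding divide_inverse inverse_mult_distrib mult_1_left mult_1_right by (simp only: mult_ac)
  qed
  have v0: "Q.vandermonde (int r) (int s) \<noteq> 0" using Q.nz1 Q.nz2 Q.nw by (simp add: Q.vandermonde_def)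
  have WW: "weight r s ^ (k + 2) = (Z1 ^ r * Z2 ^ s) ^ (k + 2) * (?c powi E) ^ (k + 2)"
    unfolding W by (simp only: power_mult_distrib)
  have "det * ((Z1 ^ r * Z2 ^ s) ^ (k + 2) * ((?c powi E) ^ (k + 2) * G) * ratio) = (det * G) * weight r s ^ (k + 1) * (ratio * weight r s)"
  proof -
    have "weight r s ^ (k + 2) = weight r s ^ (k + 1) * weight r s" by simp
    then have "det * G * weight r s ^ (k + 2) * ratio = (det * G) * weight r s ^ (k + 1) * (ratio * weight r s)" by (simp only: mult_ac)
    then show ?thesis unfolding WW by (simp only: mult_ac)
  qed
  also have "\<dots> = Q.schur (Suc a) (Suc b) (int r) (int s) * weight r s ^ k * (Q.vandermonde (int r) (int s) * Q.omega r s) * weight r s"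
  proof -
    have "Q.bialt (Suc a) (Suc b) (int r) (int s) = Q.schur (Suc a) (Suc b) (int r) (int s) * (inverse (?c powi (int r + int s)) * Q.vandermonde (int r) (int s))"
      unfolding Q.schur_def Q.bialt_1_1 using v0 c0 by simp
    then show ?thesis unfolding detG ratio using c0 by simp
  qed
  finally have "det * ((Z1 ^ r * Z2 ^ s) ^ (k + 2) * ((?c powi E) ^ (k + 2) * G) * ratio) = \<dots>" .
  then show ?thesis
    unfolding rhs_term_def P x cc det_def[symmetric] by (simp add: divide_inverse mult_ac)
qed

end

section \<open>The main theorem\<close>

context qser
begin

text \<open>The last factor \<open>weight\<close> in \<open>rhs_term_eq\<close> provides the
  divisibility; all others are power series. Hence the sum over \<open>Qplus\<close> is finite in
  each coefficient.\<close>

lemma rhs_term_monom_ideal: "rhs_term q a b k (int r, int s - int r, - int s) \<in> monom_ideal r s"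
proof -
  have "Q.schur (Suc a) (Suc b) (int r) (int s) * weight r s ^ k * delta_coeff r s * (inverse A1 * inverse A3 * inverse A2) \<in> pser"
    by (intro pser_closed schur_pser pser_power weight_pser delta_coeff_pser A_inverse_pser)
  from weight_monom_ideal[OF this, of r s] show ?thesis
    unfolding rhs_term_eq delta_coeff_def by (simp add: divide_inverse mult_ac)
qed

lemma rhs_has_sum:
  assumes B: "m \<le> int B" "n \<le> int B"
  shows "((\<lambda>y. coeff2 (rhs_term q a b k y) m n) has_sum
    (\<Sum>(r, s)\<in>{..B} \<times> {..B}. coeff2 (rhs_term q a b k (int r, int s - int r, - int s)) m n)) Qplus"
proof -
  \<comment> \<open>The coordinates r = y_1 and s = y_1 + y_2 identify \<open>Qplus\<close> with the
    pairs of natural numbers.\<close>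
  define h :: "nat \<times> nat \<Rightarrow> int \<times> int \<times> int" where "h = (\<lambda>(r, s). (int r, int s - int r, - int s))"
  have inj: "inj h" by (auto simp: inj_on_def h_def)
  have "(\<Sum>(r, s)\<in>{..B} \<times> {..B}. coeff2 (rhs_term q a b k (int r, int s - int r, - int s)) m n) =
      (\<Sum>y\<in>h ` ({..B} \<times> {..B}). coeff2 (rhs_term q a b k y) m n)"
    by (subst sum.reindex) (auto simp: h_def case_prod_unfold intro: inj_on_subset[OF inj[unfolded h_def case_prod_unfold]])
  moreover have "((\<lambda>y. coeff2 (rhs_term q a b k y) m n) has_sum
      (\<Sum>y\<in>h ` ({..B} \<times> {..B}). coeff2 (rhs_term q a b k y) m n)) Qplus"
  proof (rule has_sum_finite_neutralI)
    show "h ` ({..B} \<times> {..B}) \<subseteq> Qplus" by (auto simp: h_def Qplus_def)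
    show "coeff2 (rhs_term q a b k y) m n = 0" if "y \<in> Qplus - h ` ({..B} \<times> {..B})" for y
    proof -
      obtain y1 y2 y3 where y: "y = (y1, y2, y3)" by (cases y)
      define r s where "r = nat y1" and "s = nat (y1 + y2)"
      have eq: "y = (int r, int s - int r, - int s)"
        using that by (auto simp: y r_def s_def Qplus_def)
      then have "y = h (r, s)" by (simp add: h_def)
      then have "B < r \<or> B < s" using that by (auto simp: not_le[symmetric])
      then have "m < int r \<or> n < int s" using B by linarith
      then show ?thesis unfolding eq by (rule coeff2_monom_ideal[OF rhs_term_monom_ideal])
    qed
  qed auto
  ultimately show ?thesis by simp
qed

end

theorem theorem1p4:
  fixes a b k :: nat and q :: complex
  assumes "a \<le> k" and "b \<le> k" and "0 < norm q" and "norm q < 1"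
  shows "\<forall>m n. \<exists>c.
           ((\<lambda>(l, u). coeff2 (lhs_term q a b k l u) m n) has_sum c) (Parts k \<times> Parts k)
         \<and> ((\<lambda>y. coeff2 (rhs_term q a b k y) m n) has_sum c) Qplus"
proof (intro allI)
  fix m n :: int
  interpret qser q using assms by unfold_locales
  define B where "B = nat m + nat n"
  have B: "m \<le> int B" "n \<le> int B" by (simp_all add: B_def)
  have "((\<lambda>y. coeff2 (rhs_term q a b k y) m n) has_sum
    (\<Sum>(r, s)\<in>{..B} \<times> {..B}. coeff2 (Q.schur (Suc a) (Suc b) (int r) (int s) * weight r s ^ k * delta_coeff r s * weight r s / (A1 * A3 * A2)) m n)) Qplus"
    using rhs_has_sum[OF B, of a b k] unfolding rhs_term_eq delta_coeff_def .
  with lhs_has_sum[OF assms(1,2) total_V_delta[OF assms(1,2) B]]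
  show "\<exists>c. ((\<lambda>(l, u). coeff2 (lhs_term q a b k l u) m n) has_sum c) (Parts k \<times> Parts k)
      \<and> ((\<lambda>y. coeff2 (rhs_term q a b k y) m n) has_sum c) Qplus"
    by blast
qed

end
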